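(* Let $K=\mathbb R\times[0,T]$, let $j\in\{1,2,3,4\}$, and let $D={D_V^U}^j\times D_{2\delta}^j$. Let $(F^0,G^0)\in D$ satisfy the minimality condition. Write $S=F^0+G^0$, $r_1=A_T^\top G^0+(C_T^0)^\top$, $r_2=A_T^\top F^0-(C_T^0)^\top$ (row vectors; all functions are evaluated at $(\lambda,\mu)$ unless another argument is shown). Suppose that $(F^0,G^0)$ satisfies the following relations for the given $j$, with some multipliers as described. ($j=1$) $$r_1^*r_1=(\alpha^2(\lambda)+\gamma_1+\gamma_2)S^2,\qquad r_2^*r_2=\beta^2(\lambda)\,\mathrm{Tr}(G^0-G_1)\,S^2,\qquad \frac1{2\pi}\int_{-\infty}^\infty|\mathrm{Tr}(G^0-G_1)|^2d\mu=\delta(\lambda),$$ where $\gamma_1\le0$, $\gamma_1=0$ if $\mathrm{Tr}F^0>\mathrm{Tr}V$; $\gamma_2\ge0$, $\gamma_2=0$ if $\mathrm{Tr}F^0<\mathrm{Tr}U$. ($j=2$) $$r_1^*r_1=S\{(\alpha_k^2(\lambda)+\gamma_{1k}+\gamma_{2k})\delta_{kl}\}_{k,l=1}^N S,\qquad r_2^*r_2=S\{\beta_k^2(\lambda)(g^0_{kk}-g^1_{kk})\delta_{kl}\}_{k,l=1}^N S,$$ $$\frac1{2\pi}\int_{-\infty}^\infty|g^0_{kk}-g^1_{kk}|^2d\mu=\delta_k(\lambda),\quad k=1,\dots,N,$$ where $\gamma_{1k}\le0$, $\gamma_{1k}=0$ if $f^0_{kk}>v_{kk}$; $\gamma_{2k}\ge0$,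 $\gamma_{2k}=0$ if $f^0_{kk}<u_{kk}$. ($j=3$) $$r_1^*r_1=(\alpha^2(\lambda)+\gamma_1'+\gamma_2')\,S B_1^\top S,\qquad r_2^*r_2=\beta^2(\lambda)\langle B_2,G^0-G_1\rangle S^2,\qquad \frac1{2\pi}\int_{-\infty}^\infty|\langle B_2,G^0-G_1\rangle|^2d\mu=\delta(\lambda),$$ where $\gamma_1'\le0$, $\gamma_1'=0$ if $\langle B_1,F^0\rangle>\langle B_1,V\rangle$; $\gamma_2'\ge0$, $\gamma_2'=0$ if $\langle B_1,F^0\rangle<\langle B_1,U\rangle$. ($j=4$) $$r_1^*r_1=S(\vec\alpha(\lambda)\vec\alpha(\lambda)^*+\Gamma_1+\Gamma_2)S,\qquad r_2^*r_2=S\{\beta_{ij}(\lambda)(g^0_{ij}-g^1_{ij})\}_{i,j=1}^N S,$$ $$\frac1{2\pi}\int_{-\infty}^\infty|g^0_{ij}-g^1_{ij}|^2d\mu=\delta_{ij}(\lambda),\quad i,j=1,\dots,N,$$ where $\Gamma_1\le0$, $\Gamma_1=0$ if $F^0>V$; $\Gamma_2\ge0$, $\Gamma_2=0$ if $F^0<U$. Suppose also that $(F^0,G^0)$ gives a solution to the constrained optimization problem $$\max_{(F,G)\in D}\int_{-\infty}^{\infty}\Big[\langle(\mathbf R_T\mathbf a)(\lambda,t),(\mathbf B_T^{-1}\mathbf R_T\mathbf a)(\lambda,t)\rangle+\langle(\mathbf Q_T\mathbf a)(\lambda,t),\vec a(\lambda,t)\rangle\Big]d\lambda$$ $$=\int_{-\infty}^{\infty}\Big[\langle(\mathbf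 R_T^0\mathbf a)(\lambda,t),((\mathbf B_T^0)^{-1}\mathbf R_T^0\mathbf a)(\lambda,t)\rangle+\langle(\mathbf Q_T^0\mathbf a)(\lambda,t),\vec a(\lambda,t)\rangle\Big]d\lambda .$$ Then $F^0,G^0$ are least favorable in the class $D$ for the optimal linear estimation of the functional $A_K\vec\xi$. Moreover, if $h(F^0,G^0)\in H_D$, the minimax-robust spectral characteristic of the optimal estimate of $A_K\vec\xi$ is $h^0=h(F^0,G^0)$, determined by $$(h^0)^\top=A_T^\top F^0(F^0+G^0)^{-1}-(C_T^0)^\top(F^0+G^0)^{-1}.$$
   Context: Setting. $\vec\xi(s,t)$ and $\vec\eta(s,t)$, $(s,t)\in\mathbb R^2$, are mutually uncorrelated $N$-dimensional homogeneous (mean-zero, mean-square continuous) random fields with spectral densities $F=\{f_{ij}\}$, $G=\{g_{ij}\}$ ($N\times N$ Hermitian nonnegative definite matrix functions of $(\lambda,\mu)\in\mathbb R^2$; covariance $=\frac1{4\pi^2}\iint e^{i(s\lambda+t\mu)}F\,d\lambda d\mu$, similarly for $G$). $K=\mathbb R\times[0,T]$, and $\vec a$ is a known vector function on $K$ such that $A_K\vec\xi=\iint_K\vec a(s,t)^\top\vec\xi(s,t)\,ds\,dt$ is well defined with finite second moment. The functional is estimated linearly from observations of $\vec\xi(s,t)+\vec\eta(s,t)$ at $(s,t)\in\mathbb R^2\setminus K$. Put $A_T(\lambda,\mu)=A_K(\lambda,\mu)=\iint_K\vec a(s,t)e^{i(s\lambda+t\mu)}\,ds\,dt$. $*$ denotes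 conjugate transpose. $L_2(F+G)$ is the Hilbert space of vector functions $h$ with $\iint h^\top(F+G)\overline{h}\,d\lambda d\mu<\infty$; $L_2^{K-}(F+G)$ is its closed subspace generated by $e^{i(s\lambda+t\mu)}\delta_k$, $(s,t)\in\mathbb R^2\setminus K$, $k=1,\dots,N$ ($\delta_k$ the standard basis vectors). A linear estimate is given by its spectral characteristic $h\in L_2^{K-}(F+G)$, and its mean square error is $$\Delta(h;F,G)=\frac1{4\pi^2}\iint\big[(A_K-h)^\top F\,\overline{(A_K-h)}+h^\top G\,\overline h\big]d\lambda d\mu .$$ $h(F,G)$ is the spectral characteristic of the optimal (minimal error) estimate, and $\Delta(F,G)=\Delta(h(F,G);F,G)$. Minimality condition for $(F,G)$: $\iint \vec b(\lambda,\mu)^\top(F+G)^{-1}\overline{\vec b(\lambda,\mu)}\,d\lambda d\mu<\infty$ for some nonzero $\vec b(\lambda,\mu)=\iint_K\vec b(s,t)e^{i(s\lambda+t\mu)}dsdt$. Operators. $\vec a(\lambda,t)=\int_{-\infty}^\infty\vec a(s,t)e^{is\lambda}ds$, also denoted $\mathbf a$ as the argument of an operator. For $\vec x(\lambda,t)$, $t\in[0,T]$, and a matrix function $M(\lambda,\mu)$ put $$(\mathbf T_M\mathbf x)(\lambda,t)=\frac1{2\pi}\int_0^T\int_{-\infty}^\infty\big[\vec x(\lambda,u)^\top M(\lambda,\mu)\big]^\top e^{i(u-t)\mu}\,d\mu\,du,\quad t\in[0,T].$$ Then $\mathbf B_T=\mathbf T_{(F+G)^{-1}}$, $\mathbf R_T=\mathbf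 T_{F(F+G)^{-1}}$, $\mathbf Q_T=\mathbf T_{F(F+G)^{-1}G}$; the superscript $0$ means $(F,G)=(F^0,G^0)$. $\langle\vec x(\lambda,t),\vec y(\lambda,t)\rangle=\int_0^T\vec x(\lambda,t)^\top\overline{\vec y(\lambda,t)}\,dt$. Further, $C_T^0(\lambda,\mu)=\int_0^T\vec c(\lambda,t)e^{it\mu}dt$ with $\vec c(\lambda,t)=((\mathbf B_T^0)^{-1}\mathbf R_T^0\mathbf a)(\lambda,t)$. Least favorable: $(F^0,G^0)\in D$ is least favorable in $D$ if $\Delta(F^0,G^0)=\max_{(F,G)\in D}\Delta(h(F,G);F,G)$. Minimax-robust: $h^0$ is minimax-robust if $h^0\in H_D=\bigcap_{(F,G)\in D}L_2^{K-}(F+G)$ and $\min_{h\in H_D}\max_{(F,G)\in D}\Delta(h;F,G)=\max_{(F,G)\in D}\Delta(h^0;F,G)$. Admissible classes. $V=\{v_{ij}\}$, $U=\{u_{ij}\}$, $G_1=\{g^1_{ij}\}$ are known fixed spectral densities; $p,p_k,\delta,\delta_k,\delta_{ij}$ are given functions of $\lambda$, $P(\lambda)$ a given matrix function; $B_1,B_2$ are fixed Hermitian $N\times N$ matrices; for matrices $\langle B,F\rangle=\sum_{k,l}b_{kl}f_{kl}$. Matrix inequalities are in the sense of Hermitian matrices. $F$ and $G$ below range over spectral densities, and conditions hold for all (almost all) arguments. - ${D_V^U}^1$: $\mathrm{Tr}V\le\mathrm{Tr}F\le\mathrm{Tr}U$, $\frac1{2\pi}\int\mathrm{Tr}F\,d\mu=p(\lambda)$.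 $D_{2\delta}^1$: $\frac1{2\pi}\int|\mathrm{Tr}(G-G_1)|^2d\mu\le\delta(\lambda)$. - ${D_V^U}^2$: $v_{kk}\le f_{kk}\le u_{kk}$, $\frac1{2\pi}\int f_{kk}d\mu=p_k(\lambda)$, $k=1,\dots,N$. $D_{2\delta}^2$: $\frac1{2\pi}\int|g_{kk}-g^1_{kk}|^2d\mu\le\delta_k(\lambda)$, $k=1,\dots,N$. - ${D_V^U}^3$: $\langle B_1,V\rangle\le\langle B_1,F\rangle\le\langle B_1,U\rangle$, $\frac1{2\pi}\int\langle B_1,F\rangle d\mu=p(\lambda)$. $D_{2\delta}^3$: $\frac1{2\pi}\int|\langle B_2,G-G_1\rangle|^2d\mu\le\delta(\lambda)$. - ${D_V^U}^4$: $V\le F\le U$, $\frac1{2\pi}\int F\,d\mu=P(\lambda)$. $D_{2\delta}^4$: $\frac1{2\pi}\int|g_{ij}-g^1_{ij}|^2d\mu\le\delta_{ij}(\lambda)$, $i,j=1,\dots,N$. (All integrals are over $\mu\in\mathbb R$.) Multipliers. $\alpha,\beta,\alpha_k,\beta_k$ are real functions of $\lambda$, $\beta_{ij}$ are functions of $\lambda$, $\vec\alpha(\lambda)$ is a column vector function of $\lambda$; $\gamma_1,\gamma_2,\gamma_{1k},\gamma_{2k},\gamma_1',\gamma_2'$ are real functions of $(\lambda,\mu)$; $\Gamma_1,\Gamma_2$ are Hermitian matrix functions of $(\lambda,\mu)$. $\delta_{kl}$ inside braces $\{\cdot\}_{k,l}$ is the Kronecker symbol. *)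

theory Defs
  imports "HOL-Analysis.Analysis"
begin

type_synonym 'n vfield = "real \<times> real \<Rightarrow> complex ^ 'n"
type_synonym 'n density = "real \<times> real \<Rightarrow> complex ^ 'n ^ 'n"

section \<open>Hermitian matrices\<close>

text \<open>\<open>sesq x M y\<close> is \<open>x\<^sup>T M y'\<close> with \<open>y'\<close> the entrywise conjugate of \<open>y\<close>.\<close>

definition sesq :: "complex ^ 'n \<Rightarrow> complex ^ 'n ^ 'n \<Rightarrow> complex ^ 'n \<Rightarrow> complex" where
  "sesq x M y = (\<Sum>i\<in>UNIV. \<Sum>j\<in>UNIV. x $ i * M $ i $ j * cnj (y $ j))"

definition hermitian :: "complex ^ 'n ^ 'n \<Rightarrow> bool" where
  "hermitian M \<longleftrightarrow> (\<forall>i j. M $ i $ j = cnj (M $ j $ i))"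

definition psd :: "complex ^ 'n ^ 'n \<Rightarrow> bool" where
  "psd M \<longleftrightarrow> hermitian M \<and> (\<forall>x. 0 \<le> Re (sesq x M x))"

definition posdef :: "complex ^ 'n ^ 'n \<Rightarrow> bool" where
  "posdef M \<longleftrightarrow> hermitian M \<and> (\<forall>x. x \<noteq> 0 \<longrightarrow> 0 < Re (sesq x M x))"

text \<open>The order of Hermitian matrices.  The name avoids the componentwise order that
  the library puts on vectors.\<close>

definition herm_le :: "complex ^ 'n ^ 'n \<Rightarrow> complex ^ 'n ^ 'n \<Rightarrow> bool" where
  "herm_le A B \<longleftrightarrow> psd (B - A)"

definition herm_less :: "complex ^ 'n ^ 'n \<Rightarrow> complex ^ 'n ^ 'n \<Rightarrow> bool" where
  "herm_less A B \<longleftrightarrow> posdef (B - A)"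

text \<open>The next two quantities are only used for Hermitian arguments, where the complex number
  under \<open>Re\<close> is real.\<close>

definition tr :: "complex ^ 'n ^ 'n \<Rightarrow> real" where
  "tr M = Re (trace M)"

definition mat_ip :: "complex ^ 'n ^ 'n \<Rightarrow> complex ^ 'n ^ 'n \<Rightarrow> real" where
  "mat_ip B M = Re (\<Sum>k\<in>UNIV. \<Sum>l\<in>UNIV. B $ k $ l * M $ k $ l)"

definition diag_mat :: "('n \<Rightarrow> complex) \<Rightarrow> complex ^ 'n ^ 'n" where
  "diag_mat d = (\<chi> k l. if k = l then d k else 0)"

text \<open>\<open>star_self r\<close> is \<open>r\<^sup>* r\<close> for a row vector \<open>r\<close>, and \<open>self_star v\<close> is \<open>v v\<^sup>*\<close> for a
  column vector \<open>v\<close>.\<close>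

definition star_self :: "complex ^ 'n \<Rightarrow> complex ^ 'n ^ 'n" where
  "star_self r = (\<chi> k l. cnj (r $ k) * r $ l)"

definition self_star :: "complex ^ 'n \<Rightarrow> complex ^ 'n ^ 'n" where
  "self_star v = (\<chi> k l. v $ k * cnj (v $ l))"


section \<open>Spectral densities and the interpolation problem\<close>

text \<open>Integrability is finiteness of the covariance at the origin.\<close>

definition spectral_density :: "'n::finite density \<Rightarrow> bool" where
  "spectral_density F \<longleftrightarrow> integrable lborel F \<and> (AE z in lborel. psd (F z))"

definition strip :: "real \<Rightarrow> (real \<times> real) set" where
  "strip T = UNIV \<times> {0..T}"

text \<open>\<open>A\<^sub>K(\<lambda>,\<mu>)\<close>, the Fourier transform of \<open>a\<close> restricted to the strip.\<close>

definition AK :: "real \<Rightarrow> 'n::finite vfield \<Rightarrow> 'n vfield" where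
  "AK T a z = (LINT w:strip T|lborel. cis (fst w * fst z + snd w * snd z) *s a w)"

definition L2 :: "'n::finite density \<Rightarrow> 'n vfield set" where
  "L2 S = {h \<in> borel_measurable lborel.
     (\<integral>\<^sup>+z. ennreal (Re (sesq (h z) (S z) (h z))) \<partial>lborel) < \<infinity>}"

text \<open>The complex linear span of the \<open>e\<^sup>i\<^sup>(\<^sup>s\<^sup>\<lambda>\<^sup>+\<^sup>t\<^sup>\<mu>\<^sup>) \<delta>\<^sub>k\<close> with \<open>(s,t)\<close> outside the strip; the \<open>N\<close>
  coefficients that belong to the same \<open>(s,t)\<close> are collected in the vector \<open>v (s,t)\<close>.\<close>

definition trig_span :: "real \<Rightarrow> 'n::finite vfield set" where
  "trig_span T = {h. \<exists>W v. finite W \<and> W \<subseteq> - strip T \<and>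
     h = (\<lambda>z. \<Sum>w\<in>W. cis (fst w * fst z + snd w * snd z) *s v w)}"

definition L2K :: "real \<Rightarrow> 'n::finite density \<Rightarrow> 'n vfield set" where
  "L2K T S = {h \<in> L2 S. \<forall>\<epsilon>>0. \<exists>g\<in>trig_span T.
     (\<integral>\<^sup>+z. ennreal (Re (sesq (h z - g z) (S z) (h z - g z))) \<partial>lborel) < ennreal \<epsilon>}"

definition mse :: "real \<Rightarrow> 'n::finite vfield \<Rightarrow> 'n vfield \<Rightarrow> 'n density \<Rightarrow> 'n density \<Rightarrow> ennreal" where
  "mse T a h F G = ennreal (1 / (4 * pi\<^sup>2)) *
     (\<integral>\<^sup>+z. ennreal (Re (sesq (AK T a z - h z) (F z) (AK T a z - h z))
        + Re (sesq (h z) (G z) (h z))) \<partial>lborel)"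

text \<open>\<open>h\<close> is (a version of) \<open>h(F,G)\<close>.  It is a predicate because \<open>h(F,G)\<close> is
  only determined as an element of \<open>L\<^sub>2(F+G)\<close>.\<close>

definition optimal_char ::
    "real \<Rightarrow> 'n::finite vfield \<Rightarrow> 'n density \<Rightarrow> 'n density \<Rightarrow> 'n vfield \<Rightarrow> bool" where
  "optimal_char T a F G h \<longleftrightarrow> h \<in> L2K T (\<lambda>z. F z + G z) \<and>
     (\<forall>h'\<in>L2K T (\<lambda>z. F z + G z). mse T a h F G \<le> mse T a h' F G)"

definition minimality :: "real \<Rightarrow> 'n::finite density \<Rightarrow> 'n density \<Rightarrow> bool" where
  "minimality T F G \<longleftrightarrow> (AE z in lborel. invertible (F z + G z)) \<and>
     (\<exists>b. set_integrable lborel (strip T) b \<and> AK T b \<noteq> (\<lambda>z. 0) \<and>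
       (\<integral>\<^sup>+z. ennreal (Re (sesq (AK T b z) (matrix_inv (F z + G z)) (AK T b z))) \<partial>lborel) < \<infinity>)"


section \<open>The operators\<close>

text \<open>\<open>partial_ft a (\<lambda>,t)\<close> is \<open>a(\<lambda>,t)\<close>; for \<open>x(\<lambda>,t)\<close>, \<open>strip_ft T x (\<lambda>,\<mu>)\<close> is the integral of
  \<open>x(\<lambda>,t) e\<^sup>i\<^sup>t\<^sup>\<mu>\<close> over \<open>0 \<le> t \<le> T\<close>.\<close>

definition partial_ft :: "'n::finite vfield \<Rightarrow> 'n vfield" where
  "partial_ft a z = (LINT s|lborel. cis (s * fst z) *s a (s, snd z))"

definition strip_ft :: "real \<Rightarrow> 'n::finite vfield \<Rightarrow> 'n vfield" where
  "strip_ft T x z = (LINT t:{0..T}|lborel. cis (t * snd z) *s x (fst z, t))"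

definition ip :: "real \<Rightarrow> 'n::finite vfield \<Rightarrow> 'n vfield \<Rightarrow> real \<Rightarrow> complex" where
  "ip T x y l = (LINT t:{0..T}|lborel. (\<Sum>k\<in>UNIV. x (l, t) $ k * cnj (y (l, t) $ k)))"

definition T_op :: "real \<Rightarrow> 'n::finite density \<Rightarrow> 'n vfield \<Rightarrow> 'n vfield" where
  "T_op T M x z = (1 / (2 * pi)) *\<^sub>R (LINT u:{0..T}|lborel. LINT \<mu>|lborel.
     cis ((u - snd z) * \<mu>) *s (x (fst z, u) v* M (fst z, \<mu>)))"

text \<open>The inner integral of \<open>T_op\<close> need not converge: already for \<open>N = 1\<close> the density \<open>F + G\<close> is
  integrable, so \<open>(F + G)\<^sup>-\<^sup>1\<close> is not, by the Cauchy--Schwarz inequality.  Thus \<open>T\<^sub>M x\<close> is a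
  generalized function of \<open>t\<close>, given by its pairings \<open>\<langle>T\<^sub>M x, y\<rangle>\<close> with functions \<open>y(\<lambda>,t)\<close>.  Carrying out
  the integrals over \<open>u\<close> and \<open>t\<close> before the one over \<open>\<mu>\<close> turns the pairing into the integral below;
  \<open>ip_T_op\<close> and \<open>ip_T_op_swapped\<close> show that it agrees with \<open>ip\<close> when one of the two orders of
  integration makes \<open>T\<^sub>M x\<close> a function.\<close>

definition T_pair :: "real \<Rightarrow> 'n::finite density \<Rightarrow> 'n vfield \<Rightarrow> 'n vfield \<Rightarrow> real \<Rightarrow> complex" where
  "T_pair T M x y l = complex_of_real (1 / (2 * pi)) *
     (LINT \<mu>|lborel. sesq (strip_ft T x (l, \<mu>)) (M (l, \<mu>)) (strip_ft T y (l, \<mu>)))"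

lemma fubini_kernel:
  fixes v w :: "real \<Rightarrow> complex" and k :: "real \<Rightarrow> real \<Rightarrow> complex"
  assumes v: "integrable lborel v" and w: "integrable lborel w"
    and k: "(\<lambda>(t, m). k t m) \<in> borel_measurable (lborel \<Otimes>\<^sub>M lborel)"
    and k1: "\<And>t m. norm (k t m) \<le> 1"
  shows "(LINT t|lborel. LINT m|lborel. k t m * v t * w m) =
    (LINT m|lborel. LINT t|lborel. k t m * v t * w m)"
    and "integrable lborel (\<lambda>m. LINT t|lborel. k t m * v t * w m)"
    and "integrable lborel (\<lambda>t. LINT m|lborel. k t m * v t * w m)"
proof -
  have vm: "v \<in> borel_measurable lborel" and wm: "w \<in> borel_measurable lborel"
    using v w by auto
  have i0: "integrable (lborel \<Otimes>\<^sub>M lborel) (\<lambda>(t, m). v t * w m)"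
    by (intro lborel_pair.Fubini_integrable) (use v w vm wm in \<open>auto simp: norm_mult\<close>)
  have i: "integrable (lborel \<Otimes>\<^sub>M lborel) (\<lambda>(t, m). k t m * v t * w m)"
    apply (rule Bochner_Integration.integrable_bound[OF i0])
    subgoal using vm wm k by measurable
    subgoal by (auto simp: norm_mult split_beta intro!: AE_I2 mult_right_mono mult_left_le_one_le k1)
    done
  show "(LINT t|lborel. LINT m|lborel. k t m * v t * w m) =
    (LINT m|lborel. LINT t|lborel. k t m * v t * w m)"
    using lborel_pair.Fubini_integral[OF i] by simp
  show "integrable lborel (\<lambda>m. LINT t|lborel. k t m * v t * w m)"
    using lborel_pair.integrable_snd[OF i] by simp
  show "integrable lborel (\<lambda>t. LINT m|lborel. k t m * v t * w m)"
    using lborel_pair.integrable_fst[OF i] by simp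
qed

lemma int_nth: "integrable M f \<Longrightarrow> (LINT x|M. f x) $ i = (LINT x|M. (f x :: complex ^ 'n::finite) $ i)"
  using integral_bounded_linear[OF bounded_linear_vec_nth] by metis

lemma bounded_linear_axis: "bounded_linear (axis i :: complex \<Rightarrow> complex ^ 'n::finite)"
  by (intro linear_conv_bounded_linear[THEN iffD1] linearI) (auto simp: vec_eq_iff axis_def)

lemma integrable_nth: "integrable M f \<longleftrightarrow> (\<forall>i. integrable M (\<lambda>x. (f x :: complex ^ 'n::finite) $ i))"
proof
  assume "\<forall>i. integrable M (\<lambda>x. f x $ i)"
  then have "integrable M (\<lambda>x. \<Sum>i\<in>UNIV. (axis i (f x $ i) :: complex ^ 'n))"
    by (intro Bochner_Integration.integrable_sum) 
      (auto intro!: integrable_bounded_linear[where T="axis i" for i] simp: bounded_linear_axis)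
  moreover have "(\<Sum>i\<in>UNIV. (axis i (f x $ i) :: complex ^ 'n)) = f x" for x
    by (simp add: vec_eq_iff axis_def sum.delta)
  ultimately show "integrable M f" by simp
qed (auto intro: integrable_bounded_linear[OF bounded_linear_vec_nth])


lemmas vsc = scaleR_conv_of_real[where 'a = complex]

lemma set_integrable_nth:
  fixes f :: "real \<Rightarrow> complex ^ 'n::finite"
  assumes "set_integrable lborel A f"
  shows "integrable lborel (\<lambda>t. indicator A t * f t $ i)"
  using assms unfolding set_integrable_def integrable_nth
  by (simp add: vsc of_real_indicator)

lemma integrable_cis_mult:
  assumes "integrable lborel v"
  shows "integrable lborel (\<lambda>t. cis (t * m) * v t)"
proof (rule Bochner_Integration.integrable_bound[OF assms])
  show "(\<lambda>t. cis (t * m) * v t) \<in> borel_measurable lborel"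
    unfolding cis_conv_exp using borel_measurable_integrable[OF assms] by measurable
qed (simp add: norm_mult)

lemma strip_ft_nth:
  fixes x :: "'n::finite vfield"
  assumes "set_integrable lborel {0..T} (\<lambda>t. x (l, t))"
  shows "strip_ft T x (l, m) $ i = (LINT t|lborel. cis (t * m) * (indicator {0..T} t * x (l, t) $ i))"
proof -
  note * = integrable_cis_mult[OF set_integrable_nth[OF assms]]
  have "integrable lborel (\<lambda>t. indicator {0..T} t *\<^sub>R (cis (t * m) *s x (l, t)))"
    unfolding integrable_nth using * by (simp add: vsc of_real_indicator mult.left_commute)
  from int_nth[OF this] show ?thesis
    unfolding strip_ft_def set_lebesgue_integral_def
    by (simp add: vsc of_real_indicator mult.left_commute)
qed

lemma cis_kernel:
  "(\<lambda>(t, m). cis (t * m)) \<in> borel_measurable (lborel \<Otimes>\<^sub>M lborel)"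
  "(\<lambda>(t, m). cis (- (t * m))) \<in> borel_measurable (lborel \<Otimes>\<^sub>M lborel)"
  "(\<lambda>(t, m). cis ((t - c) * m)) \<in> borel_measurable (lborel \<Otimes>\<^sub>M lborel)"
  unfolding cis_conv_exp by measurable

lemma ip_T_op_swapped:
  fixes x y :: "'n::finite vfield" and M :: "'n density"
  assumes w: "integrable lborel (\<lambda>\<mu>. strip_ft T x (l, \<mu>) v* M (l, \<mu>))"
    and y: "set_integrable lborel {0..T} (\<lambda>t. y (l, t))"
    and g: "\<And>t. t \<in> {0..T} \<Longrightarrow> g (l, t) =
      (1 / (2 * pi)) *\<^sub>R (LINT \<mu>|lborel. cis (- (t * \<mu>)) *s (strip_ft T x (l, \<mu>) v* M (l, \<mu>)))"
  shows "ip T g y l = T_pair T M x y l"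
proof -
  define w where "w = (\<lambda>\<mu>. strip_ft T x (l, \<mu>) v* M (l, \<mu>))"
  have wi: "integrable lborel (\<lambda>\<mu>. w \<mu> $ k)" for k
    using assms(1) unfolding integrable_nth w_def by auto
  define v where "v = (\<lambda>k t. cnj (indicator {0..T} t * y (l, t) $ k))"
  have vi: "integrable lborel (v k)" for k
    unfolding v_def using set_integrable_nth[OF y] by (subst integrable_cnj) auto
  note F = fubini_kernel[OF vi wi cis_kernel(2), simplified]
  have cw: "integrable lborel (\<lambda>m. cis (- (t * m)) * w m $ k)" for t k
    using integrable_cis_mult[OF wi[of k], of "- t"] by (simp add: mult.commute)
  have gk: "g (l, t) $ k = complex_of_real (1 / (2 * pi)) * (LINT m|lborel. cis (- (t * m)) * w m $ k)"
    if "t \<in> {0..T}" for t k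
  proof -
    have "integrable lborel (\<lambda>m. cis (- (t * m)) *s w m)"
      unfolding integrable_nth using cw by simp
    from int_nth[OF this] g[OF that] show ?thesis
      by (simp add: w_def vsc)
  qed
  have S1: "(\<Sum>k\<in>UNIV. (LINT t|lborel. cis (- (t * m)) * v k t * w m $ k))
      = sesq (strip_ft T x (l, m)) (M (l, m)) (strip_ft T y (l, m))" for m
  proof -
    have "(LINT t|lborel. cis (- (t * m)) * v k t * w m $ k) = w m $ k * cnj (strip_ft T y (l, m) $ k)" for k
    proof -
      have "w m $ k * cnj (strip_ft T y (l, m) $ k) =
          w m $ k * (LINT t|lborel. cnj (cis (t * m) * (indicator {0..T} t * y (l, t) $ k)))"
        unfolding strip_ft_nth[OF y] by (simp only: Bochner_Integration.integral_cnj)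
      also have "\<dots> = (LINT t|lborel. w m $ k * cnj (cis (t * m) * (indicator {0..T} t * y (l, t) $ k)))"
        by (simp only: integral_mult_right_zero)
      finally show ?thesis unfolding v_def by (auto simp: cis_cnj mult_ac)
    qed
    then show ?thesis
      unfolding sesq_def w_def vector_matrix_mult_def
      by (subst sum.swap) (simp add: sum_distrib_right sum_distrib_left mult_ac)
  qed
  have "ip T g y l = (LINT t|lborel. (\<Sum>k\<in>UNIV. complex_of_real (1 / (2 * pi)) *
      (LINT m|lborel. cis (- (t * m)) * v k t * w m $ k)))"
    unfolding ip_def set_lebesgue_integral_def
  proof (intro Bochner_Integration.integral_cong refl, goal_cases)
    case (1 t)
    have "(LINT m|lborel. cis (- (t * m)) * v k t * w m $ k)
       = v k t * (LINT m|lborel. cis (- (t * m)) * w m $ k)" for k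
      by (subst integral_mult_right_zero[symmetric]) (simp add: mult_ac)
    then show ?case using gk[of t]
      by (cases "t \<in> {0..T}") (auto simp: v_def mult_ac)
  qed
  also have "\<dots> = complex_of_real (1 / (2 * pi)) * (\<Sum>k\<in>UNIV. LINT t|lborel. 
      (LINT m|lborel. cis (- (t * m)) * v k t * w m $ k))"
    using F(3) by (subst Bochner_Integration.integral_sum) (auto simp: sum_distrib_left simp del: of_real_divide of_real_mult)
  also have "\<dots> = complex_of_real (1 / (2 * pi)) * (\<Sum>k\<in>UNIV. LINT m|lborel. 
      (LINT t|lborel. cis (- (t * m)) * v k t * w m $ k))"
    using F(1) by simp
  also have "\<dots> = complex_of_real (1 / (2 * pi)) * (LINT m|lborel. (\<Sum>k\<in>UNIV. 
      (LINT t|lborel. cis (- (t * m)) * v k t * w m $ k)))"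
    using F(2) by (subst Bochner_Integration.integral_sum) auto
  finally show ?thesis unfolding S1 T_pair_def .
qed

lemma ip_T_op:
  fixes x y :: "'n::finite vfield" and M :: "'n density"
  assumes M: "integrable lborel (\<lambda>\<mu>. M (l, \<mu>))"
    and x: "set_integrable lborel {0..T} (\<lambda>t. x (l, t))"
    and y: "set_integrable lborel {0..T} (\<lambda>t. y (l, t))"
  shows "ip T (T_op T M x) y l = T_pair T M x y l"
proof (rule ip_T_op_swapped[OF _ y])
  have Mi: "integrable lborel (\<lambda>\<mu>. M (l, \<mu>) $ i $ j)" for i j
    using integrable_bounded_linear[OF bounded_linear_vec_nth[of j] integrable_bounded_linear[OF bounded_linear_vec_nth[of i] M]] .
  define v where "v = (\<lambda>k t. indicator {0..T} t * x (l, t) $ k)"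
  have vi: "integrable lborel (v k)" for k
    unfolding v_def using set_integrable_nth[OF x] by auto
  have X: "strip_ft T x (l, m) $ i = (LINT t|lborel. cis (t * m) * v i t)" for m i
    unfolding strip_ft_nth[OF x] v_def ..
  have XM: "(strip_ft T x (l, m) v* M (l, m)) $ j =
      (\<Sum>i\<in>UNIV. LINT t|lborel. cis (t * m) * v i t * M (l, m) $ i $ j)" for m j
    by (simp add: vector_matrix_mult_def X mult.commute)
  show "integrable lborel (\<lambda>\<mu>. strip_ft T x (l, \<mu>) v* M (l, \<mu>))"
    unfolding integrable_nth XM
    using fubini_kernel(2)[OF vi Mi cis_kernel(1)] by (auto intro!: Bochner_Integration.integrable_sum)
  then have XMi: "integrable lborel (\<lambda>\<mu>. (strip_ft T x (l, \<mu>) v* M (l, \<mu>)) $ j)" for j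
    unfolding integrable_nth by auto
  fix t
  note F = fubini_kernel[OF vi Mi cis_kernel(3)[of t], simplified]
  have i1: "integrable lborel (\<lambda>m. cis ((u - t) * m) * (x (l, u) $ i * M (l, m) $ i $ j))" for u i j
    using integrable_cis_mult[OF integrable_mult_right[OF Mi[of i j], of "x (l, u) $ i"], of "u - t"]
    by (simp add: mult_ac)
  have i2: "integrable lborel (\<lambda>m. cis ((u - t) * m) *s (x (l, u) v* M (l, m)))" for u
    unfolding integrable_nth using i1
    by (auto simp: vector_matrix_mult_def sum_distrib_left mult_ac intro!: Bochner_Integration.integrable_sum)
  have inner: "indicator {0..T} u * (LINT m|lborel. cis ((u - t) * m) *s (x (l, u) v* M (l, m))) $ j
     = (\<Sum>i\<in>UNIV. LINT m|lborel. cis ((u - t) * m) * v i u * M (l, m) $ i $ j)" for u j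
    unfolding int_nth[OF i2]
    using i1[of u _ j] by (auto simp: vector_matrix_mult_def sum_distrib_left v_def indicator_def mult_ac
        intro!: Bochner_Integration.integral_sum)
  have outer_i: "integrable lborel (\<lambda>u. indicator {0..T} u *\<^sub>R (LINT m|lborel. cis ((u - t) * m) *s (x (l, u) v* M (l, m))))"
    unfolding integrable_nth using F(3)
    by (auto simp: vsc of_real_indicator inner intro!: Bochner_Integration.integrable_sum)
  have rhs_i: "integrable lborel (\<lambda>\<mu>. cis (- (t * \<mu>)) *s (strip_ft T x (l, \<mu>) v* M (l, \<mu>)))"
    unfolding integrable_nth using integrable_cis_mult[OF XMi, of "- t"] by (simp add: mult.commute)
  have "(LINT u:{0..T}|lborel. LINT \<mu>|lborel. cis ((u - t) * \<mu>) *s (x (l, u) v* M (l, \<mu>)))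
      = (LINT \<mu>|lborel. cis (- (t * \<mu>)) *s (strip_ft T x (l, \<mu>) v* M (l, \<mu>)))"
  proof (subst vec_eq_iff, intro allI)
    fix j
    have S2: "(\<Sum>i\<in>UNIV. LINT u|lborel. cis ((u - t) * m) * v i u * M (l, m) $ i $ j)
       = cis (- (t * m)) * (strip_ft T x (l, m) v* M (l, m)) $ j" for m
    proof -
      have "cis ((u - t) * m) * v i u * M (l, m) $ i $ j
        = cis (- (t * m)) * (cis (u * m) * v i u * M (l, m) $ i $ j)" for u i
        by (simp add: cis_mult left_diff_distrib flip: mult.assoc)
      then show ?thesis unfolding XM sum_distrib_left by (simp only: integral_mult_right_zero)
    qed
    have "(LINT u:{0..T}|lborel. LINT \<mu>|lborel. cis ((u - t) * \<mu>) *s (x (l, u) v* M (l, \<mu>))) $ j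
       = (LINT u|lborel. (\<Sum>i\<in>UNIV. LINT m|lborel. cis ((u - t) * m) * v i u * M (l, m) $ i $ j))"
      unfolding set_lebesgue_integral_def int_nth[OF outer_i]
      by (simp add: vsc of_real_indicator inner)
    also have "\<dots> = (\<Sum>i\<in>UNIV. LINT m|lborel. LINT u|lborel. cis ((u - t) * m) * v i u * M (l, m) $ i $ j)"
      using F by (subst Bochner_Integration.integral_sum) auto
    also have "\<dots> = (LINT m|lborel. (\<Sum>i\<in>UNIV. LINT u|lborel. cis ((u - t) * m) * v i u * M (l, m) $ i $ j))"
      using F by (subst Bochner_Integration.integral_sum) auto
    finally show "(LINT u:{0..T}|lborel. LINT \<mu>|lborel. cis ((u - t) * \<mu>) *s (x (l, u) v* M (l, \<mu>))) $ j
      = (LINT \<mu>|lborel. cis (- (t * \<mu>)) *s (strip_ft T x (l, \<mu>) v* M (l, \<mu>))) $ j"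
      unfolding int_nth[OF rhs_i] S2 by simp
  qed
  then show "T_op T M x (l, t) =
      (1 / (2 * pi)) *\<^sub>R (LINT \<mu>|lborel. cis (- (t * \<mu>)) *s (strip_ft T x (l, \<mu>) v* M (l, \<mu>)))"
    by (simp add: T_op_def)
qed

definition B_pair where
  "B_pair T F G = T_pair T (\<lambda>z. matrix_inv (F z + G z))"

definition R_pair where
  "R_pair T F G = T_pair T (\<lambda>z. F z ** matrix_inv (F z + G z))"

definition Q_pair where
  "Q_pair T F G = T_pair T (\<lambda>z. F z ** matrix_inv (F z + G z) ** G z)"

text \<open>The functions \<open>y(\<lambda>,t)\<close> with finite energy, that is, the form domain of \<open>B\<^sub>T\<close>.\<close>

definition energy_space :: "real \<Rightarrow> 'n::finite density \<Rightarrow> 'n vfield set" where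
  "energy_space T S = {y. set_borel_measurable lborel (strip T) y \<and>
     (AE l in lborel. set_integrable lborel {0..T} (\<lambda>t. y (l, t))) \<and>
     (\<integral>\<^sup>+z. ennreal (Re (sesq (strip_ft T y z) (matrix_inv (S z)) (strip_ft T y z))) \<partial>lborel) < \<infinity>}"

text \<open>\<open>c = B\<^sub>T\<^sup>-\<^sup>1 R\<^sub>T a\<close>, as the solution of \<open>B\<^sub>T c = R\<^sub>T a\<close>.  It is unique up to null sets,
  since \<open>\<langle>B\<^sub>T c, c\<rangle> = 0\<close> forces \<open>c = 0\<close> when \<open>F + G\<close> is positive definite.\<close>

definition BinvRa ::
    "real \<Rightarrow> 'n::finite vfield \<Rightarrow> 'n density \<Rightarrow> 'n density \<Rightarrow> 'n vfield \<Rightarrow> bool" where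
  "BinvRa T a F G c \<longleftrightarrow> c \<in> energy_space T (\<lambda>z. F z + G z) \<and>
     (\<forall>y\<in>energy_space T (\<lambda>z. F z + G z).
       AE l in lborel. B_pair T F G c y l = R_pair T F G (partial_ft a) y l)"

text \<open>The objective, with \<open>c\<close> in place of \<open>B\<^sub>T\<^sup>-\<^sup>1 R\<^sub>T a\<close>; both pairings are real.\<close>

definition objective ::
    "real \<Rightarrow> 'n::finite vfield \<Rightarrow> 'n density \<Rightarrow> 'n density \<Rightarrow> 'n vfield \<Rightarrow> real" where
  "objective T a F G c = (LINT l|lborel.
     Re (R_pair T F G (partial_ft a) c l + Q_pair T F G (partial_ft a) (partial_ft a) l))"

text \<open>The maximum runs over the pairs in \<open>D\<close> for which the objective is meaningful.\<close>

definition solves_problem ::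
    "('n::finite density \<times> 'n density) set \<Rightarrow> real \<Rightarrow> 'n vfield \<Rightarrow>
      'n density \<Rightarrow> 'n density \<Rightarrow> 'n vfield \<Rightarrow> bool" where
  "solves_problem D T a F0 G0 c0 \<longleftrightarrow> (F0, G0) \<in> D \<and> BinvRa T a F0 G0 c0 \<and>
     (\<forall>(F, G)\<in>D. \<forall>c. (AE z in lborel. invertible (F z + G z)) \<and> BinvRa T a F G c \<longrightarrow>
       objective T a F G c \<le> objective T a F0 G0 c0)"


section \<open>Least favorable densities and minimax-robust characteristics\<close>

definition least_favorable ::
    "('n::finite density \<times> 'n density) set \<Rightarrow> real \<Rightarrow> 'n vfield \<Rightarrow> 'n density \<Rightarrow> 'n density \<Rightarrow> bool" where
  "least_favorable D T a F0 G0 \<longleftrightarrow> (F0, G0) \<in> D \<and>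
     (\<exists>h0. optimal_char T a F0 G0 h0 \<and>
       (\<forall>(F, G)\<in>D. \<forall>h. optimal_char T a F G h \<longrightarrow> mse T a h F G \<le> mse T a h0 F0 G0))"

definition H_class :: "('n::finite density \<times> 'n density) set \<Rightarrow> real \<Rightarrow> 'n vfield set" where
  "H_class D T = {h. \<forall>(F, G)\<in>D. h \<in> L2K T (\<lambda>z. F z + G z)}"

text \<open>The maximum over \<open>D\<close> is attained for \<open>h0\<close>; for the competitors \<open>h\<close> it is a supremum.\<close>

definition minimax_robust ::
    "('n::finite density \<times> 'n density) set \<Rightarrow> real \<Rightarrow> 'n vfield \<Rightarrow> 'n vfield \<Rightarrow> bool" where
  "minimax_robust D T a h0 \<longleftrightarrow> h0 \<in> H_class D T \<and>
     (\<exists>(F1, G1)\<in>D. \<forall>(F, G)\<in>D. mse T a h0 F G \<le> mse T a h0 F1 G1) \<and>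
     (\<forall>h\<in>H_class D T. (SUP (F, G)\<in>D. mse T a h0 F G) \<le> (SUP (F, G)\<in>D. mse T a h F G))"


section \<open>Admissible classes\<close>

definition mean_mu :: "(real \<times> real \<Rightarrow> 'b::{banach, second_countable_topology}) \<Rightarrow> real \<Rightarrow> 'b" where
  "mean_mu f l = (1 / (2 * pi)) *\<^sub>R (LINT \<mu>|lborel. f (l, \<mu>))"

text \<open>Integrability is stated separately because a divergent integral has value \<open>0\<close>.\<close>

definition dev_le :: "(real \<times> real \<Rightarrow> real) \<Rightarrow> (real \<Rightarrow> real) \<Rightarrow> bool" where
  "dev_le f d \<longleftrightarrow> (AE l in lborel. integrable lborel (\<lambda>\<mu>. (f (l, \<mu>))\<^sup>2) \<and>
     mean_mu (\<lambda>z. (f z)\<^sup>2) l \<le> d l)"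

definition DVU1 :: "'n::finite density \<Rightarrow> 'n density \<Rightarrow> (real \<Rightarrow> real) \<Rightarrow> 'n density set" where
  "DVU1 V U p = {F. spectral_density F \<and>
     (AE z in lborel. tr (V z) \<le> tr (F z) \<and> tr (F z) \<le> tr (U z)) \<and>
     (AE l in lborel. mean_mu (\<lambda>z. tr (F z)) l = p l)}"

definition D2d1 :: "'n::finite density \<Rightarrow> (real \<Rightarrow> real) \<Rightarrow> 'n density set" where
  "D2d1 G1 d = {G. spectral_density G \<and> dev_le (\<lambda>z. \<bar>tr (G z - G1 z)\<bar>) d}"

definition DVU2 :: "'n::finite density \<Rightarrow> 'n density \<Rightarrow> ('n \<Rightarrow> real \<Rightarrow> real) \<Rightarrow> 'n density set" where
  "DVU2 V U p = {F. spectral_density F \<and> (\<forall>k.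
     (AE z in lborel. Re (V z $ k $ k) \<le> Re (F z $ k $ k) \<and> Re (F z $ k $ k) \<le> Re (U z $ k $ k)) \<and>
     (AE l in lborel. mean_mu (\<lambda>z. Re (F z $ k $ k)) l = p k l))}"

definition D2d2 :: "'n::finite density \<Rightarrow> ('n \<Rightarrow> real \<Rightarrow> real) \<Rightarrow> 'n density set" where
  "D2d2 G1 d = {G. spectral_density G \<and> (\<forall>k. dev_le (\<lambda>z. cmod (G z $ k $ k - G1 z $ k $ k)) (d k))}"

definition DVU3 ::
    "complex ^ 'n ^ 'n \<Rightarrow> 'n::finite density \<Rightarrow> 'n density \<Rightarrow> (real \<Rightarrow> real) \<Rightarrow> 'n density set" where
  "DVU3 B V U p = {F. spectral_density F \<and>
     (AE z in lborel. mat_ip B (V z) \<le> mat_ip B (F z) \<and> mat_ip B (F z) \<le> mat_ip B (U z)) \<and>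
     (AE l in lborel. mean_mu (\<lambda>z. mat_ip B (F z)) l = p l)}"

definition D2d3 ::
    "complex ^ 'n ^ 'n \<Rightarrow> 'n::finite density \<Rightarrow> (real \<Rightarrow> real) \<Rightarrow> 'n density set" where
  "D2d3 B G1 d = {G. spectral_density G \<and> dev_le (\<lambda>z. \<bar>mat_ip B (G z - G1 z)\<bar>) d}"

definition DVU4 ::
    "'n::finite density \<Rightarrow> 'n density \<Rightarrow> (real \<Rightarrow> complex ^ 'n ^ 'n) \<Rightarrow> 'n density set" where
  "DVU4 V U P = {F. spectral_density F \<and>
     (AE z in lborel. herm_le (V z) (F z) \<and> herm_le (F z) (U z)) \<and>
     (AE l in lborel. mean_mu F l = P l)}"

definition D2d4 :: "'n::finite density \<Rightarrow> ('n \<Rightarrow> 'n \<Rightarrow> real \<Rightarrow> real) \<Rightarrow> 'n density set" where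
  "D2d4 G1 d = {G. spectral_density G \<and>
     (\<forall>i j. dev_le (\<lambda>z. cmod (G z $ i $ j - G1 z $ i $ j)) (d i j))}"


section \<open>Relations for the least favorable densities\<close>

definition r1 :: "real \<Rightarrow> 'n::finite vfield \<Rightarrow> 'n density \<Rightarrow> 'n vfield \<Rightarrow> 'n vfield" where
  "r1 T a G0 c0 z = AK T a z v* G0 z + strip_ft T c0 z"

definition r2 :: "real \<Rightarrow> 'n::finite vfield \<Rightarrow> 'n density \<Rightarrow> 'n vfield \<Rightarrow> 'n vfield" where
  "r2 T a F0 c0 z = AK T a z v* F0 z - strip_ft T c0 z"

definition relations1 where
  "relations1 T (a :: 'n::finite vfield) V U G1 d F0 G0 c0 \<longleftrightarrow>
    (\<exists>(\<alpha> :: real \<Rightarrow> real) (\<beta> :: real \<Rightarrow> real)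
      (\<gamma>1 :: real \<times> real \<Rightarrow> real) (\<gamma>2 :: real \<times> real \<Rightarrow> real).
      (AE z in lborel.
        let S = F0 z + G0 z in
        star_self (r1 T a G0 c0 z) = ((\<alpha> (fst z))\<^sup>2 + \<gamma>1 z + \<gamma>2 z) *\<^sub>R (S ** S) \<and>
        star_self (r2 T a F0 c0 z) = ((\<beta> (fst z))\<^sup>2 * tr (G0 z - G1 z)) *\<^sub>R (S ** S) \<and>
        \<gamma>1 z \<le> 0 \<and> (tr (V z) < tr (F0 z) \<longrightarrow> \<gamma>1 z = 0) \<and>
        0 \<le> \<gamma>2 z \<and> (tr (F0 z) < tr (U z) \<longrightarrow> \<gamma>2 z = 0)) \<and>
      (AE l in lborel. mean_mu (\<lambda>z. \<bar>tr (G0 z - G1 z)\<bar>\<^sup>2) l = d l))"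

definition relations2 where
  "relations2 T (a :: 'n::finite vfield) V U G1 d F0 G0 c0 \<longleftrightarrow>
    (\<exists>(\<alpha> :: 'n \<Rightarrow> real \<Rightarrow> real) (\<beta> :: 'n \<Rightarrow> real \<Rightarrow> real)
      (\<gamma>1 :: 'n \<Rightarrow> real \<times> real \<Rightarrow> real) (\<gamma>2 :: 'n \<Rightarrow> real \<times> real \<Rightarrow> real).
      (AE z in lborel.
        let S = F0 z + G0 z in
        star_self (r1 T a G0 c0 z) =
          S ** diag_mat (\<lambda>k. complex_of_real ((\<alpha> k (fst z))\<^sup>2 + \<gamma>1 k z + \<gamma>2 k z)) ** S \<and>
        star_self (r2 T a F0 c0 z) =
          S ** diag_mat (\<lambda>k. complex_of_real ((\<beta> k (fst z))\<^sup>2) * (G0 z $ k $ k - G1 z $ k $ k)) ** S \<and>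
        (\<forall>k. \<gamma>1 k z \<le> 0 \<and> (Re (V z $ k $ k) < Re (F0 z $ k $ k) \<longrightarrow> \<gamma>1 k z = 0) \<and>
          0 \<le> \<gamma>2 k z \<and> (Re (F0 z $ k $ k) < Re (U z $ k $ k) \<longrightarrow> \<gamma>2 k z = 0))) \<and>
      (\<forall>k. AE l in lborel. mean_mu (\<lambda>z. (cmod (G0 z $ k $ k - G1 z $ k $ k))\<^sup>2) l = d k l))"

definition relations3 where
  "relations3 B1 B2 T (a :: 'n::finite vfield) V U G1 d F0 G0 c0 \<longleftrightarrow>
    (\<exists>(\<alpha> :: real \<Rightarrow> real) (\<beta> :: real \<Rightarrow> real)
      (\<gamma>1 :: real \<times> real \<Rightarrow> real) (\<gamma>2 :: real \<times> real \<Rightarrow> real).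
      (AE z in lborel.
        let S = F0 z + G0 z in
        star_self (r1 T a G0 c0 z) =
          ((\<alpha> (fst z))\<^sup>2 + \<gamma>1 z + \<gamma>2 z) *\<^sub>R (S ** transpose B1 ** S) \<and>
        star_self (r2 T a F0 c0 z) = ((\<beta> (fst z))\<^sup>2 * mat_ip B2 (G0 z - G1 z)) *\<^sub>R (S ** S) \<and>
        \<gamma>1 z \<le> 0 \<and> (mat_ip B1 (V z) < mat_ip B1 (F0 z) \<longrightarrow> \<gamma>1 z = 0) \<and>
        0 \<le> \<gamma>2 z \<and> (mat_ip B1 (F0 z) < mat_ip B1 (U z) \<longrightarrow> \<gamma>2 z = 0)) \<and>
      (AE l in lborel. mean_mu (\<lambda>z. \<bar>mat_ip B2 (G0 z - G1 z)\<bar>\<^sup>2) l = d l))"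

definition relations4 where
  "relations4 T (a :: 'n::finite vfield) V U G1 d F0 G0 c0 \<longleftrightarrow>
    (\<exists>(\<alpha> :: real \<Rightarrow> complex ^ 'n) (\<beta> :: 'n \<Rightarrow> 'n \<Rightarrow> real \<Rightarrow> complex)
      (\<Gamma>1 :: 'n density) (\<Gamma>2 :: 'n density).
      (AE z in lborel.
        let S = F0 z + G0 z in
        star_self (r1 T a G0 c0 z) = S ** (self_star (\<alpha> (fst z)) + \<Gamma>1 z + \<Gamma>2 z) ** S \<and>
        star_self (r2 T a F0 c0 z) =
          S ** (\<chi> i j. \<beta> i j (fst z) * (G0 z $ i $ j - G1 z $ i $ j)) ** S \<and>
        hermitian (\<Gamma>1 z) \<and> herm_le (\<Gamma>1 z) 0 \<and> (herm_less (V z) (F0 z) \<longrightarrow> \<Gamma>1 z = 0) \<and>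
        hermitian (\<Gamma>2 z) \<and> herm_le 0 (\<Gamma>2 z) \<and> (herm_less (F0 z) (U z) \<longrightarrow> \<Gamma>2 z = 0)) \<and>
      (\<forall>i j. AE l in lborel. mean_mu (\<lambda>z. (cmod (G0 z $ i $ j - G1 z $ i $ j))\<^sup>2) l = d i j l))"

end

theory Submission
  imports Defs "HOL-Probability.Characteristic_Functions"
begin

text \<open>Write \<open>S = F + G\<close>. With \<open>w\<^sup>T = A\<^sub>T\<^sup>T F S\<^sup>-\<^sup>1\<close>, completing the square turns the error of \<open>h\<close> into a constant
  plus the squared distance from \<open>h\<close> to \<open>w\<close> in \<open>L\<^sub>2(S)\<close>, so the optimal characteristic is the projection of \<open>w\<close>
  onto the closed span of the exponentials outside the strip. A function \<open>x\<close> is orthogonal to these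
  exponentials iff, for almost every \<open>\<lambda>\<close>, \<open>x\<^sup>T S\<close> is the Fourier transform in \<open>t\<close> of a function living on
  \<open>[0,T]\<close>; hence \<open>(w - h)\<^sup>T = C\<^sup>T S\<^sup>-\<^sup>1\<close> with \<open>C\<close> the transform of some \<open>c\<close>, where
  orthogonality says exactly that \<open>B\<^sub>T c = R\<^sub>T a\<close>, and the minimal error
  is the objective of the optimization problem divided by \<open>2 \<pi>\<close>.

  The class \<open>D\<close> is convex and the error is affine in \<open>(F,G)\<close>. A pair in \<open>D\<close> whose sum is singular is mixed
  with \<open>(F0,G0)\<close>, which makes the sum invertible. Let \<open>h\<^sub>\<epsilon>\<close> be optimal for the mixture with weight \<open>\<epsilon>\<close> on
  \<open>(F,G)\<close>: maximality of the objective bounds its error at \<open>(F,G)\<close> by the optimal error at \<open>(F0,G0)\<close>,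
  and forces \<open>h\<^sub>\<epsilon>\<close> to converge to \<open>h(F0,G0)\<close> in \<open>L\<^sub>2(F0 + G0)\<close>, at rate \<open>\<epsilon>\<close> for the squared norm. Fatou's lemma
  then gives the saddle point inequality.\<close>

section \<open>Fourier inversion on the line\<close>

text \<open>The obstacle is that two norms are involved: the \<open>h\<^sub>\<epsilon>\<close>
  converge in \<open>L\<^sub>2(F0 + G0)\<close>, which gives no control in the norm of another pair.
  What passes from one pair to the other is convergence almost everywhere, as all densities are
  taken against the same Lebesgue measure; hence Fatou's lemma. The rate \<epsilon> comes from
  dropping the error at (F,G) from the affine identity: (1 - \<epsilon>) (M + \<kappa> N) \<le> M,
  with M the optimal error at (F0,G0), N the squared distance and \<kappa> = 1/(4 pi^2). Along
  weights that decrease geometrically, the whole sequence then converges almost everywhere. The same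
  device gives completeness, since elements of \<open>L2\<close> are functions and not classes;
  invertibility of the density turns small forms into small vectors. Orthogonality is a single
  integral over the plane, whereas the operator equation holds for almost every \<lambda>. The
  unboundedness of K in s closes the gap: if t lies outside [0,T], every s is available, and a slice
  integral whose Fourier transform in \<lambda> vanishes is zero almost everywhere.\<close>

lemma AE_zero_if_interval_integrals_zero:
  fixes f :: "real \<Rightarrow> complex"
  assumes f: "\<And>N. set_integrable lborel {-real N..real N} f"
    and z: "\<And>a b. (LINT x:{a..b}|lborel. f x) = 0"
  shows "AE x in lborel. f x = 0"
proof -
  \<comment> \<open>The cutoff makes the function integrable on the line. Local integrability is
    what is available later, for the difference of an integrable and a bounded function.\<close>
  have *: "AE x in lborel. indicator {-real N..real N} x *\<^sub>R f x = 0" for N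
  proof (rule sigma_finite_measure.density_zero[OF sigma_finite_lborel])
    let ?f = "\<lambda>x. indicator {-real N..real N} x *\<^sub>R f x"
    show i: "integrable lborel ?f" using f[of N] by (simp add: set_integrable_def)
    have si: "set_integrable lborel A ?f" if "A \<in> sets borel" for A
      unfolding set_integrable_def using integrable_mult_indicator[OF _ i, of A] that by simp
    have int: "(LINT x:{a..b}|lborel. ?f x) = 0" for a b
    proof -
      have "(LINT x:{a..b}|lborel. ?f x) = (LINT x:{max a (-real N)..min b (real N)}|lborel. f x)"
        unfolding set_lebesgue_integral_def
        by (intro Bochner_Integration.integral_cong) (auto simp: indicator_def)
      then show ?thesis using z by simp
    qed
    have all: "(LINT x|lborel. ?f x) = 0"
    proof -
      have "(LINT x:{-real N..real N}|lborel. ?f x) = (LINT x|lborel. ?f x)"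
        unfolding set_lebesgue_integral_def
        by (intro Bochner_Integration.integral_cong) (auto simp: indicator_def)
      then show ?thesis using int by simp
    qed
    fix A :: "real set" assume "A \<in> sets lborel"
    then have A: "A \<in> sigma_sets UNIV (range (\<lambda>(a, b). {a..b}))"
      by (simp add: borel_eq_atLeastAtMost)
    \<comment> \<open>Closed intervals, the empty ones included, form an intersection-stable
      generator of the Borel sets, so vanishing on them spreads to all Borel sets by Dynkin
      induction.\<close>
    have G: "Int_stable (range (\<lambda>(a, b). {a..b :: real}))" "range (\<lambda>(a, b). {a..b :: real}) \<subseteq> Pow UNIV"
      by (auto simp: Int_stable_def)
    from G A show "(LINT x:A|lborel. ?f x) = 0"
    proof (induction rule: sigma_sets_induct_disjoint)
      case (basic A) then show ?case using int by auto
    next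
      case empty show ?case by (simp add: set_lebesgue_integral_def)
    next
      case (compl A)
      then have A: "A \<in> sets borel" by (simp add: borel_eq_atLeastAtMost)
      have "(LINT x:UNIV - A|lborel. ?f x) = (LINT x|lborel. ?f x - indicator A x *\<^sub>R ?f x)"
        unfolding set_lebesgue_integral_def
        by (intro Bochner_Integration.integral_cong) (auto simp: indicator_def)
      also have "\<dots> = (LINT x|lborel. ?f x) - (LINT x:A|lborel. ?f x)"
        using si[OF A] i unfolding set_lebesgue_integral_def set_integrable_def
        by (intro Bochner_Integration.integral_diff)
      finally show ?case using all compl by simp
    next
      case (union A)
      have A: "\<And>i. A i \<in> sets borel" using union(2) by (auto simp: borel_eq_atLeastAtMost)
      have "(LINT x:(\<Union>i. A i)|lborel. ?f x) = (\<Sum>i. LINT x:A i|lborel. ?f x)"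
      proof (rule lebesgue_integral_countable_add)
        show "set_integrable lborel (\<Union>i. A i) ?f" by (rule si) (use A in auto)
        show "A i \<in> sets lborel" for i using A by simp
        show "A i \<inter> A j = {}" if "i \<noteq> j" for i j using union(1) that by (auto simp: disjoint_family_on_def)
      qed
      then show ?case using union by simp
    qed
  qed
  then have "AE x in lborel. \<forall>N. indicator {-real N..real N} x *\<^sub>R f x = 0"
    by (subst AE_all_countable) blast
  then show ?thesis
  proof eventually_elim
    case (elim x)
    obtain N where "\<bar>x\<bar> \<le> real N" using real_arch_simple by blast
    then have "x \<in> {-real N..real N}" by auto
    then show ?case using elim[rule_format, of N] by simp
  qed
qed

text \<open>A restatement of the characteristic function of the normal law with the Gaussian on both
  sides: up to a constant it is its own transform, so one function serves as mollifier in m and as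
  convergence factor in t.\<close>

lemma std_normal_fourier:
  "(LINT u|lborel. cis (t * u) * complex_of_real (std_normal_density u))
     = complex_of_real (sqrt (2 * pi) * std_normal_density t)"
proof -
  have "char std_normal_distribution t = (LINT u|lborel. std_normal_density u *\<^sub>R cis (t * u))"
    unfolding char_def by (subst integral_density) (auto simp: cis_conv_exp mult_ac)
  then have "(LINT u|lborel. std_normal_density u *\<^sub>R cis (t * u)) = complex_of_real (exp (- (t\<^sup>2) / 2))"
    by (metis char_std_normal_distribution)
  then show ?thesis by (simp add: vsc mult_ac std_normal_density_def)
qed

text \<open>Gaussian summation. Convolving \<open>f\<close> with a Gaussian of width
  \<open>e k\<close> equals the inversion integral of \<open>F\<close> damped by
  \<open>n (e k * t)\<close>, and the latter tends to \<open>Y\<close> pointwise by dominated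
  convergence. On the side of \<open>f\<close> only integrals over intervals are compared, so the
  mollifier can be moved onto the indicator, and no approximation of \<open>f\<close> in mean is
  required.\<close>

lemma fourier_inversion:
  fixes f F :: "real \<Rightarrow> complex"
  assumes f: "integrable lborel f"
    and F: "integrable lborel F"
    and Fdef: "\<And>t. F t = (LINT m|lborel. cis (- (t * m)) * f m)"
  shows "AE m in lborel. f m = complex_of_real (1 / (2 * pi)) * (LINT t|lborel. cis (t * m) * F t)"
proof -
  note [measurable] = borel_measurable_integrable[OF f] borel_measurable_integrable[OF F]
  define Y where "Y = (\<lambda>m. complex_of_real (1 / (2 * pi)) * (LINT t|lborel. cis (t * m) * F t))"
  define n where "n = (\<lambda>u. complex_of_real (std_normal_density u))"
  \<comment> \<open>The bound 1 is what \<open>fubini_kernel\<close> demands of a kernel; it also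
    gives the dominating function for the damped integrals.\<close>
  have n1: "norm (n u) \<le> 1" for u
  proof -
    have "1 \<le> sqrt (2 * pi)" using pi_gt3 by (simp add: real_le_rsqrt)
    moreover have "exp (- u\<^sup>2 / 2) \<le> 1" by simp
    ultimately have "exp (- u\<^sup>2 / 2) / sqrt (2 * pi) \<le> 1 / 1" by (intro frac_le) auto
    then have "std_normal_density u \<le> 1" by (simp add: std_normal_density_def)
    then show ?thesis unfolding n_def norm_of_real using normal_density_nonneg[of 0 1 u] by simp
  qed
  have [measurable]: "n \<in> borel_measurable borel" unfolding n_def by simp
  have ni: "integrable lborel n" unfolding n_def by simp
  have ni': "integrable lborel (\<lambda>u. n (c * u))" if "c \<noteq> 0" for c
    using lborel_integrable_real_affine[OF ni that, of 0] by simp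
  define e where "e = (\<lambda>k. 1 / (real k + 1))"
  have e: "e k > 0" "e \<longlonglongrightarrow> 0" for k
    using LIMSEQ_inverse_real_of_nat unfolding e_def by (auto simp: inverse_eq_divide add.commute)
  have nf: "n ((m - x) / e k) = complex_of_real (e k / sqrt (2 * pi)) *
      (LINT t|lborel. cis (t * (x - m)) * n (e k * t))" for m x k
  proof -
    have "n ((m - x) / e k) = complex_of_real (1 / sqrt (2 * pi)) * (LINT s|lborel. cis ((m - x) / e k * s) * n s)"
      unfolding n_def std_normal_fourier by simp
    \<comment> \<open>The substitution s = - e k t; evenness of the Gaussian absorbs the sign inside
      \<open>n\<close>.\<close>
    also have "(LINT s|lborel. cis ((m - x) / e k * s) * n s) =
        \<bar>- e k\<bar> *\<^sub>R (LINT t|lborel. cis ((m - x) / e k * (0 + (- e k) * t)) * n (0 + (- e k) * t))"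
      using e(1)[of k] by (intro lborel_integral_real_affine) auto
    also have "(\<lambda>t. cis ((m - x) / e k * (0 + (- e k) * t)) * n (0 + (- e k) * t)) = (\<lambda>t. cis (t * (x - m)) * n (e k * t))"
    proof
      fix t
      have "(m - x) / e k * (0 + (- e k) * t) = t * (x - m)"
        using e(1)[of k] by (simp add: field_simps)
      then show "cis ((m - x) / e k * (0 + (- e k) * t)) * n (0 + (- e k) * t) = cis (t * (x - m)) * n (e k * t)"
        by (simp add: n_def std_normal_density_def)
    qed
    finally show ?thesis using e(1)[of k] by (simp add: vsc)
  qed
  have smooth: "(LINT m|lborel. n ((m - x) / e k) * f m) =
      complex_of_real (e k / sqrt (2 * pi)) * (LINT t|lborel. cis (t * x) * n (e k * t) * F t)" for x k
  proof -
    have m: "(\<lambda>(m, t). cis (t * (x - m))) \<in> borel_measurable (lborel \<Otimes>\<^sub>M lborel)"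
      unfolding cis_conv_exp by measurable
    have "(LINT m|lborel. n ((m - x) / e k) * f m) =
      complex_of_real (e k / sqrt (2 * pi)) * (LINT m|lborel. LINT t|lborel. cis (t * (x - m)) * f m * n (e k * t))"
      unfolding nf by (subst integral_mult_right_zero[symmetric], intro Bochner_Integration.integral_cong refl,
          subst integral_mult_right_zero[symmetric], subst integral_mult_left_zero[symmetric]) (simp add: mult_ac)
    also have "(LINT m|lborel. LINT t|lborel. cis (t * (x - m)) * f m * n (e k * t)) =
       (LINT t|lborel. LINT m|lborel. cis (t * (x - m)) * f m * n (e k * t))"
      using e(1)[of k] by (intro fubini_kernel(1)[OF f ni' m]) auto
    also have "\<dots> = (LINT t|lborel. cis (t * x) * n (e k * t) * F t)"
    proof (intro Bochner_Integration.integral_cong refl)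
      fix t
      have "cis (t * (x - m)) * f m * n (e k * t) = cis (t * x) * n (e k * t) * (cis (- (t * m)) * f m)" for m
      proof -
        have "cis (t * (x - m)) = cis (t * x) * cis (- (t * m))"
          by (simp add: cis_mult right_diff_distrib)
        then show ?thesis by (simp only: mult_ac)
      qed
      then show "(LINT m|lborel. cis (t * (x - m)) * f m * n (e k * t)) = cis (t * x) * n (e k * t) * F t"
        unfolding Fdef by (simp only: integral_mult_right_zero)
    qed
    finally show ?thesis .
  qed
  have cisF[measurable]: "(\<lambda>x. LINT t|lborel. cis (t * x) * F t) \<in> borel_measurable borel"
    unfolding cis_conv_exp by measurable
  have Ym[measurable]: "Y \<in> borel_measurable borel" unfolding Y_def by measurable
  have cisi: "integrable lborel (\<lambda>t. cis (t * x) * F t)" for x by (rule integrable_cis_mult[OF F])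
  define CF where "CF = (LINT t|lborel. norm (F t))"
  have Yb: "norm (Y x) \<le> CF" for x
  proof -
    have "norm (LINT t|lborel. cis (t * x) * F t) \<le> (LINT t|lborel. norm (cis (t * x) * F t))"
      by (rule integral_norm_bound)
    then have "norm (LINT t|lborel. cis (t * x) * F t) \<le> CF" by (simp add: norm_mult CF_def)
    moreover have "norm (Y x) \<le> 1 * norm (LINT t|lborel. cis (t * x) * F t)"
      unfolding Y_def norm_mult norm_of_real using pi_gt3 by (intro mult_right_mono) (auto simp: divide_simps)
    ultimately show ?thesis by simp
  qed
  have CF0: "CF \<ge> 0" unfolding CF_def by simp
  have lim_n: "(\<lambda>k. n (e k * t)) \<longlonglongrightarrow> n 0" for t
  proof -
    have "isCont n 0" unfolding n_def std_normal_density_def by (intro continuous_intros) auto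
    moreover have "(\<lambda>k. e k * t) \<longlonglongrightarrow> 0" using tendsto_mult_left_zero[OF e(2)] by simp
    ultimately show ?thesis using isCont_tendsto_compose by blast
  qed
  define g where "g = (\<lambda>k x. complex_of_real (1 / sqrt (2 * pi)) * (LINT t|lborel. cis (t * x) * n (e k * t) * F t))"
  have cm[measurable]: "(\<lambda>t. cis (t * x)) \<in> borel_measurable borel" for x
    unfolding cis_conv_exp by measurable
  have gbd: "norm (cis (t * x) * n (e k * t) * F t) \<le> norm (F t)" for t x k
    using mult_right_mono[OF n1[of "e k * t"], of "norm (F t)"] by (simp add: norm_mult)
  have gi: "integrable lborel (\<lambda>t. cis (t * x) * n (e k * t) * F t)" for x k
    by (rule Bochner_Integration.integrable_bound[OF F]) (use gbd in auto)
  have g_lim: "(\<lambda>k. g k x) \<longlonglongrightarrow> Y x" for x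
  proof -
    have "(\<lambda>k. LINT t|lborel. cis (t * x) * n (e k * t) * F t) \<longlonglongrightarrow> (LINT t|lborel. cis (t * x) * n 0 * F t)"
      by (rule integral_dominated_convergence[where w="\<lambda>t. norm (F t)"])
        (use F gbd in \<open>auto intro!: tendsto_intros lim_n\<close>)
    moreover have "(LINT t|lborel. cis (t * x) * n 0 * F t) = n 0 * (LINT t|lborel. cis (t * x) * F t)"
      by (subst integral_mult_right_zero[symmetric]) (simp add: mult_ac)
    moreover have n0: "complex_of_real (1 / sqrt (2 * pi)) * n 0 = complex_of_real (1 / (2 * pi))"
    proof -
      have "1 / sqrt (2 * pi) * (1 / sqrt (2 * pi)) = 1 / (2 * pi)"
        using pi_gt_zero by (simp add: mult_ac)
      then show ?thesis unfolding n_def std_normal_density_def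
        by (metis (no_types) mult.right_neutral of_real_mult exp_zero minus_zero power_zero_numeral div_0)
    qed
    ultimately have "(\<lambda>k. complex_of_real (1 / sqrt (2 * pi)) * (LINT t|lborel. cis (t * x) * n (e k * t) * F t))
        \<longlonglongrightarrow> complex_of_real (1 / sqrt (2 * pi)) * (n 0 * (LINT t|lborel. cis (t * x) * F t))"
      by (intro tendsto_mult_left) simp
    then show ?thesis unfolding g_def Y_def mult.assoc[symmetric] n0 .
  qed
  have gb: "norm (g k x) \<le> CF" for k x
  proof -
    have "norm (LINT t|lborel. cis (t * x) * n (e k * t) * F t) \<le> (LINT t|lborel. norm (cis (t * x) * n (e k * t) * F t))"
      by (rule integral_norm_bound)
    also have "\<dots> \<le> CF" unfolding CF_def
      using gi gbd F by (intro integral_mono) auto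
    finally have 1: "norm (LINT t|lborel. cis (t * x) * n (e k * t) * F t) \<le> CF" .
    have "norm (g k x) \<le> 1 * norm (LINT t|lborel. cis (t * x) * n (e k * t) * F t)"
      unfolding g_def norm_mult norm_of_real using pi_gt3 by (intro mult_right_mono) (auto simp: divide_simps real_le_rsqrt)
    then show ?thesis using 1 by simp
  qed
  have indi: "integrable lborel (\<lambda>x. indicator {a..b} x * CF)" for a b :: real
    by (intro integrable_mult_left) (auto simp: integrable_indicator_iff emeasure_lborel_Icc_eq)
  have gm[measurable]: "g k \<in> borel_measurable borel" for k
    unfolding g_def cis_conv_exp by measurable
  have "(LINT x:{a..b}|lborel. f x) = (LINT x:{a..b}|lborel. Y x)" for a b
  proof -
    have c1: "(\<lambda>k. LINT x:{a..b}|lborel. g k x) \<longlonglongrightarrow> (LINT x:{a..b}|lborel. Y x)"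
      unfolding set_lebesgue_integral_def
    proof (rule integral_dominated_convergence[where w="\<lambda>x. indicator {a..b} x * CF"])
      show "integrable lborel (\<lambda>x. indicator {a..b} x * CF)" by (rule indi)
    qed (auto simp: indicator_def gb intro!: g_lim)
    \<comment> \<open>The mollified indicator of [a,b]. It stays bounded by 1 and converges to the
      indicator off the two end points, which form a null set.\<close>
    define Ph where "Ph = (\<lambda>k m. LINT u|lborel. indicator {a..b} (m - e k * u) *\<^sub>R n u)"
    have Ph1: "norm (Ph k m) \<le> 1" for k m
    proof -
      have "norm (Ph k m) \<le> (LINT u|lborel. norm (indicator {a..b} (m - e k * u) *\<^sub>R n u))"
        unfolding Ph_def by (rule integral_norm_bound)
      also have "\<dots> \<le> (LINT u|lborel. std_normal_density u)"
      proof (intro integral_mono)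
        show i: "integrable lborel (\<lambda>u. std_normal_density u)" by simp
        have le: "norm (indicator {a..b} (m - e k * u) *\<^sub>R n u) \<le> std_normal_density u" for u
          using normal_density_nonneg[of 0 1 u] unfolding n_def norm_scaleR norm_of_real by (simp add: indicator_def)
        then show "norm (indicator {a..b} (m - e k * u) *\<^sub>R n u) \<le> std_normal_density u" for u .
        show "integrable lborel (\<lambda>u. norm (indicator {a..b} (m - e k * u) *\<^sub>R n u))"
        proof (rule Bochner_Integration.integrable_bound[OF i])
          show "AE u in lborel. norm (norm (indicator {a..b} (m - e k * u) *\<^sub>R n u)) \<le> norm (std_normal_density u)"
            using le by (intro AE_I2) (auto intro: order_trans)
        qed measurable
      qed
      also have "\<dots> = 1" by simp
      finally show ?thesis .
    qed
    have Phm[measurable]: "Ph k \<in> borel_measurable borel" for k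
      unfolding Ph_def by measurable
    have Phl: "(\<lambda>k. Ph k m) \<longlonglongrightarrow> indicator {a..b} m" if "m \<noteq> a" "m \<noteq> b" for m
    proof -
      have "(\<lambda>k. Ph k m) \<longlonglongrightarrow> (LINT u|lborel. indicator {a..b} m *\<^sub>R n u)"
        unfolding Ph_def
      proof (rule integral_dominated_convergence[where w="\<lambda>t. norm (n t)"])
        show "AE u in lborel. (\<lambda>k. indicator {a..b} (m - e k * u) *\<^sub>R n u) \<longlonglongrightarrow> indicator {a..b} m *\<^sub>R n u"
        proof (intro AE_I2 tendsto_intros)
          fix u
          have l: "(\<lambda>k. m - e k * u) \<longlonglongrightarrow> m"
            using tendsto_diff[OF tendsto_const[of m] tendsto_mult_left_zero[OF e(2)], of u] by simp
          have "m \<notin> frontier {a..b}" using that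
            by (auto simp: frontier_def interior_atLeastAtMost_real)
          then have "isCont (indicator {a..b} :: real \<Rightarrow> real) m" by (simp add: isCont_indicator)
          then show "(\<lambda>k. indicator {a..b} (m - e k * u) :: real) \<longlonglongrightarrow> indicator {a..b} m"
            using l isCont_tendsto_compose by blast
        qed
      qed (use ni in \<open>auto simp: indicator_def\<close>)
      moreover have "(LINT u|lborel. n u) = 1"
      proof -
        have "(LINT u|lborel. n u) = complex_of_real (LINT u|lborel. std_normal_density u)"
          unfolding n_def by (rule integral_complex_of_real)
        also have "\<dots> = 1" by simp
        finally show ?thesis .
      qed
      ultimately show ?thesis by (simp add: vsc of_real_indicator)
    qed
    have eq: "(LINT x:{a..b}|lborel. g k x) = (LINT m|lborel. Ph k m * f m)" for k
    proof -
      have g': "g k x = complex_of_real (1 / e k) * (LINT m|lborel. n ((m - x) / e k) * f m)" for x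
        unfolding smooth g_def using e(1)[of k] by simp
      have m: "(\<lambda>(m, x). n ((m - x) / e k)) \<in> borel_measurable (lborel \<Otimes>\<^sub>M lborel)"
        by measurable
      have "integrable lborel (\<lambda>x. indicator {a..b} x :: real)"
        by (auto simp: integrable_indicator_iff emeasure_lborel_Icc_eq)
      then have ii: "integrable lborel (\<lambda>x. indicator {a..b} x :: complex)"
        using integrable_of_real[where 'a=complex] by (fastforce simp: of_real_indicator)
      have "(LINT x:{a..b}|lborel. g k x) = complex_of_real (1 / e k) *
        (LINT x|lborel. LINT m|lborel. n ((m - x) / e k) * f m * indicator {a..b} x)"
      proof -
        have "(LINT m|lborel. n ((m - x) / e k) * f m * indicator {a..b} x) =
          (LINT m|lborel. n ((m - x) / e k) * f m) * indicator {a..b} x" for x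
          by (rule integral_mult_left_zero)
        then have "indicator {a..b} x *\<^sub>R g k x = complex_of_real (1 / e k) *
            (LINT m|lborel. n ((m - x) / e k) * f m * indicator {a..b} x)" for x
          by (simp add: g' vsc of_real_indicator mult_ac)
        then show ?thesis unfolding set_lebesgue_integral_def by (simp only: integral_mult_right_zero)
      qed
      also have "(LINT x|lborel. LINT m|lborel. n ((m - x) / e k) * f m * indicator {a..b} x) =
        (LINT m|lborel. LINT x|lborel. n ((m - x) / e k) * f m * indicator {a..b} x)"
        by (rule fubini_kernel(1)[OF f ii m n1, symmetric])
      also have "complex_of_real (1 / e k) * (LINT m|lborel. LINT x|lborel. n ((m - x) / e k) * f m * indicator {a..b} x) =
        (LINT m|lborel. complex_of_real (1 / e k) * (LINT x|lborel. n ((m - x) / e k) * f m * indicator {a..b} x))"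
        by (rule integral_mult_right_zero[symmetric])
      also have "\<dots> = (LINT m|lborel. Ph k m * f m)"
      proof (intro Bochner_Integration.integral_cong refl)
        fix m
        have "(LINT x|lborel. n ((m - x) / e k) * f m * indicator {a..b} x) =
          \<bar>- e k\<bar> *\<^sub>R (LINT u|lborel. n ((m - (m + (- e k) * u)) / e k) * f m * indicator {a..b} (m + (- e k) * u))"
          using e(1)[of k] by (intro lborel_integral_real_affine) auto
        also have "(LINT u|lborel. n ((m - (m + (- e k) * u)) / e k) * f m * indicator {a..b} (m + (- e k) * u))
          = (LINT u|lborel. indicator {a..b} (m - e k * u) *\<^sub>R n u * f m)"
          using e(1)[of k] by (intro Bochner_Integration.integral_cong refl) (auto simp: vsc of_real_indicator)
        also have "\<dots> = Ph k m * f m" unfolding Ph_def by (rule integral_mult_left_zero)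
        finally show "complex_of_real (1 / e k) * (LINT x|lborel. n ((m - x) / e k) * f m * indicator {a..b} x) = Ph k m * f m"
          using e(1)[of k] by (simp add: vsc)
      qed
      finally show ?thesis .
    qed
    have "(\<lambda>k. LINT m|lborel. Ph k m * f m) \<longlonglongrightarrow> (LINT m|lborel. indicator {a..b} m *\<^sub>R f m)"
    proof (rule integral_dominated_convergence[where w="\<lambda>t. norm (f t)"])
      have "AE m in lborel. m \<noteq> a \<and> m \<noteq> b" by (auto intro: AE_lborel_singleton)
      then show "AE m in lborel. (\<lambda>k. Ph k m * f m) \<longlonglongrightarrow> indicator {a..b} m *\<^sub>R f m"
      proof eventually_elim
        case (elim m)
        then show ?case using tendsto_mult_right[OF Phl[of m], of "f m"] by (simp add: vsc of_real_indicator)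
      qed
    qed (use f mult_right_mono[OF Ph1] in \<open>auto simp: norm_mult intro!: AE_I2\<close>)
    from LIMSEQ_unique[OF this c1[unfolded eq]] show ?thesis unfolding set_lebesgue_integral_def .
  qed note fY = this
  have sf: "set_integrable lborel {a..b} f" for a b
    using f by (auto simp: set_integrable_def intro!: integrable_mult_indicator)
  have sY: "set_integrable lborel {a..b} Y" for a b
    unfolding set_integrable_def
    by (rule Bochner_Integration.integrable_bound[where f="\<lambda>x. indicator {a..b} x * CF"])
      (use Yb CF0 indi in \<open>auto simp: indicator_def\<close>)
  have "AE x in lborel. f x - Y x = 0"
    using sf sY fY by (intro AE_zero_if_interval_integrals_zero) (auto simp: set_integral_diff)
  then show ?thesis unfolding Y_def by simp
qed

section \<open>Hermitian forms\<close>

definition cdot :: "complex ^ 'n::finite \<Rightarrow> complex ^ 'n \<Rightarrow> complex" where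
  "cdot x y = (\<Sum>k\<in>UNIV. x $ k * cnj (y $ k))"

abbreviation qf :: "complex ^ 'n ^ 'n::finite \<Rightarrow> complex ^ 'n \<Rightarrow> real" where
  "qf M x \<equiv> Re (sesq x M x)"

lemma sesq_eq_cdot: "sesq x M y = cdot (x v* M) y"
  unfolding sesq_def cdot_def vector_matrix_mult_def
  by (subst sum.swap) (simp add: sum_distrib_right)

lemma sesq_linear:
  "sesq (x + x') M y = sesq x M y + sesq x' M y"
  "sesq (x - x') M y = sesq x M y - sesq x' M y"
  "sesq x M (y + y') = sesq x M y + sesq x M y'"
  "sesq x M (y - y') = sesq x M y - sesq x M y'"
  "sesq (c *s x) M y = c * sesq x M y"
  "sesq x M (c *s y) = cnj c * sesq x M y"
  "sesq x (M + M') y = sesq x M y + sesq x M' y"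
  "sesq x (M - M') y = sesq x M y - sesq x M' y"
  "sesq 0 M y = 0" "sesq x M 0 = 0"
  "sesq x (r *\<^sub>R M) y = r *\<^sub>R sesq x M y"
  by (simp_all add: sesq_def algebra_simps sum.distrib sum_subtractf sum_distrib_left scaleR_right.sum vsc)

lemma hermitianD: "hermitian M \<Longrightarrow> cnj (M $ i $ j) = M $ j $ i"
  by (metis hermitian_def)

lemma hermitianI: "(\<And>i j. cnj (M $ i $ j) = M $ j $ i) \<Longrightarrow> hermitian M"
  unfolding hermitian_def by metis

lemma hermitian_add: "hermitian M \<Longrightarrow> hermitian N \<Longrightarrow> hermitian (M + N)"
  by (intro hermitianI) (simp add: hermitianD)

lemma hermitian_scaleR: "hermitian M \<Longrightarrow> hermitian (r *\<^sub>R M)"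
  by (intro hermitianI) (simp add: hermitianD)

lemma sesq_hermitian_cnj: "hermitian M \<Longrightarrow> sesq y M x = cnj (sesq x M y)"
proof -
  assume M: "hermitian M"
  have "cnj (sesq x M y) = (\<Sum>i\<in>UNIV. \<Sum>j\<in>UNIV. y $ j * cnj (M $ i $ j) * cnj (x $ i))"
    unfolding sesq_def cnj_sum by (intro sum.cong refl) simp
  also have "\<dots> = (\<Sum>j\<in>UNIV. \<Sum>i\<in>UNIV. y $ j * M $ j $ i * cnj (x $ i))"
    by (subst sum.swap) (simp only: hermitianD[OF M])
  finally show ?thesis by (simp add: sesq_def)
qed

lemma qf_diff: "hermitian M \<Longrightarrow> qf M (x - y) = qf M x - 2 * Re (sesq x M y) + qf M y"
  using sesq_hermitian_cnj[of M y x] by (simp add: sesq_linear)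

lemma qf_scale: "qf M (c *s x) = (cmod c)\<^sup>2 * qf M x"
proof -
  have "sesq (c *s x) M (c *s x) = (c * cnj c) * sesq x M x" by (simp add: sesq_linear)
  also have "\<dots> = complex_of_real ((cmod c)\<^sup>2) * sesq x M x" by (simp only: complex_norm_square)
  finally show ?thesis by simp
qed

lemma psdD: "psd M \<Longrightarrow> hermitian M" "psd M \<Longrightarrow> 0 \<le> qf M x"
  by (auto simp: psd_def)

lemma psd_add: "psd M \<Longrightarrow> psd N \<Longrightarrow> psd (M + N)"
  by (auto simp: psd_def hermitian_add sesq_linear)

lemma psd_scaleR: "0 \<le> r \<Longrightarrow> psd M \<Longrightarrow> psd (r *\<^sub>R M)"
  by (auto simp: psd_def hermitian_scaleR sesq_linear)

text \<open>A weighted form of the Cauchy-Schwarz inequality, obtained by expanding the form at a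
  multiple of x minus y. Its right-hand side is linear in the two quadratic forms and can therefore
  be integrated directly.\<close>

lemma psd_young:
  assumes M: "psd M" and t: "t > 0"
  shows "norm (sesq x M y) \<le> (t * qf M x + qf M y / t) / 2"
proof -
  define w where "w = sesq x M y"
  \<comment> \<open>A phase that makes \<theta> w real and nonnegative, so that the cross term
    becomes the modulus of w.\<close>
  define \<theta> where "\<theta> = (if w = 0 then 1 else cnj w / complex_of_real (cmod w))"
  have "cmod w \<noteq> 0 \<Longrightarrow> cnj w * w = complex_of_real (cmod w) * complex_of_real (cmod w)"
    by (metis complex_norm_square mult.commute of_real_power power2_eq_square)
  then have tw: "\<theta> * w = complex_of_real (cmod w)"
    unfolding \<theta>_def by (auto simp: field_simps)
  have t1: "cmod \<theta> = 1" unfolding \<theta>_def by (auto simp: norm_divide)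
  have "0 \<le> qf M ((complex_of_real t * \<theta>) *s x - y)" using psdD(2)[OF M] .
  also have "\<dots> = t\<^sup>2 * qf M x - 2 * (t * cmod w) + qf M y"
  proof -
    have "qf M ((complex_of_real t * \<theta>) *s x) = t\<^sup>2 * qf M x"
      unfolding qf_scale using t t1 by (simp add: norm_mult)
    moreover have "Re (sesq ((complex_of_real t * \<theta>) *s x) M y) = t * cmod w"
      unfolding sesq_linear(5) w_def[symmetric] mult.assoc[of "complex_of_real t"] tw by simp
    ultimately show ?thesis unfolding qf_diff[OF psdD(1)[OF M]] by simp
  qed
  finally have "2 * t * cmod w \<le> t\<^sup>2 * qf M x + qf M y" by simp
  then show ?thesis using t unfolding w_def by (simp add: field_simps power2_eq_square)
qed

text \<open>The Young inequality optimised over its weight: t = w / A if A is positive.\<close>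

lemma psd_cauchy_schwarz:
  assumes M: "psd M"
  shows "(norm (sesq x M y))\<^sup>2 \<le> qf M x * qf M y"
proof (cases "norm (sesq x M y) = 0")
  case True
  then show ?thesis using psdD(2)[OF M] by simp
next
  case False
  define w A B where "w = norm (sesq x M y)" and "A = qf M x" and "B = qf M y"
  have w: "w > 0" and A: "A \<ge> 0" and B: "B \<ge> 0"
    using False psdD(2)[OF M] by (auto simp: w_def A_def B_def)
  have y: "w \<le> (t * A + B / t) / 2" if "t > 0" for t
    using psd_young[OF M that] by (simp add: w_def A_def B_def)
  show ?thesis
  proof (cases "A = 0")
    case True
    \<comment> \<open>For A = 0 a large weight is contradictory: this one yields w \<le> w B / (2 (B
      + 1)), impossible for positive w.\<close>
    have "w \<le> B / ((B + 1) / w) / 2" using y[of "(B + 1) / w"] True w B by simp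
    then have "w * (B + 1) * 2 \<le> w * B" using B by (simp add: field_simps)
    then have "(B + 1) * 2 \<le> B" using w by (simp add: mult.assoc mult_le_cancel_left_pos)
    then show ?thesis using B by simp
  next
    case False
    then have "w \<le> (w + B / (w / A)) / 2" using y[of "w / A"] w A by simp
    then have "w * w \<le> A * B" using w by (simp add: field_simps)
    then show ?thesis by (simp add: w_def A_def B_def power2_eq_square)
  qed
qed

lemma norm_le_component_bound:
  fixes v :: "complex ^ 'n::finite"
  shows "norm v \<le> (\<Sum>j\<in>UNIV. norm (v $ j))"
  by (simp add: norm_vec_def L2_set_le_sum)

lemma norm_vector_matrix_le:
  fixes M :: "complex ^ 'n ^ 'm::finite"
  shows "norm (v v* M) \<le> (\<Sum>j\<in>UNIV. \<Sum>i\<in>UNIV. norm (M $ i $ j)) * norm v"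
proof -
  have "norm (v v* M) \<le> (\<Sum>j\<in>UNIV. norm ((v v* M) $ j))" by (rule norm_le_component_bound)
  also have "\<dots> \<le> (\<Sum>j\<in>UNIV. \<Sum>i\<in>UNIV. norm (M $ i $ j) * norm v)"
  proof (intro sum_mono)
    fix j
    have "norm ((v v* M) $ j) \<le> (\<Sum>i\<in>UNIV. norm (v $ i * M $ i $ j))"
      unfolding vector_matrix_mult_def by (simp add: norm_sum)
    also have "\<dots> \<le> (\<Sum>i\<in>UNIV. norm (M $ i $ j) * norm v)"
      by (intro sum_mono) (auto simp: norm_mult mult.commute[of _ "norm v"] intro!: mult_right_mono Finite_Cartesian_Product.norm_nth_le)
    finally show "norm ((v v* M) $ j) \<le> (\<Sum>i\<in>UNIV. norm (M $ i $ j) * norm v)" .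
  qed
  finally show ?thesis by (simp add: sum_distrib_right)
qed

lemma norm_sesq_le:
  "norm (sesq x M y) \<le> (\<Sum>i\<in>UNIV. \<Sum>j\<in>UNIV. norm (M $ i $ j)) * (norm x * norm y)"
  unfolding sesq_def sum_distrib_right
proof (rule order_trans[OF norm_sum sum_mono], rule order_trans[OF norm_sum sum_mono])
  fix i j
  show "norm (x $ i * M $ i $ j * cnj (y $ j)) \<le> norm (M $ i $ j) * (norm x * norm y)"
    using mult_left_mono[OF mult_mono[OF Finite_Cartesian_Product.norm_nth_le[of x i] Finite_Cartesian_Product.norm_nth_le[of y j]], of "norm (M $ i $ j)"]
    by (simp add: norm_mult mult_ac)
qed

lemma sesq_axis: "sesq x M (axis j 1) = (x v* M) $ j"
proof -
  have "(x v* M) $ k * cnj (axis j 1 $ k) = (if k = j then (x v* M) $ k else 0)" for k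
    by (simp add: axis_def)
  then show ?thesis unfolding sesq_eq_cdot cdot_def by simp
qed

text \<open>The entries of the row vector x S are values of the form at x and a basis vector, so
  Cauchy-Schwarz bounds them by the root of \<open>qf S x\<close>; multiplying by the inverse
  recovers x. The constant depends on S, hence on the point, which is enough for almost everywhere
  convergence.\<close>

lemma psd_invertible_norm_bound:
  fixes S :: "complex ^ 'n ^ 'n::finite"
  assumes S: "psd S" "invertible S"
  obtains C where "C \<ge> 0" "\<And>x. norm x \<le> C * sqrt (qf S x)"
proof -
  obtain R where R: "S ** R = mat 1" using S(2) unfolding invertible_def by blast
  define K where "K = (\<Sum>j\<in>UNIV. \<Sum>i\<in>UNIV. norm (R $ i $ j))"
  define L where "L = (\<Sum>j\<in>UNIV. sqrt (qf S (axis j 1)))"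
  have K: "K \<ge> 0" unfolding K_def by (intro sum_nonneg) auto
  have "norm x \<le> (K * L) * sqrt (qf S x)" for x
  proof -
    have "norm (x v* S) \<le> (\<Sum>j\<in>UNIV. norm ((x v* S) $ j))" by (rule norm_le_component_bound)
    also have "\<dots> \<le> (\<Sum>j\<in>UNIV. sqrt (qf S (axis j 1)) * sqrt (qf S x))"
    proof (intro sum_mono)
      fix j
      show "norm ((x v* S) $ j) \<le> sqrt (qf S (axis j 1)) * sqrt (qf S x)"
        using psd_cauchy_schwarz[OF S(1), of x "axis j 1"]
        unfolding sesq_axis[symmetric] real_sqrt_mult[symmetric]
        by (intro real_le_rsqrt) (simp add: mult.commute)
    qed
    finally have 1: "norm (x v* S) \<le> L * sqrt (qf S x)" by (simp add: L_def sum_distrib_right)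
    have "x = (x v* S) v* R" by (simp add: vector_matrix_mul_assoc R vector_matrix_mul_rid)
    then have "norm x \<le> K * norm (x v* S)" using norm_vector_matrix_le[of "x v* S" R] by (simp add: K_def)
    also have "\<dots> \<le> K * (L * sqrt (qf S x))" using 1 K by (intro mult_left_mono)
    finally show ?thesis by (simp add: mult.assoc)
  qed
  moreover have "K * L \<ge> 0" using K psdD(2)[OF S(1)] unfolding L_def by (intro mult_nonneg_nonneg sum_nonneg) auto
  ultimately show ?thesis using that by blast
qed

lemma qf_eq_0_iff: "psd S \<Longrightarrow> invertible S \<Longrightarrow> qf S x = 0 \<longleftrightarrow> x = 0"
  by (metis norm_eq_zero norm_ge_zero order_antisym_conv psd_invertible_norm_bound mult_zero_right real_sqrt_zero sesq_linear(9) zero_complex.sel(1))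

lemma matrix_inv_mult:
  fixes S :: "complex ^ 'n ^ 'n::finite"
  assumes "invertible S"
  shows "S ** matrix_inv S = mat 1" "matrix_inv S ** S = mat 1"
  using assms someI_ex[of "\<lambda>A'. S ** A' = mat 1 \<and> A' ** S = mat 1"] unfolding invertible_def matrix_inv_def by auto

lemma vec_inv_cancel:
  fixes S :: "complex ^ 'n ^ 'n::finite"
  assumes "invertible S"
  shows "(x v* S) v* matrix_inv S = x" "(x v* matrix_inv S) v* S = x"
  using matrix_inv_mult[OF assms] by (simp_all add: vector_matrix_mul_assoc vector_matrix_mul_rid)

text \<open>Passes from the energy form, taken with the inverse density, to the form of
  \<open>L2\<close>. With y = v S, Hermitian symmetry lets S act on the other argument.\<close>

lemma sesq_matrix_inv:
  fixes S :: "complex ^ 'n ^ 'n::finite"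
  assumes S: "psd S" "invertible S"
  shows "sesq x (matrix_inv S) y = sesq (x v* matrix_inv S) S (y v* matrix_inv S)"
proof -
  define u v where "u = x v* matrix_inv S" and "v = y v* matrix_inv S"
  have y: "y = v v* S" using vec_inv_cancel[OF S(2)] by (simp add: v_def)
  have "sesq x (matrix_inv S) y = cdot u (v v* S)" by (simp add: sesq_eq_cdot u_def y[symmetric])
  also have "\<dots> = cnj (cdot (v v* S) u)" by (simp add: cdot_def cnj_sum mult.commute)
  also have "\<dots> = sesq u S v" using sesq_hermitian_cnj[OF psdD(1)[OF S(1)], of u v] by (simp add: sesq_eq_cdot)
  finally show ?thesis by (simp add: u_def v_def)
qed

section \<open>Measurability of vector and matrix valued functions\<close>

lemma borel_measurable_vec_iff:
  fixes f :: "'a \<Rightarrow> ('b::euclidean_space) ^ 'n::finite"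
  shows "f \<in> borel_measurable M \<longleftrightarrow> (\<forall>i. (\<lambda>x. f x $ i) \<in> borel_measurable M)"
proof
  assume f: "f \<in> borel_measurable M"
  have "(\<lambda>v. v $ i) \<in> borel_measurable borel" for i :: 'n
    by (intro borel_measurable_continuous_onI continuous_intros) 
  then show "\<forall>i. (\<lambda>x. f x $ i) \<in> borel_measurable M" using measurable_compose[OF f] by blast
next
  assume *: "\<forall>i. (\<lambda>x. f x $ i) \<in> borel_measurable M"
  show "f \<in> borel_measurable M"
  proof (subst borel_measurable_euclidean_space, intro ballI)
    fix b :: "'b ^ 'n" assume "b \<in> Basis"
    then obtain i u where b: "b = axis i u" by (auto simp: Basis_vec_def)
    show "(\<lambda>x. f x \<bullet> b) \<in> borel_measurable M"
      unfolding b inner_axis using * by (intro borel_measurable_inner) auto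
  qed
qed

lemma vec_nth_measurable [measurable]:
  "(\<lambda>v::('b::euclidean_space) ^ 'n::finite. v $ i) \<in> borel_measurable borel"
  by (rule borel_measurable_vec_iff[THEN iffD1, rule_format]) simp

lemma measurable_vecI:
  fixes f :: "'a \<Rightarrow> complex ^ 'n::finite"
  shows "(\<And>i. (\<lambda>x. f x $ i) \<in> borel_measurable M) \<Longrightarrow> f \<in> borel_measurable M"
  by (simp add: borel_measurable_vec_iff)

lemma measurable_cis [measurable]: "f \<in> borel_measurable M \<Longrightarrow> (\<lambda>x. cis (f x)) \<in> borel_measurable M"
  unfolding cis_conv_exp by measurable

lemma measurable_cnj [measurable]: "f \<in> borel_measurable M \<Longrightarrow> (\<lambda>x. cnj (f x)) \<in> borel_measurable M"
  by (rule measurable_compose[OF _ borel_measurable_continuous_onI]) (auto intro: continuous_intros)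

lemma measurable_sesq [measurable]:
  fixes f g :: "'a \<Rightarrow> complex ^ 'n::finite"
  assumes [measurable]: "f \<in> borel_measurable M" "g \<in> borel_measurable M" "S \<in> borel_measurable M"
  shows "(\<lambda>x. sesq (f x) (S x) (g x)) \<in> borel_measurable M"
  unfolding sesq_def by measurable

lemma measurable_cdot [measurable]:
  fixes f g :: "'a \<Rightarrow> complex ^ 'n::finite"
  assumes [measurable]: "f \<in> borel_measurable M" "g \<in> borel_measurable M"
  shows "(\<lambda>x. cdot (f x) (g x)) \<in> borel_measurable M"
  unfolding cdot_def by measurable

lemma measurable_vecmat [measurable]:
  fixes f :: "'a \<Rightarrow> complex ^ 'm::finite" and S :: "'a \<Rightarrow> complex ^ 'n::finite ^ 'm"
  assumes [measurable]: "f \<in> borel_measurable M" "S \<in> borel_measurable M"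
  shows "(\<lambda>x. f x v* S x) \<in> borel_measurable M"
  unfolding vector_matrix_mult_def by (intro measurable_vecI) simp

lemma measurable_vec_scale [measurable]:
  fixes f :: "'a \<Rightarrow> complex ^ 'n::finite"
  assumes [measurable]: "f \<in> borel_measurable M" "c \<in> borel_measurable M"
  shows "(\<lambda>x. c x *s f x) \<in> borel_measurable M"
  by (intro measurable_vecI) simp

lemma measurable_matmul [measurable]:
  fixes A B :: "'a \<Rightarrow> complex ^ 'n ^ 'n::finite"
  assumes [measurable]: "A \<in> borel_measurable M" "B \<in> borel_measurable M"
  shows "(\<lambda>x. A x ** B x) \<in> borel_measurable M"
  unfolding matrix_matrix_mult_def borel_measurable_vec_iff by simp

lemma measurable_det:
  fixes A :: "'a \<Rightarrow> complex ^ 'n ^ 'n::finite"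
  assumes "\<And>i j. (\<lambda>x. A x $ i $ j) \<in> borel_measurable M"
  shows "(\<lambda>x. det (A x)) \<in> borel_measurable M"
  unfolding det_def using assms by (intro borel_measurable_sum borel_measurable_times borel_measurable_prod) auto

text \<open>On singular matrices \<open>matrix_inv\<close> is \<open>SOME\<close> of an empty predicate, hence constant.\<close>

lemma measurable_matrix_inv_borel:
  "(matrix_inv :: complex ^ 'n ^ 'n::finite \<Rightarrow> _) \<in> borel_measurable borel"
proof -
  define J :: "complex ^ 'n ^ 'n \<Rightarrow> complex ^ 'n ^ 'n" where
    "J A = (\<chi> k j. det (\<chi> i l. if l = k then axis j 1 $ i else A $ i $ l) / det A)" for A
  define c where "c = (SOME A'::complex ^ 'n ^ 'n. False)"
  have "matrix_inv A = (if det A \<noteq> 0 then J A else c)" for A :: "complex ^ 'n ^ 'n"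
  proof (cases "det A = 0")
    case True
    then have "\<not> invertible A" by (simp add: invertible_det_nz)
    then have "(\<lambda>A'. A ** A' = mat 1 \<and> A' ** A = mat 1) = (\<lambda>_. False)" by (auto simp: invertible_def)
    then show ?thesis using True by (simp add: matrix_inv_def c_def)
  next
    case False
    then have "invertible A" by (simp add: invertible_det_nz)
    from matrix_inv_mult(1)[OF this] have "A *v (matrix_inv A *v axis j 1) = axis j 1" for j
      by (simp add: matrix_vector_mul_assoc)
    then have c1: "matrix_inv A *v axis j 1 = (\<chi> k. det (\<chi> i l. if l = k then axis j 1 $ i else A $ i $ l) / det A)" for j
      using cramer[OF False] by blast
    have c2: "(matrix_inv A *v axis j 1) $ k = matrix_inv A $ k $ j" for j k
      by (simp add: matrix_vector_mult_def axis_def if_distrib cong: if_cong)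
    have "matrix_inv A $ k $ j = J A $ k $ j" for k j
      unfolding J_def by (subst c2[symmetric], subst c1) simp
    then show ?thesis using False by (simp add: vec_eq_iff)
  qed
  then have eq: "matrix_inv = (\<lambda>A :: complex ^ 'n ^ 'n. if det A \<noteq> 0 then J A else c)" by auto
  have [measurable]: "(\<lambda>A :: complex ^ 'n ^ 'n. det A) \<in> borel_measurable borel"
    by (intro measurable_det) simp
  have [measurable]: "J \<in> borel_measurable borel"
  proof -
    have [measurable]: "(\<lambda>A::complex ^ 'n ^ 'n. det (\<chi> i l. if l = k then axis j 1 $ i else A $ i $ l)) \<in> borel_measurable borel" for k j :: 'n
    proof (rule measurable_det)
      fix i l show "(\<lambda>A::complex ^ 'n ^ 'n. (\<chi> i l. if l = k then axis j 1 $ i else A $ i $ l) $ i $ l) \<in> borel_measurable borel"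
        by (cases "l = k") auto
    qed
    show ?thesis unfolding J_def borel_measurable_vec_iff vec_lambda_beta by (intro allI) measurable
  qed
  show ?thesis by (subst eq) measurable
qed

lemma measurable_matrix_inv [measurable]:
  fixes A :: "'a \<Rightarrow> complex ^ 'n ^ 'n::finite"
  shows "A \<in> borel_measurable M \<Longrightarrow> (\<lambda>x. matrix_inv (A x)) \<in> borel_measurable M"
  by (rule measurable_compose[OF _ measurable_matrix_inv_borel])

section \<open>Spectral densities and projections\<close>

lemma spectral_densityD:
  assumes "spectral_density S"
  shows "integrable lborel S" "S \<in> borel_measurable borel" "AE z in lborel. psd (S z)"
  using assms borel_measurable_integrable[of lborel S] by (auto simp: spectral_density_def)

lemma spectral_density_add:
  assumes "spectral_density F" "spectral_density G"
  shows "spectral_density (\<lambda>z. F z + G z)"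
proof -
  have "AE z in lborel. psd (F z + G z)"
    using spectral_densityD(3)[OF assms(1)] spectral_densityD(3)[OF assms(2)]
    by eventually_elim (rule psd_add)
  then show ?thesis using assms by (simp add: spectral_density_def)
qed

lemma spectral_density_scaleR:
  assumes "spectral_density F" "0 \<le> r"
  shows "spectral_density (\<lambda>z. r *\<^sub>R F z)"
proof -
  have "AE z in lborel. psd (r *\<^sub>R F z)"
    using spectral_densityD(3)[OF assms(1)] by eventually_elim (rule psd_scaleR[OF assms(2)])
  then show ?thesis using assms by (simp add: spectral_density_def)
qed

text \<open>A real Bochner integral, so that the Hilbert space algebra takes place in the reals. By
  \<open>nn_integral_qf\<close> it agrees on \<open>L2 S\<close> with the integral that defines
  \<open>L2\<close>. The factor 1/(4 pi^2) is left out and returns in \<open>mse_eq\<close>.\<close>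

definition sqnorm :: "'n::finite density \<Rightarrow> 'n vfield \<Rightarrow> real" where
  "sqnorm S h = (LINT z|lborel. qf (S z) (h z))"

definition sp_inner :: "'n::finite density \<Rightarrow> 'n vfield \<Rightarrow> 'n vfield \<Rightarrow> complex" where
  "sp_inner S g h = (LINT z|lborel. sesq (g z) (S z) (h z))"

lemma L2_measurable: "h \<in> L2 S \<Longrightarrow> h \<in> borel_measurable borel"
  by (simp add: L2_def)

lemma qf_nonneg_AE: "spectral_density S \<Longrightarrow> AE z in lborel. 0 \<le> qf (S z) (h z)"
  using spectral_densityD(3) psdD(2) by (metis (mono_tags, lifting) eventually_mono)

lemma nn_integral_qf_finite_iff:
  assumes S: "spectral_density S" and h [measurable]: "h \<in> borel_measurable borel"
  shows "(\<integral>\<^sup>+z. ennreal (qf (S z) (h z)) \<partial>lborel) < \<infinity> \<longleftrightarrow> integrable lborel (\<lambda>z. qf (S z) (h z))"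
proof -
  note [measurable] = spectral_densityD(2)[OF S]
  have m: "(\<lambda>z. qf (S z) (h z)) \<in> borel_measurable lborel" by measurable
  show ?thesis
  proof
    assume "(\<integral>\<^sup>+z. ennreal (qf (S z) (h z)) \<partial>lborel) < \<infinity>"
    then show "integrable lborel (\<lambda>z. qf (S z) (h z))"
      by (intro integrableI_nonneg m qf_nonneg_AE[OF S]) auto
  next
    assume "integrable lborel (\<lambda>z. qf (S z) (h z))"
    then show "(\<integral>\<^sup>+z. ennreal (qf (S z) (h z)) \<partial>lborel) < \<infinity>"
      using nn_integral_eq_integral[OF _ qf_nonneg_AE[OF S]] by simp
  qed
qed

lemma L2_iff:
  assumes S: "spectral_density S"
  shows "h \<in> L2 S \<longleftrightarrow> h \<in> borel_measurable borel \<and> integrable lborel (\<lambda>z. qf (S z) (h z))"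
  using nn_integral_qf_finite_iff[OF S, of h] by (auto simp: L2_def)

lemma nn_integral_qf:
  assumes S: "spectral_density S" and h: "h \<in> L2 S"
  shows "(\<integral>\<^sup>+z. ennreal (qf (S z) (h z)) \<partial>lborel) = ennreal (sqnorm S h)"
  unfolding sqnorm_def using h by (intro nn_integral_eq_integral qf_nonneg_AE[OF S]) (simp add: L2_iff[OF S])

lemma L2_sesq_integrable:
  assumes S: "spectral_density S" and g: "g \<in> L2 S" and h: "h \<in> L2 S"
  shows "integrable lborel (\<lambda>z. sesq (g z) (S z) (h z))"
proof (rule Bochner_Integration.integrable_bound)
  show "integrable lborel (\<lambda>z. (qf (S z) (g z) + qf (S z) (h z)) / 2)"
    using g h by (simp add: L2_iff[OF S])
  show "(\<lambda>z. sesq (g z) (S z) (h z)) \<in> borel_measurable lborel"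
    using L2_measurable[OF g] L2_measurable[OF h] spectral_densityD(2)[OF S] by measurable
  show "AE z in lborel. norm (sesq (g z) (S z) (h z)) \<le> norm ((qf (S z) (g z) + qf (S z) (h z)) / 2)"
    using spectral_densityD(3)[OF S]
  proof eventually_elim
    case (elim z)
    show ?case using psd_young[OF elim, of 1 "g z" "h z"] by simp
  qed
qed

lemma L2I:
  assumes "spectral_density S" "h \<in> borel_measurable borel" "integrable lborel (\<lambda>z. sesq (h z) (S z) (h z))"
  shows "h \<in> L2 S"
  using assms by (simp add: L2_iff)

lemma L2_add:
  assumes S: "spectral_density S" and g: "g \<in> L2 S" and h: "h \<in> L2 S"
  shows "(\<lambda>z. g z + h z) \<in> L2 S"
  using L2_sesq_integrable[OF S g g] L2_sesq_integrable[OF S g h] L2_sesq_integrable[OF S h g]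
    L2_sesq_integrable[OF S h h] L2_measurable[OF g] L2_measurable[OF h]
  by (intro L2I[OF S]) (auto simp: sesq_linear)

lemma L2_diff:
  assumes S: "spectral_density S" and g: "g \<in> L2 S" and h: "h \<in> L2 S"
  shows "(\<lambda>z. g z - h z) \<in> L2 S"
  using L2_sesq_integrable[OF S g g] L2_sesq_integrable[OF S g h] L2_sesq_integrable[OF S h g]
    L2_sesq_integrable[OF S h h] L2_measurable[OF g] L2_measurable[OF h]
  by (intro L2I[OF S]) (auto simp: sesq_linear)

lemma L2_scale:
  assumes S: "spectral_density S" and h: "h \<in> L2 S"
  shows "(\<lambda>z. c *s h z) \<in> L2 S"
  using L2_sesq_integrable[OF S h h] L2_measurable[OF h]
  by (intro L2I[OF S]) (auto simp: sesq_linear)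

lemma L2_bounded:
  fixes h :: "'n::finite vfield"
  assumes S: "spectral_density S" and h [measurable]: "h \<in> borel_measurable borel" and B: "\<And>z. norm (h z) \<le> B"
  shows "h \<in> L2 S"
proof (rule L2I[OF S h])
  note [measurable] = spectral_densityD(2)[OF S]
  have B0: "B \<ge> 0" using B[of undefined] norm_ge_zero order_trans by blast
  have "integrable lborel (\<lambda>z. S z $ i $ j)" for i j
    using spectral_densityD(1)[OF S] by (intro integrable_bounded_linear[OF bounded_linear_vec_nth])
  then have i: "integrable lborel (\<lambda>z. (\<Sum>i\<in>UNIV. \<Sum>j\<in>UNIV. norm (S z $ i $ j)) * (B * B))"
    by (intro integrable_mult_left Bochner_Integration.integrable_sum integrable_norm)
  show "integrable lborel (\<lambda>z. sesq (h z) (S z) (h z))"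
  proof (rule Bochner_Integration.integrable_bound[OF i])
    show "AE z in lborel. norm (sesq (h z) (S z) (h z)) \<le> norm ((\<Sum>i\<in>UNIV. \<Sum>j\<in>UNIV. norm (S z $ i $ j)) * (B * B))"
    proof (intro AE_I2)
      fix z
      have "norm (sesq (h z) (S z) (h z)) \<le> (\<Sum>i\<in>UNIV. \<Sum>j\<in>UNIV. norm (S z $ i $ j)) * (norm (h z) * norm (h z))"
        by (rule norm_sesq_le)
      also have "\<dots> \<le> (\<Sum>i\<in>UNIV. \<Sum>j\<in>UNIV. norm (S z $ i $ j)) * (B * B)"
        using B[of z] B0 by (intro mult_left_mono mult_mono sum_nonneg) auto
      finally show "norm (sesq (h z) (S z) (h z)) \<le> norm ((\<Sum>i\<in>UNIV. \<Sum>j\<in>UNIV. norm (S z $ i $ j)) * (B * B))"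
        by simp
    qed
  qed measurable
qed

lemma sqnorm_nonneg: "spectral_density S \<Longrightarrow> 0 \<le> sqnorm S h"
  unfolding sqnorm_def by (intro integral_nonneg_AE qf_nonneg_AE)

lemma sqnorm_eq_sp_inner:
  assumes S: "spectral_density S" and h: "h \<in> L2 S"
  shows "sqnorm S h = Re (sp_inner S h h)"
  unfolding sqnorm_def sp_inner_def by (rule integral_Re[OF L2_sesq_integrable[OF S h h]])

lemma sp_inner_linear:
  assumes S: "spectral_density S" and g: "g \<in> L2 S" and h: "h \<in> L2 S" and k: "k \<in> L2 S"
  shows "sp_inner S (\<lambda>z. g z + h z) k = sp_inner S g k + sp_inner S h k"
    "sp_inner S (\<lambda>z. g z - h z) k = sp_inner S g k - sp_inner S h k"
    "sp_inner S k (\<lambda>z. g z + h z) = sp_inner S k g + sp_inner S k h"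
    "sp_inner S k (\<lambda>z. g z - h z) = sp_inner S k g - sp_inner S k h"
  unfolding sp_inner_def sesq_linear
  using L2_sesq_integrable[OF S g k] L2_sesq_integrable[OF S h k]
    L2_sesq_integrable[OF S k g] L2_sesq_integrable[OF S k h] by simp_all

lemma sp_inner_scale:
  "sp_inner S (\<lambda>z. c *s g z) k = c * sp_inner S g k" "sp_inner S k (\<lambda>z. c *s g z) = cnj c * sp_inner S k g"
  unfolding sp_inner_def sesq_linear by simp_all

lemma sp_inner_cnj:
  assumes S: "spectral_density S" and g: "g \<in> L2 S" and h: "h \<in> L2 S"
  shows "sp_inner S h g = cnj (sp_inner S g h)"
proof -
  note [measurable] = spectral_densityD(2)[OF S] L2_measurable[OF g] L2_measurable[OF h]
  have "sp_inner S h g = (LINT z|lborel. cnj (sesq (g z) (S z) (h z)))"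
    unfolding sp_inner_def
  proof (rule integral_cong_AE)
    show "AE z in lborel. sesq (h z) (S z) (g z) = cnj (sesq (g z) (S z) (h z))"
      using spectral_densityD(3)[OF S] by eventually_elim (intro sesq_hermitian_cnj psdD)
  qed measurable
  then show ?thesis by (simp add: sp_inner_def)
qed

lemma sqnorm_add:
  assumes S: "spectral_density S" and g: "g \<in> L2 S" and h: "h \<in> L2 S"
  shows "sqnorm S (\<lambda>z. g z + h z) = sqnorm S g + 2 * Re (sp_inner S g h) + sqnorm S h"
  using sp_inner_cnj[OF S g h]
  by (simp add: sqnorm_eq_sp_inner[OF S] L2_add[OF S] g h sp_inner_linear[OF S])

lemma sqnorm_diff:
  assumes S: "spectral_density S" and g: "g \<in> L2 S" and h: "h \<in> L2 S"
  shows "sqnorm S (\<lambda>z. g z - h z) = sqnorm S g - 2 * Re (sp_inner S g h) + sqnorm S h"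
  using sp_inner_cnj[OF S g h]
  by (simp add: sqnorm_eq_sp_inner[OF S] L2_diff[OF S] g h sp_inner_linear[OF S])

lemma sqnorm_scale: "sqnorm S (\<lambda>z. c *s h z) = (cmod c)\<^sup>2 * sqnorm S h"
  unfolding sqnorm_def qf_scale by simp

text \<open>Nonnegativity of the squared norm of the difference. It replaces the triangle inequality
  for squared norms; its factor 2 is the origin of the tolerances
  \<open>\<epsilon> / 4\<close>.\<close>

lemma sqnorm_add_le:
  assumes S: "spectral_density S" and g: "g \<in> L2 S" and h: "h \<in> L2 S"
  shows "sqnorm S (\<lambda>z. g z + h z) \<le> 2 * sqnorm S g + 2 * sqnorm S h"
  using sqnorm_nonneg[OF S, of "\<lambda>z. g z - h z"] by (simp add: sqnorm_add[OF S g h] sqnorm_diff[OF S g h])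

lemma sqnorm_parallelogram:
  assumes S: "spectral_density S" and g: "g \<in> L2 S" and h: "h \<in> L2 S"
  shows "sqnorm S (\<lambda>z. g z + h z) + sqnorm S (\<lambda>z. g z - h z) = 2 * sqnorm S g + 2 * sqnorm S h"
  by (simp add: sqnorm_add[OF S g h] sqnorm_diff[OF S g h])

lemma sqnorm_minus_commute: "sqnorm S (\<lambda>z. g z - h z) = sqnorm S (\<lambda>z. h z - g z)"
proof -
  have "(\<lambda>z. g z - h z) = (\<lambda>z. (-1) *s (h z - g z))" by (auto simp: vec_eq_iff)
  then show ?thesis using sqnorm_scale[of S "-1" "\<lambda>z. h z - g z"] by simp
qed

text \<open>The free weight t takes the place of square roots: where one factor is small and the
  other merely bounded, a large t makes both terms small.\<close>

lemma integral_norm_sesq_young: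
  assumes S: "spectral_density S" and g: "g \<in> L2 S" and h: "h \<in> L2 S" and t: "t > 0"
  shows "(LINT z|lborel. norm (sesq (g z) (S z) (h z))) \<le> (t * sqnorm S g + sqnorm S h / t) / 2"
proof -
  have gi: "integrable lborel (\<lambda>z. qf (S z) (g z))" and hi: "integrable lborel (\<lambda>z. qf (S z) (h z))"
    using g h by (auto simp: L2_iff[OF S])
  have "(LINT z|lborel. norm (sesq (g z) (S z) (h z))) \<le> (LINT z|lborel. (t * qf (S z) (g z) + qf (S z) (h z) / t) / 2)"
  proof (rule integral_mono_AE)
    show "integrable lborel (\<lambda>z. norm (sesq (g z) (S z) (h z)))"
      by (intro integrable_norm L2_sesq_integrable S g h)
    show "AE z in lborel. norm (sesq (g z) (S z) (h z)) \<le> (t * qf (S z) (g z) + qf (S z) (h z) / t) / 2"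
      using spectral_densityD(3)[OF S] by eventually_elim (rule psd_young[OF _ t])
  qed (use gi hi in auto)
  also have "\<dots> = (t * sqnorm S g + sqnorm S h / t) / 2"
    using gi hi by (simp add: sqnorm_def)
  finally show ?thesis .
qed

lemma norm_spip_young:
  assumes "spectral_density S" "g \<in> L2 S" "h \<in> L2 S" "t > 0"
  shows "norm (sp_inner S g h) \<le> (t * sqnorm S g + sqnorm S h / t) / 2"
  unfolding sp_inner_def by (rule order_trans[OF integral_norm_bound integral_norm_sesq_young[OF assms]])

section \<open>The closed span of the exponentials outside the strip, and projections onto
  it\<close>

lemma trig_span_zero: "(\<lambda>z. 0) \<in> trig_span T"
  unfolding trig_span_def by (intro CollectI exI[of _ "{}"]) auto

lemma trig_span_single:
  fixes v :: "complex ^ 'n::finite"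
  assumes "w \<notin> strip T"
  shows "(\<lambda>z. cis (fst w * fst z + snd w * snd z) *s v) \<in> trig_span T"
  unfolding trig_span_def using assms by (intro CollectI exI[of _ "{w}"] exI[of _ "\<lambda>_. v"]) auto

lemma trig_span_scale:
  fixes g :: "'n::finite vfield"
  assumes "g \<in> trig_span T"
  shows "(\<lambda>z. c *s g z) \<in> trig_span T"
proof -
  obtain W v where W: "finite W" "W \<subseteq> - strip T"
    and g: "g = (\<lambda>z. \<Sum>w\<in>W. cis (fst w * fst z + snd w * snd z) *s v w)"
    using assms unfolding trig_span_def by blast
  have "(\<lambda>z. c *s g z) = (\<lambda>z. \<Sum>w\<in>W. cis (fst w * fst z + snd w * snd z) *s (c *s v w))"
    unfolding g by (auto simp: vec_eq_iff sum_distrib_left mult_ac)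
  then show ?thesis unfolding trig_span_def using W
    by (intro CollectI exI[of _ W] exI[of _ "\<lambda>w. c *s v w"] conjI)
qed

lemma trig_span_add:
  fixes g h :: "'n::finite vfield"
  assumes "g \<in> trig_span T" "h \<in> trig_span T"
  shows "(\<lambda>z. g z + h z) \<in> trig_span T"
proof -
  obtain W v where W: "finite W" "W \<subseteq> - strip T"
    and g: "g = (\<lambda>z. \<Sum>w\<in>W. cis (fst w * fst z + snd w * snd z) *s v w)"
    using assms(1) unfolding trig_span_def by blast
  obtain W' v' where W': "finite W'" "W' \<subseteq> - strip T"
    and h: "h = (\<lambda>z. \<Sum>w\<in>W'. cis (fst w * fst z + snd w * snd z) *s v' w)"
    using assms(2) unfolding trig_span_def by blast
  \<comment> \<open>Both coefficient families are extended by zero to the union of the frequency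
    sets, where they can be added.\<close>
  define u where "u w = (if w \<in> W then v w else 0) + (if w \<in> W' then v' w else 0)" for w
  have 1: "(\<Sum>w\<in>W. cis (fst w * fst z + snd w * snd z) *s v w) =
      (\<Sum>w\<in>W \<union> W'. cis (fst w * fst z + snd w * snd z) *s (if w \<in> W then v w else 0))" for z
    using W W' by (intro sum.mono_neutral_cong_left) auto
  have 2: "(\<Sum>w\<in>W'. cis (fst w * fst z + snd w * snd z) *s v' w) =
      (\<Sum>w\<in>W \<union> W'. cis (fst w * fst z + snd w * snd z) *s (if w \<in> W' then v' w else 0))" for z
    using W W' by (intro sum.mono_neutral_cong_left) auto
  have "(\<lambda>z. g z + h z) = (\<lambda>z. \<Sum>w\<in>W \<union> W'. cis (fst w * fst z + snd w * snd z) *s u w)"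
  proof
    fix z
    have "g z + h z = (\<Sum>w\<in>W \<union> W'. cis (fst w * fst z + snd w * snd z) *s (if w \<in> W then v w else 0)
        + cis (fst w * fst z + snd w * snd z) *s (if w \<in> W' then v' w else 0))"
      unfolding sum.distrib unfolding g h by (rule arg_cong2[where f=plus, OF 1 2])
    also have "\<dots> = (\<Sum>w\<in>W \<union> W'. cis (fst w * fst z + snd w * snd z) *s u w)"
      by (intro sum.cong refl) (simp only: u_def vector_add_ldistrib)
    finally show "g z + h z = \<dots>" .
  qed
  then show ?thesis unfolding trig_span_def using W W' by (intro CollectI exI[of _ "W \<union> W'"] exI[of _ u]) auto
qed

lemma trig_span_measurable_bounded:
  fixes g :: "'n::finite vfield"
  assumes "g \<in> trig_span T"
  shows "g \<in> borel_measurable borel" "\<exists>B. \<forall>z. norm (g z) \<le> B"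
proof -
  obtain W v where W: "finite W" "W \<subseteq> - strip T"
    and g: "g = (\<lambda>z. \<Sum>w\<in>W. cis (fst w * fst z + snd w * snd z) *s v w)"
    using assms unfolding trig_span_def by blast
  have [measurable]: "fst \<in> borel_measurable (borel :: (real \<times> real) measure)"
    "snd \<in> borel_measurable (borel :: (real \<times> real) measure)"
    by (auto simp: borel_prod[symmetric])
  show "g \<in> borel_measurable borel" unfolding g by measurable
  have "norm (g z) \<le> (\<Sum>w\<in>W. norm (v w))" for z
  proof -
    have "norm (c *s u) = norm u" if "norm c = 1" for c :: complex and u :: "complex ^ 'n"
      using that by (simp add: norm_vec_def norm_mult)
    then show ?thesis unfolding g by (intro order_trans[OF norm_sum]) (auto intro!: sum_mono)
  qed
  then show "\<exists>B. \<forall>z. norm (g z) \<le> B" by blast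
qed

lemma trig_span_L2: "spectral_density S \<Longrightarrow> g \<in> trig_span T \<Longrightarrow> g \<in> L2 S"
  using trig_span_measurable_bounded L2_bounded by blast

lemma L2K_iff:
  assumes S: "spectral_density S"
  shows "h \<in> L2K T S \<longleftrightarrow> h \<in> L2 S \<and> (\<forall>\<epsilon>>0. \<exists>g\<in>trig_span T. sqnorm S (\<lambda>z. h z - g z) < \<epsilon>)"
proof (cases "h \<in> L2 S")
  case True
  have "(\<integral>\<^sup>+z. ennreal (qf (S z) (h z - g z)) \<partial>lborel) < ennreal \<epsilon> \<longleftrightarrow> sqnorm S (\<lambda>z. h z - g z) < \<epsilon>"
    if "g \<in> trig_span T" "\<epsilon> > 0" for g \<epsilon>
    using nn_integral_qf[OF S L2_diff[OF S True trig_span_L2[OF S that(1)]]] sqnorm_nonneg[OF S]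
    by (simp add: ennreal_less_iff)
  then show ?thesis using True unfolding L2K_def by auto
qed (simp add: L2K_def)

lemma L2K_L2: "h \<in> L2K T S \<Longrightarrow> h \<in> L2 S"
  by (simp add: L2K_def)

lemma trig_span_L2K:
  assumes S: "spectral_density S" and g: "g \<in> trig_span T"
  shows "g \<in> L2K T S"
  unfolding L2K_iff[OF S] using trig_span_L2[OF S g] g
  by (auto intro!: bexI[of _ g] simp: sqnorm_def sesq_linear)

lemma L2K_add:
  assumes S: "spectral_density S" and g: "g \<in> L2K T S" and h: "h \<in> L2K T S"
  shows "(\<lambda>z. g z + h z) \<in> L2K T S"
  unfolding L2K_iff[OF S]
proof (intro conjI allI impI)
  show "(\<lambda>z. g z + h z) \<in> L2 S" by (intro L2_add[OF S] L2K_L2[OF g] L2K_L2[OF h])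
  fix \<epsilon> :: real assume e: "\<epsilon> > 0"
  obtain g' h' where g': "g' \<in> trig_span T" "sqnorm S (\<lambda>z. g z - g' z) < \<epsilon> / 4"
    and h': "h' \<in> trig_span T" "sqnorm S (\<lambda>z. h z - h' z) < \<epsilon> / 4"
    using g h e unfolding L2K_iff[OF S] by (meson divide_pos_pos zero_less_numeral)
  have "sqnorm S (\<lambda>z. g z + h z - (g' z + h' z)) = sqnorm S (\<lambda>z. (g z - g' z) + (h z - h' z))"
    by (simp add: algebra_simps)
  also have "\<dots> \<le> 2 * sqnorm S (\<lambda>z. g z - g' z) + 2 * sqnorm S (\<lambda>z. h z - h' z)"
    by (intro sqnorm_add_le[OF S] L2_diff[OF S] L2K_L2[OF g] L2K_L2[OF h] trig_span_L2[OF S g'(1)] trig_span_L2[OF S h'(1)])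
  also have "\<dots> < \<epsilon>" using g' h' by simp
  finally show "\<exists>f\<in>trig_span T. sqnorm S (\<lambda>z. g z + h z - f z) < \<epsilon>"
    using trig_span_add[OF g'(1) h'(1)] by (intro bexI[of _ "\<lambda>z. g' z + h' z"])
qed

lemma L2K_scale:
  assumes S: "spectral_density S" and h: "h \<in> L2K T S"
  shows "(\<lambda>z. c *s h z) \<in> L2K T S"
  unfolding L2K_iff[OF S]
proof (intro conjI allI impI)
  show "(\<lambda>z. c *s h z) \<in> L2 S" by (intro L2_scale[OF S] L2K_L2[OF h])
  fix \<epsilon> :: real assume e: "\<epsilon> > 0"
  define d where "d = \<epsilon> / ((cmod c)\<^sup>2 + 1)"
  have "d > 0" using e unfolding d_def by (intro divide_pos_pos add_nonneg_pos) auto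
  then obtain g where g: "g \<in> trig_span T" "sqnorm S (\<lambda>z. h z - g z) < d"
    using h unfolding L2K_iff[OF S] by blast
  have "sqnorm S (\<lambda>z. c *s h z - c *s g z) = sqnorm S (\<lambda>z. c *s (h z - g z))"
    by (rule arg_cong[where f="sqnorm S"]) (auto simp: vec_eq_iff algebra_simps)
  also have "\<dots> = (cmod c)\<^sup>2 * sqnorm S (\<lambda>z. h z - g z)" by (rule sqnorm_scale)
  also have "\<dots> \<le> (cmod c)\<^sup>2 * d" using g(2) by (intro mult_left_mono) auto
  also have "\<dots> < ((cmod c)\<^sup>2 + 1) * d" using \<open>d > 0\<close> by simp
  also have "\<dots> = \<epsilon>" unfolding d_def using add_nonneg_pos[of "(cmod c)\<^sup>2" 1] by simp
  finally show "\<exists>f\<in>trig_span T. sqnorm S (\<lambda>z. c *s h z - f z) < \<epsilon>"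
    using trig_span_scale[OF g(1)] by (intro bexI[of _ "\<lambda>z. c *s g z"])
qed

lemma L2K_closed:
  assumes S: "spectral_density S" and h: "h \<in> L2 S"
    and k: "\<And>\<epsilon>. \<epsilon> > 0 \<Longrightarrow> \<exists>k\<in>L2K T S. sqnorm S (\<lambda>z. h z - k z) < \<epsilon>"
  shows "h \<in> L2K T S"
  unfolding L2K_iff[OF S]
proof (intro conjI allI impI h)
  fix \<epsilon> :: real assume e: "\<epsilon> > 0"
  obtain k where k: "k \<in> L2K T S" "sqnorm S (\<lambda>z. h z - k z) < \<epsilon> / 4" using k[of "\<epsilon> / 4"] e by auto
  obtain g where g: "g \<in> trig_span T" "sqnorm S (\<lambda>z. k z - g z) < \<epsilon> / 4"
    using k(1) e unfolding L2K_iff[OF S] by (meson divide_pos_pos zero_less_numeral)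
  have "sqnorm S (\<lambda>z. h z - g z) = sqnorm S (\<lambda>z. (h z - k z) + (k z - g z))" by simp
  also have "\<dots> \<le> 2 * sqnorm S (\<lambda>z. h z - k z) + 2 * sqnorm S (\<lambda>z. k z - g z)"
    by (intro sqnorm_add_le[OF S] L2_diff[OF S] h L2K_L2[OF k(1)] trig_span_L2[OF S g(1)])
  also have "\<dots> < \<epsilon>" using k g by simp
  finally show "\<exists>f\<in>trig_span T. sqnorm S (\<lambda>z. h z - f z) < \<epsilon>" using g by blast
qed

lemma L2K_orthogonalI:
  assumes S: "spectral_density S" and x: "x \<in> L2 S"
    and orth: "\<And>g. g \<in> trig_span T \<Longrightarrow> sp_inner S g x = 0"
    and h: "h \<in> L2K T S"
  shows "sp_inner S h x = 0"
proof -
  have "norm (sp_inner S h x) \<le> 0 + \<epsilon>" if e: "\<epsilon> > 0" for \<epsilon>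
  proof -
    \<comment> \<open>With this weight the term of x is at most \<epsilon>, and approximation of h
      up to \<open>\<epsilon> / t\<close> makes the other term at most \<epsilon>. The summand 1
      keeps t positive when x has norm zero.\<close>
    define t where "t = (sqnorm S x + 1) / \<epsilon>"
    have t: "t > 0" unfolding t_def using e sqnorm_nonneg[OF S, of x] by simp
    obtain g where g: "g \<in> trig_span T" "sqnorm S (\<lambda>z. h z - g z) < \<epsilon> / t"
      using h t e unfolding L2K_iff[OF S] by (meson divide_pos_pos)
    have hg: "(\<lambda>z. h z - g z) \<in> L2 S" by (intro L2_diff[OF S] L2K_L2[OF h] trig_span_L2[OF S g(1)])
    have "sp_inner S h x = sp_inner S (\<lambda>z. h z - g z) x"
      using sp_inner_linear(2)[OF S L2K_L2[OF h] trig_span_L2[OF S g(1)] x] orth[OF g(1)] by simp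
    then have "norm (sp_inner S h x) \<le> (t * sqnorm S (\<lambda>z. h z - g z) + sqnorm S x / t) / 2"
      using norm_spip_young[OF S hg x t] by simp
    also have "\<dots> \<le> (\<epsilon> + \<epsilon>) / 2"
    proof -
      have "t * sqnorm S (\<lambda>z. h z - g z) \<le> \<epsilon>" using g(2) t by (simp add: field_simps)
      moreover have "sqnorm S x / t \<le> \<epsilon>"
        unfolding t_def using e sqnorm_nonneg[OF S, of x] by (simp add: field_simps)
      ultimately show ?thesis by simp
    qed
    finally show ?thesis by simp
  qed
  from field_le_epsilon[OF this] show ?thesis by simp
qed

text \<open>The rate 8^(-n) leaves room for the weights 4^n: the weighted series has total integral
  at most the sum of K 2^(-n), so at almost every point 4^n times the form is bounded in n. The
  square root gives the decay 2^(-n), and invertibility carries it over to the vectors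
  themselves.\<close>

lemma L2_geometric_AE_bound:
  fixes d :: "nat \<Rightarrow> 'n::finite vfield"
  assumes S: "spectral_density S" and inv: "AE z in lborel. invertible (S z)"
    and d: "\<And>n. d n \<in> L2 S" and K: "\<And>n. sqnorm S (d n) \<le> K * (1/8) ^ n"
  shows "AE z in lborel. \<exists>C. \<forall>n. norm (d n z) \<le> C * (1/2) ^ n"
proof -
  note [measurable] = spectral_densityD(2)[OF S] L2_measurable[OF d]
  have K0: "K \<ge> 0" using K[of 0] sqnorm_nonneg[OF S, of "d 0"] by simp
  have "(\<integral>\<^sup>+z. (\<Sum>n. ennreal (4 ^ n) * ennreal (qf (S z) (d n z))) \<partial>lborel)
    = (\<Sum>n. \<integral>\<^sup>+z. ennreal (4 ^ n) * ennreal (qf (S z) (d n z)) \<partial>lborel)"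
    by (rule nn_integral_suminf) measurable
  also have "\<dots> = (\<Sum>n. ennreal (4 ^ n * sqnorm S (d n)))"
    by (subst nn_integral_cmult) (auto simp: nn_integral_qf[OF S d] ennreal_mult sqnorm_nonneg[OF S])
  also have "\<dots> \<le> (\<Sum>n. ennreal (K * (1/2) ^ n))"
  proof (intro suminf_le summableI ennreal_leI)
    fix n
    have "4 ^ n * sqnorm S (d n) \<le> 4 ^ n * (K * (1/8) ^ n)" using K by (intro mult_left_mono) auto
    also have "\<dots> = K * (4 * (1/8)) ^ n" by (simp only: power_mult_distrib mult_ac)
    finally show "4 ^ n * sqnorm S (d n) \<le> K * (1/2) ^ n" by simp
  qed
  also have "\<dots> = ennreal (\<Sum>n. K * (1/2) ^ n)"
    using K0 by (intro suminf_ennreal2) (auto intro!: summable_mult summable_geometric)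
  also have "\<dots> < \<infinity>" by simp
  finally have "AE z in lborel. (\<Sum>n. ennreal (4 ^ n) * ennreal (qf (S z) (d n z))) \<noteq> \<infinity>"
    by (intro nn_integral_PInf_AE) auto
  then show ?thesis using inv spectral_densityD(3)[OF S]
  proof eventually_elim
    case (elim z)
    obtain M where M: "(\<Sum>n. ennreal (4 ^ n) * ennreal (qf (S z) (d n z))) = ennreal M" "M \<ge> 0"
      using elim(1) by (cases "\<Sum>n. ennreal (4 ^ n) * ennreal (qf (S z) (d n z))" rule: ennreal_cases) auto
    obtain C where C: "C \<ge> 0" "\<And>x. norm x \<le> C * sqrt (qf (S z) x)"
      using psd_invertible_norm_bound[OF elim(3,2)] by blast
    have "norm (d n z) \<le> (C * sqrt M) * (1/2) ^ n" for n
    proof -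
      have "ennreal (4 ^ n * qf (S z) (d n z)) = (\<Sum>n\<in>{n}. ennreal (4 ^ n) * ennreal (qf (S z) (d n z)))"
        using psdD(2)[OF elim(3)] by (simp add: ennreal_mult)
      also have "\<dots> \<le> ennreal M" unfolding M(1)[symmetric] by (intro sum_le_suminf summableI) auto
      finally have "4 ^ n * qf (S z) (d n z) \<le> M" using M(2) by simp
      then have "qf (S z) (d n z) \<le> M * ((1/2) ^ n)\<^sup>2"
      proof -
        have "(4::real) ^ n * ((1/2) ^ n)\<^sup>2 = (4 * (1/2)\<^sup>2) ^ n"
          by (simp only: power_mult_distrib power_mult[symmetric] mult.commute[of n 2])
        then have "(4::real) ^ n * ((1/2) ^ n)\<^sup>2 = 1" by (simp add: power2_eq_square)
        then have e: "4 ^ n * ((1/2) ^ n)\<^sup>2 = (1::real)" .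
        have "4 ^ n * qf (S z) (d n z) * ((1/2) ^ n)\<^sup>2 \<le> M * ((1/2) ^ n)\<^sup>2"
          using \<open>4 ^ n * qf (S z) (d n z) \<le> M\<close> by (rule mult_right_mono) simp
        moreover have "4 ^ n * qf (S z) (d n z) * ((1/2) ^ n)\<^sup>2 = qf (S z) (d n z) * (4 ^ n * ((1/2) ^ n)\<^sup>2)"
          by (simp only: mult_ac)
        ultimately show ?thesis unfolding e by simp
      qed
      then have "sqrt (qf (S z) (d n z)) \<le> sqrt (M * ((1/2) ^ n)\<^sup>2)" by simp
      also have "\<dots> = sqrt M * (1/2) ^ n" by (simp add: real_sqrt_mult)
      finally show ?thesis using C(2)[of "d n z"] mult_left_mono[OF _ C(1)] by (smt (verit) mult.assoc)
    qed
    then show ?case by blast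
  qed
qed

lemma L2_Fatou:
  fixes g :: "nat \<Rightarrow> 'n::finite vfield"
  assumes S: "spectral_density S" and g: "\<And>n. g n \<in> L2 S" and b: "\<And>n. sqnorm S (g n) \<le> b"
    and f [measurable]: "f \<in> borel_measurable borel"
    and lim: "AE z in lborel. (\<lambda>n. g n z) \<longlonglongrightarrow> f z"
  shows "f \<in> L2 S" "sqnorm S f \<le> b"
proof -
  note [measurable] = spectral_densityD(2)[OF S] L2_measurable[OF g]
  have b0: "b \<ge> 0" using b[of 0] sqnorm_nonneg[OF S, of "g 0"] by simp
  have "AE z in lborel. liminf (\<lambda>n. ennreal (qf (S z) (g n z))) = ennreal (qf (S z) (f z))"
    using lim
  proof eventually_elim
    case (elim z)
    have "(\<lambda>n. qf (S z) (g n z)) \<longlonglongrightarrow> qf (S z) (f z)"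
      unfolding sesq_def by (intro tendsto_intros tendsto_vec_nth elim)
    then show ?case by (intro lim_imp_Liminf) (auto intro: tendsto_ennrealI)
  qed
  then have "(\<integral>\<^sup>+z. ennreal (qf (S z) (f z)) \<partial>lborel) = (\<integral>\<^sup>+z. liminf (\<lambda>n. ennreal (qf (S z) (g n z))) \<partial>lborel)"
    by (intro nn_integral_cong_AE) auto
  also have "\<dots> \<le> liminf (\<lambda>n. \<integral>\<^sup>+z. ennreal (qf (S z) (g n z)) \<partial>lborel)"
    by (rule nn_integral_liminf) measurable
  also have "\<dots> \<le> ennreal b"
    using b by (intro Liminf_le) (auto simp: nn_integral_qf[OF S g] intro!: always_eventually ennreal_leI)
  finally have *: "(\<integral>\<^sup>+z. ennreal (qf (S z) (f z)) \<partial>lborel) \<le> ennreal b" .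
  then show fL: "f \<in> L2 S" unfolding L2_def by (auto intro: le_less_trans)
  show "sqnorm S f \<le> b" using * b0 by (simp add: nn_integral_qf[OF S fL])
qed

text \<open>The projection theorem for a space of functions. The minimizing sequence is chosen
  within 8^(-n) of the infimum so that it converges pointwise almost everywhere, and Fatou's lemma
  shows that the pointwise limit attains the infimum.\<close>

lemma L2K_projection:
  fixes S :: "'n::finite density"
  assumes S: "spectral_density S" and inv: "AE z in lborel. invertible (S z)" and f: "f \<in> L2 S"
  obtains h where "h \<in> L2K T S" "\<And>g. g \<in> trig_span T \<Longrightarrow> sp_inner S g (\<lambda>z. f z - h z) = 0"
proof -
  define N where "N k = sqnorm S (\<lambda>z. f z - k z)" for k
  define d where "d = (INF k\<in>L2K T S. N k)"
  have ne: "L2K T S \<noteq> {}" using trig_span_L2K[OF S trig_span_zero] by blast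
  have bdd: "bdd_below (N ` L2K T S)" unfolding N_def by (intro bdd_belowI2[of _ 0] sqnorm_nonneg[OF S])
  have dle: "d \<le> N k" if "k \<in> L2K T S" for k unfolding d_def by (rule cINF_lower[OF bdd that])
  have "\<exists>k\<in>L2K T S. N k < d + (1/8) ^ n" for n :: nat
    using cINF_less_iff[OF ne bdd, of "d + (1/8) ^ n"] unfolding d_def by simp
  then obtain k where k: "\<And>n. k n \<in> L2K T S" "\<And>n. N (k n) < d + (1/8) ^ n" by metis
  note kL = L2K_L2[OF k(1)]
  note [measurable] = L2_measurable[OF kL] L2_measurable[OF f]
  have cauchy: "sqnorm S (\<lambda>z. k m z - k n z) \<le> 2 * (1/8) ^ n + 2 * (1/8) ^ m" for m n
  proof -
    \<comment> \<open>The midpoint is a competitor at squared distance at least d; in the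
      parallelogram identity this bounds the difference of two near-minimizers.\<close>
    have mid: "(\<lambda>z. (1/2) *s (k n z + k m z)) \<in> L2K T S"
      by (intro L2K_scale[OF S] L2K_add[OF S] k)
    have "sqnorm S (\<lambda>z. (f z - k n z) + (f z - k m z)) = sqnorm S (\<lambda>z. 2 *s (f z - (1/2) *s (k n z + k m z)))"
      by (rule arg_cong[where f="sqnorm S"]) (auto simp: vec_eq_iff algebra_simps)
    also have "\<dots> = 4 * N (\<lambda>z. (1/2) *s (k n z + k m z))" unfolding N_def by (subst sqnorm_scale) simp
    finally have "4 * d \<le> sqnorm S (\<lambda>z. (f z - k n z) + (f z - k m z))" using dle[OF mid] by simp
    moreover have "sqnorm S (\<lambda>z. (f z - k n z) - (f z - k m z)) = sqnorm S (\<lambda>z. k m z - k n z)" by simp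
    ultimately show ?thesis
      using sqnorm_parallelogram[OF S L2_diff[OF S f kL[of n]] L2_diff[OF S f kL[of m]]] k(2)[of n] k(2)[of m]
      unfolding N_def by simp
  qed
  have "AE z in lborel. \<exists>C. \<forall>n. norm (k (Suc n) z - k n z) \<le> C * (1/2) ^ n"
  proof (rule L2_geometric_AE_bound[OF S inv, of "\<lambda>n z. k (Suc n) z - k n z"])
    fix n
    show "(\<lambda>z. k (Suc n) z - k n z) \<in> L2 S" by (intro L2_diff[OF S] kL)
    show "sqnorm S (\<lambda>z. k (Suc n) z - k n z) \<le> 4 * (1/8) ^ n"
    proof -
      have "0 \<le> (1/8::real) ^ n" by simp
      then show ?thesis using cauchy[of "Suc n" n] unfolding power_Suc by linarith
    qed
  qed
  then have conv: "AE z in lborel. convergent (\<lambda>n. k n z)"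
  proof eventually_elim
    case (elim z)
    then obtain C where C: "\<And>n. norm (k (Suc n) z - k n z) \<le> C * (1/2) ^ n" by blast
    have "summable (\<lambda>n. k (Suc n) z - k n z)"
      by (rule summable_comparison_test'[of "\<lambda>n. C * (1/2) ^ n" 0]) (auto intro!: summable_mult summable_geometric C)
    then have "convergent (\<lambda>n. \<Sum>i<n. k (Suc i) z - k i z)" by (simp add: summable_iff_convergent)
    then have "convergent (\<lambda>n. k n z - k 0 z)" by (simp only: sum_lessThan_telescope[of "\<lambda>i. k i z"])
    then have "convergent (\<lambda>n. k n z - k 0 z + k 0 z)" by (intro convergent_add convergent_const)
    then show ?case by simp
  qed
  \<comment> \<open>\<open>lim\<close> is total, so \<open>h\<close> is measurable everywhere; at
    points of divergence, a null set, its value is irrelevant.\<close>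
  define h where "h = (\<lambda>z. lim (\<lambda>n. k n z))"
  have hm [measurable]: "h \<in> borel_measurable borel"
    unfolding h_def by (rule borel_measurable_lim_metric) measurable
  have lim: "AE z in lborel. (\<lambda>n. k n z) \<longlonglongrightarrow> h z"
    using conv unfolding h_def by eventually_elim (simp add: convergent_LIMSEQ_iff)
  have small: "(1/8::real) ^ (n + m) \<le> (1/8) ^ m" for n m :: nat
    by (intro power_decreasing) auto
  have kh: "(\<lambda>z. k m z - h z) \<in> L2 S" "sqnorm S (\<lambda>z. k m z - h z) \<le> 4 * (1/8) ^ m" for m
  proof -
    have g: "(\<lambda>z. k m z - k (n + m) z) \<in> L2 S" for n by (intro L2_diff[OF S] kL)
    have b: "sqnorm S (\<lambda>z. k m z - k (n + m) z) \<le> 4 * (1/8) ^ m" for n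
      using cauchy[of m "n + m"] small[of n m] by linarith
    have l: "AE z in lborel. (\<lambda>n. k m z - k (n + m) z) \<longlonglongrightarrow> k m z - h z"
      using lim by eventually_elim (intro tendsto_diff tendsto_const LIMSEQ_ignore_initial_segment)
    show "(\<lambda>z. k m z - h z) \<in> L2 S" "sqnorm S (\<lambda>z. k m z - h z) \<le> 4 * (1/8) ^ m"
      using L2_Fatou[OF S g b _ l] by simp_all
  qed
  have hL: "h \<in> L2 S" using L2_diff[OF S kL[of 0] kh(1)[of 0]] by simp
  have hK: "h \<in> L2K T S"
  proof (rule L2K_closed[OF S hL])
    fix \<epsilon> :: real assume "\<epsilon> > 0"
    then obtain m where "(1/8::real) ^ m < \<epsilon> / 4" using real_arch_pow_inv[of "\<epsilon> / 4" "1/8"] by auto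
    then have "sqnorm S (\<lambda>z. h z - k m z) < \<epsilon>" using kh(2)[of m] sqnorm_minus_commute[of S h "k m"] by simp
    then show "\<exists>k\<in>L2K T S. sqnorm S (\<lambda>z. h z - k z) < \<epsilon>" using k(1) by blast
  qed
  have Nh: "N h \<le> d"
  proof (rule field_le_epsilon)
    fix \<epsilon> :: real assume "\<epsilon> > 0"
    then obtain m where m: "(1/8::real) ^ m < \<epsilon>" using real_arch_pow_inv[of "\<epsilon>" "1/8"] by auto
    have g: "(\<lambda>z. f z - k (n + m) z) \<in> L2 S" for n by (intro L2_diff[OF S] f kL)
    have b: "sqnorm S (\<lambda>z. f z - k (n + m) z) \<le> d + \<epsilon>" for n
      using k(2)[of "n + m", unfolded N_def] small[of n m] m by linarith
    have l: "AE z in lborel. (\<lambda>n. f z - k (n + m) z) \<longlonglongrightarrow> f z - h z"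
      using lim by eventually_elim (intro tendsto_diff tendsto_const LIMSEQ_ignore_initial_segment)
    show "N h \<le> d + \<epsilon>" unfolding N_def by (rule L2_Fatou(2)[OF S g b _ l]) measurable
  qed
  define x where "x = (\<lambda>z. f z - h z)"
  have x: "x \<in> L2 S" unfolding x_def by (rule L2_diff[OF S f hL])
  have "sp_inner S g x = 0" if g: "g \<in> trig_span T" for g
  proof -
    note gL = trig_span_L2[OF S g]
    define p where "p = sp_inner S x g"
    have var: "2 * Re (cnj c * p) \<le> (cmod c)\<^sup>2 * sqnorm S g" for c
    proof -
      have "(\<lambda>z. h z + c *s g z) \<in> L2K T S"
        by (intro L2K_add[OF S] L2K_scale[OF S] hK trig_span_L2K[OF S g])
      from dle[OF this] Nh have "N h \<le> N (\<lambda>z. h z + c *s g z)" by simp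
      also have "\<dots> = sqnorm S (\<lambda>z. x z - c *s g z)" unfolding N_def x_def by (simp add: algebra_simps)
      also have "\<dots> = sqnorm S x - 2 * Re (cnj c * p) + (cmod c)\<^sup>2 * sqnorm S g"
        using sqnorm_diff[OF S x L2_scale[OF S gL]] by (simp add: sp_inner_scale sqnorm_scale p_def)
      finally show ?thesis by (simp add: N_def x_def)
    qed
    \<comment> \<open>Inserting c = t p in the variational inequality gives 2 t |p|^2 \<le> t |p|^2
      for this t, which forces p = 0.\<close>
    define t where "t = 1 / (sqnorm S g + 1)"
    have g0: "sqnorm S g \<ge> 0" by (rule sqnorm_nonneg[OF S])
    have t: "t > 0" "t * sqnorm S g \<le> 1" using g0 by (auto simp: t_def)
    have pp: "cnj p * p = complex_of_real ((cmod p)\<^sup>2)" by (metis complex_norm_square mult.commute)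
    have "Re (cnj (complex_of_real t * p) * p) = t * (cmod p)\<^sup>2"
      by (simp only: complex_cnj_mult complex_cnj_complex_of_real mult.assoc pp of_real_mult[symmetric] Re_complex_of_real)
    then have "2 * (t * (cmod p)\<^sup>2) \<le> t * (t * sqnorm S g) * (cmod p)\<^sup>2"
      using var[of "complex_of_real t * p"] t by (simp add: norm_mult power_mult_distrib power2_eq_square mult_ac)
    also have "\<dots> \<le> t * 1 * (cmod p)\<^sup>2" using t by (intro mult_right_mono mult_left_mono) auto
    finally have "t * (cmod p)\<^sup>2 \<le> 0" by simp
    then have "p = 0" using t by (simp add: mult_le_0_iff)
    then show ?thesis using sp_inner_cnj[OF S x gL] by (simp add: p_def)
  qed
  then show ?thesis using that[OF hK] unfolding x_def by blast
qed

section \<open>Functions of finite energy\<close>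

lemma measurable_fst_plane [measurable]: "(fst :: real \<times> real \<Rightarrow> real) \<in> borel_measurable borel"
  and measurable_snd_plane [measurable]: "(snd :: real \<times> real \<Rightarrow> real) \<in> borel_measurable borel"
  by (auto simp: borel_prod[symmetric])

lemma plane_fst:
  fixes f :: "real \<times> real \<Rightarrow> 'b::{banach, second_countable_topology}"
  assumes "integrable lborel f"
  shows "AE l in lborel. integrable lborel (\<lambda>m. f (l, m))"
    "integrable lborel (\<lambda>l. LINT m|lborel. f (l, m))"
    "(LINT l|lborel. LINT m|lborel. f (l, m)) = (LINT z|lborel. f z)"
  using lborel_pair.AE_integrable_fst'[of f] lborel_pair.integrable_fst'[of f] lborel_pair.integral_fst'[of f] assms
  by (auto simp: lborel_prod)

lemma plane_snd:
  fixes f :: "real \<times> real \<Rightarrow> 'b::{banach, second_countable_topology}"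
  assumes "integrable lborel f"
  shows "AE m in lborel. integrable lborel (\<lambda>l. f (l, m))"
    "(LINT m|lborel. LINT l|lborel. f (l, m)) = (LINT z|lborel. f z)"
  using lborel_pair.AE_integrable_snd[of "\<lambda>l m. f (l, m)"] lborel_pair.integral_snd[of "\<lambda>l m. f (l, m)"] assms
  by (auto simp: lborel_prod)

lemma plane_AE:
  fixes P :: "real \<times> real \<Rightarrow> bool"
  shows "AE z in lborel. P z \<Longrightarrow> AE l in lborel. AE m in lborel. P (l, m)"
  using lborel_pair.AE_pair[of P] unfolding lborel_prod .

lemma plane_AE_I:
  fixes P :: "real \<times> real \<Rightarrow> bool"
  assumes "{z. P z} \<in> sets borel" "AE l in lborel. AE m in lborel. P (l, m)"
  shows "AE z in lborel. P z"
  using lborel_pair.AE_pair_measure[of P, unfolded lborel_prod] assms by simp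

lemma plane_AE_swap:
  fixes P :: "real \<times> real \<Rightarrow> bool"
  assumes "{z. P z} \<in> sets borel" "AE m in lborel. AE l in lborel. P (l, m)"
  shows "AE l in lborel. AE m in lborel. P (l, m)"
  using lborel_pair.AE_commute[of "\<lambda>l m. P (l, m)", unfolded lborel_prod] assms by simp

lemma measurable_plane_section [measurable]:
  assumes "f \<in> borel_measurable (borel :: (real \<times> real) measure)"
  shows "(\<lambda>m. f (l, m)) \<in> borel_measurable borel"
  by (rule measurable_compose[OF _ assms]) (simp add: borel_prod[symmetric])

lemma strip_borel [measurable]: "strip T \<in> sets borel"
proof -
  have "strip T = snd -` {0..T} \<inter> space borel" by (auto simp: strip_def)
  also have "\<dots> \<in> sets borel" by (rule measurable_sets[OF measurable_snd_plane]) simp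
  finally show ?thesis .
qed

lemma AE_all_finite:
  fixes P :: "'n::finite \<Rightarrow> 'a \<Rightarrow> bool"
  assumes "\<And>k. AE x in M. P k x"
  shows "AE x in M. \<forall>k. P k x"
proof -
  have "AE x in M. \<forall>k\<in>UNIV. P k x" using assms by (intro AE_finite_allI) auto
  then show ?thesis by simp
qed

lemma bounded_linear_vector_scale: "bounded_linear (\<lambda>v :: complex ^ 'n::finite. c *s v)"
  by (intro linear_conv_bounded_linear[THEN iffD1] linearI) (auto simp: vec_eq_iff algebra_simps)

lemma norm_vector_scale: "norm (c *s (v :: complex ^ 'n::finite)) = norm c * norm v"
proof -
  have "norm (c *s v) = L2_set (\<lambda>i. norm c * norm (v $ i)) UNIV" by (simp add: norm_vec_def norm_mult)
  then show ?thesis by (simp add: L2_set_right_distrib norm_vec_def)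
qed

lemma integrable_cis_scale:
  fixes f :: "'a \<Rightarrow> complex ^ 'n::finite"
  assumes f: "integrable M f" and g: "g \<in> borel_measurable M"
  shows "integrable M (\<lambda>x. cis (g x) *s f x)"
proof (rule Bochner_Integration.integrable_bound[OF f])
  show "(\<lambda>x. cis (g x) *s f x) \<in> borel_measurable M"
    using g borel_measurable_integrable[OF f] by measurable
qed (simp add: norm_vector_scale)

text \<open>The bound is the integral of the norm of \<open>a\<close> over the strip. As spectral
  densities are integrable, boundedness puts \<open>AK T a\<close> into \<open>L2\<close> of every
  density, whatever the pair.\<close>

lemma AK_bounded:
  fixes a :: "'n::finite vfield"
  assumes a: "set_integrable lborel (strip T) a"
  shows "\<exists>B. \<forall>z. norm (AK T a z) \<le> B"
proof (intro exI allI)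
  fix z
  have "norm (AK T a z) \<le> (LINT w|lborel. norm (indicator (strip T) w *\<^sub>R (cis (fst w * fst z + snd w * snd z) *s a w)))"
    unfolding AK_def set_lebesgue_integral_def by (rule integral_norm_bound)
  then show "norm (AK T a z) \<le> (LINT w|lborel. norm (indicator (strip T) w *\<^sub>R a w))"
    by (simp add: norm_vector_scale)
qed

lemma scale_scaleR_commute: "r *\<^sub>R (c *s (v :: complex ^ 'n::finite)) = c *s (r *\<^sub>R v)"
  by (simp add: vec_eq_iff)

lemma AK_measurable [measurable]:
  fixes a :: "'n::finite vfield"
  assumes a: "set_integrable lborel (strip T) a"
  shows "AK T a \<in> borel_measurable borel"
proof -
  have [measurable]: "(\<lambda>w. indicator (strip T) w *\<^sub>R a w) \<in> borel_measurable borel"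
    using borel_measurable_integrable[OF a[unfolded set_integrable_def]] by simp
  show ?thesis unfolding AK_def set_lebesgue_integral_def scale_scaleR_commute by measurable
qed

text \<open>Fubini's theorem. The inner integral in s need only exist for almost every t, and the
  outer integral ignores the others, so the identity holds at every z. It lets the pairings that
  contain \<open>partial_ft a\<close> be expressed through \<open>AK\<close>.\<close>

lemma strip_ft_partial_ft:
  fixes a :: "'n::finite vfield"
  assumes a: "set_integrable lborel (strip T) a"
  shows "strip_ft T (partial_ft a) z = AK T a z"
proof -
  define b where "b = (\<lambda>w. indicator (strip T) w *\<^sub>R a w)"
  have b: "integrable lborel b" using a by (simp add: b_def set_integrable_def)
  note [measurable] = borel_measurable_integrable[OF b]
  define f where "f w = cis (fst w * fst z + snd w * snd z) *s b w" for w
  have f: "integrable lborel f" unfolding f_def by (intro integrable_cis_scale b) simp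
  have "AK T a z = (LINT w|lborel. f w)"
    unfolding AK_def set_lebesgue_integral_def scale_scaleR_commute f_def b_def ..
  also have "\<dots> = (LINT t|lborel. LINT s|lborel. f (s, t))" by (rule plane_snd(2)[OF f, symmetric])
  also have "\<dots> = (LINT t|lborel. cis (t * snd z) *s (LINT s|lborel. cis (s * fst z) *s b (s, t)))"
  proof (rule integral_cong_AE)
    have [measurable]: "(\<lambda>(t, s). b (s, t)) \<in> borel_measurable (borel \<Otimes>\<^sub>M borel)"
      by (simp add: borel_prod[symmetric]) measurable
    show "(\<lambda>t. LINT s|lborel. f (s, t)) \<in> borel_measurable lborel"
      unfolding f_def by measurable
    show "(\<lambda>t. cis (t * snd z) *s (LINT s|lborel. cis (s * fst z) *s b (s, t))) \<in> borel_measurable lborel"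
      by measurable
    show "AE t in lborel. (LINT s|lborel. f (s, t)) = cis (t * snd z) *s (LINT s|lborel. cis (s * fst z) *s b (s, t))"
      using plane_snd(1)[OF b]
    proof eventually_elim
      case (elim t)
      have "integrable lborel (\<lambda>s. cis (s * fst z) *s b (s, t))" by (intro integrable_cis_scale elim) simp
      from integral_bounded_linear[OF bounded_linear_vector_scale this, symmetric]
      show ?case by (simp add: f_def cis_mult[symmetric] mult.commute)
    qed
  qed
  also have "\<dots> = strip_ft T (partial_ft a) z"
    unfolding strip_ft_def set_lebesgue_integral_def partial_ft_def
  proof (intro Bochner_Integration.integral_cong refl)
    fix t
    have "b (s, t) = indicator {0..T} t *\<^sub>R a (s, t)" for s by (auto simp: b_def strip_def indicator_def)
    then show "cis (t * snd z) *s (LINT s|lborel. cis (s * fst z) *s b (s, t)) =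
        indicator {0..T} t *\<^sub>R (cis (t * snd z) *s (LINT s|lborel. cis (s * fst (fst z, t)) *s a (s, snd (fst z, t))))"
      by (cases "t \<in> {0..T}") auto
  qed
  finally show ?thesis ..
qed

lemma strip_ft_measurable [measurable]:
  fixes y :: "'n::finite vfield"
  assumes "set_borel_measurable lborel (strip T) y"
  shows "strip_ft T y \<in> borel_measurable borel"
proof -
  have [measurable]: "(\<lambda>w. indicator (strip T) w *\<^sub>R y w) \<in> borel_measurable borel"
    using assms by (simp add: set_borel_measurable_def)
  have "strip_ft T y = (\<lambda>z. LINT t|lborel. cis (t * snd z) *s (indicator (strip T) (fst z, t) *\<^sub>R y (fst z, t)))"
    unfolding strip_ft_def set_lebesgue_integral_def scale_scaleR_commute by (simp add: strip_def indicator_def)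
  also have "\<dots> \<in> borel_measurable borel"
  proof -
    have "(\<lambda>p. (fst (fst p), snd p)) \<in> ((borel :: (real \<times> real) measure) \<Otimes>\<^sub>M (borel :: real measure)) \<rightarrow>\<^sub>M (borel :: (real \<times> real) measure)"
      by (intro borel_measurable_Pair) measurable
    then have [measurable]: "(\<lambda>p. indicator (strip T) (fst (fst p), snd p) *\<^sub>R y (fst (fst p), snd p))
        \<in> borel_measurable ((borel :: (real \<times> real) measure) \<Otimes>\<^sub>M (borel :: real measure))"
      by (rule measurable_compose) measurable
    show ?thesis by (rule lborel.borel_measurable_lebesgue_integral) (simp add: split_beta')
  qed
  finally show ?thesis .
qed

section \<open>One-dimensional transforms and their supports\<close>

lemma fourier_continuous:
  fixes f :: "real \<Rightarrow> complex"
  assumes f: "integrable lborel f"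
  shows "continuous_on UNIV (\<lambda>t. LINT m|lborel. cis (t * m) * f m)"
  unfolding continuous_on_sequentially comp_def
proof (intro ballI allI impI)
  fix x :: "nat \<Rightarrow> real" and t assume "(\<forall>n. x n \<in> UNIV) \<and> x \<longlonglongrightarrow> t"
  then have x: "x \<longlonglongrightarrow> t" by simp
  note [measurable] = borel_measurable_integrable[OF f]
  show "(\<lambda>n. LINT m|lborel. cis (x n * m) * f m) \<longlonglongrightarrow> (LINT m|lborel. cis (t * m) * f m)"
  proof (rule integral_dominated_convergence[where w="\<lambda>m. norm (f m)"])
    show "AE m in lborel. (\<lambda>n. cis (x n * m) * f m) \<longlonglongrightarrow> cis (t * m) * f m"
      unfolding cis_conv_exp by (intro AE_I2 tendsto_intros x)
  qed (use f in \<open>auto simp: norm_mult\<close>)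
qed

text \<open>Inversion recovers f, and hence its vanishing outside [0,T], only almost everywhere. The
  exponentials involve individual values of t, so continuity of the back transform is used to reach
  every t in the open complement.\<close>

lemma fourier_back_vanishes:
  fixes f Y :: "real \<Rightarrow> complex"
  assumes f: "integrable lborel f" and supp: "\<And>u. u \<notin> {0..T} \<Longrightarrow> f u = 0"
    and Y: "integrable lborel Y" and Y_def: "\<And>m. Y m = (LINT t|lborel. cis (t * m) * f t)"
    and t: "t \<notin> {0..T}"
  shows "(LINT m|lborel. cis (t * m) * cnj (Y m)) = 0"
proof -
  define \<phi> where "\<phi> = (\<lambda>u. LINT m|lborel. cis (u * m) * Y m)"
  \<comment> \<open>The reflection adjusts the sign of the exponent to the convention of
    \<open>fourier_inversion\<close>.\<close>
  have fm: "integrable lborel (\<lambda>u. f (- u))"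
    using lborel_integrable_real_affine[OF f, of "-1" 0] by simp
  have "Y m = (LINT u|lborel. cis (- (m * u)) * f (- u))" for m
    using lborel_integral_real_affine[of "-1" "\<lambda>t. cis (t * m) * f t" 0] by (simp add: Y_def mult.commute)
  from fourier_inversion[OF fm Y this]
  have ae: "AE u in lborel. f (- u) = complex_of_real (1 / (2 * pi)) * \<phi> u"
    unfolding \<phi>_def by (simp add: mult.commute)
  define A where "A = uminus -` (- {0..T})"
  \<comment> \<open>A closed set that contains almost every point of an open set contains all of
    that open set.\<close>
  have "open A" unfolding A_def by (intro open_vimage continuous_intros)
  moreover have "closed {u. \<phi> u = 0}"
    using continuous_closed_vimage[of "{0}" \<phi>] fourier_continuous[OF Y]
    unfolding \<phi>_def by (simp add: continuous_on_eq_continuous_at vimage_def)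
  moreover have "AE u \<in> A in lebesgue. u \<in> {u. \<phi> u = 0}"
  proof (rule AE_completion)
    show "AE u \<in> A in lborel. u \<in> {u. \<phi> u = 0}"
      using ae
    proof eventually_elim
      case (elim u)
      show ?case
      proof
        assume "u \<in> A"
        then have "f (- u) = 0" unfolding A_def using supp by auto
        then show "u \<in> {u. \<phi> u = 0}" using elim by simp
      qed
    qed
  qed
  moreover have "- t \<in> A" using t by (simp add: A_def)
  ultimately have "- t \<in> {u. \<phi> u = 0}" by (rule mem_closed_if_AE_lebesgue_open)
  then have "(LINT m|lborel. cis (- t * m) * Y m) = 0" by (simp add: \<phi>_def)
  then have "cnj (LINT m|lborel. cis (- t * m) * Y m) = 0" by simp
  then have "(LINT m|lborel. cnj (cis (- t * m) * Y m)) = 0" by (simp only: Bochner_Integration.integral_cnj)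
  then show ?thesis by (simp add: cis_cnj)
qed

section \<open>Finite energy and orthogonality to the exponentials\<close>

locale spectral_sum =
  fixes S :: "'n::finite density"
  assumes S: "spectral_density S" and inv: "AE z in lborel. invertible (S z)"
begin

lemma [measurable]: "S \<in> borel_measurable borel"
  by (rule spectral_densityD(2)[OF S])

text \<open>The Riesz representative in \<open>L2 S\<close> of the functional that pairs h with the
  transform of y, see \<open>sesq_dual_AE\<close>. Its squared norm is the energy of y.\<close>

definition dual :: "real \<Rightarrow> 'n vfield \<Rightarrow> 'n vfield" where
  "dual T y z = strip_ft T y z v* matrix_inv (S z)"

lemma energy_measurable:
  assumes "y \<in> energy_space T S"
  shows "strip_ft T y \<in> borel_measurable borel" "dual T y \<in> borel_measurable borel"
proof -
  show [measurable]: "strip_ft T y \<in> borel_measurable borel"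
    using assms by (intro strip_ft_measurable) (simp add: energy_space_def)
  show "dual T y \<in> borel_measurable borel" unfolding dual_def by measurable
qed

lemma sesq_dual_AE:
  "AE z in lborel. \<forall>h. sesq h (S z) (dual T y z) = cdot h (strip_ft T y z)"
  using spectral_densityD(3)[OF S] inv
proof eventually_elim
  case (elim z)
  show ?case
  proof
    fix h
    have "sesq h (S z) (dual T y z) = cnj (cdot (dual T y z v* S z) h)"
      using sesq_hermitian_cnj[OF psdD(1)[OF elim(1)], of h "dual T y z"] by (simp add: sesq_eq_cdot)
    also have "dual T y z v* S z = strip_ft T y z" by (simp add: dual_def vec_inv_cancel[OF elim(2)])
    finally show "sesq h (S z) (dual T y z) = cdot h (strip_ft T y z)" by (simp add: cdot_def mult.commute)
  qed
qed

lemma qf_dual_AE: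
  "AE z in lborel. sesq (strip_ft T y z) (matrix_inv (S z)) (strip_ft T y' z) = sesq (dual T y z) (S z) (dual T y' z)"
  using spectral_densityD(3)[OF S] inv
  by eventually_elim (simp add: dual_def sesq_matrix_inv)

lemma dual_L2:
  assumes y: "y \<in> energy_space T S"
  shows "dual T y \<in> L2 S"
proof -
  have "(\<integral>\<^sup>+z. ennreal (qf (S z) (dual T y z)) \<partial>lborel) =
      (\<integral>\<^sup>+z. ennreal (qf (matrix_inv (S z)) (strip_ft T y z)) \<partial>lborel)"
    by (rule nn_integral_cong_AE) (use qf_dual_AE[of T y y] in eventually_elim, simp)
  then show ?thesis using y energy_measurable[OF y] by (simp add: L2_def energy_space_def)
qed

lemma cdot_strip_ft_integrable:
  assumes y: "y \<in> energy_space T S" and h: "h \<in> L2 S"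
  shows "integrable lborel (\<lambda>z. cdot (h z) (strip_ft T y z))"
proof -
  note [measurable] = energy_measurable[OF y] L2_measurable[OF h]
  have ae: "AE z in lborel. sesq (h z) (S z) (dual T y z) = cdot (h z) (strip_ft T y z)"
    using sesq_dual_AE[of T y] by eventually_elim simp
  show ?thesis
    using L2_sesq_integrable[OF S h dual_L2[OF y]] integrable_cong_AE[OF _ _ ae] by simp
qed

text \<open>A frequency (s,t) outside the strip has t outside [0,T] whatever s is. On a slice the
  factor in s is a constant, and the integral over \<mu> is a back transform of a function supported
  in [0,T].\<close>

lemma trig_perp_energy:
  assumes y: "y \<in> energy_space T S" and g: "g \<in> trig_span T"
  shows "AE l in lborel. (LINT m|lborel. cdot (g (l, m)) (strip_ft T y (l, m))) = 0"
proof -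
  note [measurable] = energy_measurable[OF y]
  obtain W v where W: "finite W" "W \<subseteq> - strip T"
    and g: "g = (\<lambda>z. \<Sum>w\<in>W. cis (fst w * fst z + snd w * snd z) *s v w)"
    using g unfolding trig_span_def by blast
  \<comment> \<open>Integrability of S makes constant vectors members of \<open>L2 S\<close>;
    pairing them with the dual of y shows that finite energy implies an integrable transform, as
    inversion on the slices requires.\<close>
  have "integrable lborel (\<lambda>z. strip_ft T y z $ k)" for k
  proof -
    have "(\<lambda>z. axis k 1) \<in> L2 S" by (rule L2_bounded[OF S, of _ "norm (axis k 1 :: complex ^ 'n)"]) auto
    from cdot_strip_ft_integrable[OF y this]
    have "integrable lborel (\<lambda>z. cdot (axis k 1) (strip_ft T y z))" .
    moreover have "cdot (axis k 1) u = cnj (u $ k)" for u :: "complex ^ 'n"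
    proof -
      have "axis k 1 $ i * cnj (u $ i) = (if i = k then cnj (u $ i) else 0)" for i
        by (simp add: axis_def)
      then show ?thesis unfolding cdot_def by simp
    qed
    ultimately show ?thesis by (simp add: integrable_cnj)
  qed
  then have "AE l in lborel. \<forall>k. integrable lborel (\<lambda>m. strip_ft T y (l, m) $ k)"
    by (intro AE_all_finite plane_fst(1))
  moreover have "AE l in lborel. set_integrable lborel {0..T} (\<lambda>t. y (l, t))"
    using y by (simp add: energy_space_def)
  ultimately show ?thesis
  proof eventually_elim
    case (elim l)
    have z: "(LINT m|lborel. cis (t * m) * cnj (strip_ft T y (l, m) $ k)) = 0" if "t \<notin> {0..T}" for t k
    proof (rule fourier_back_vanishes[where T=T and f="\<lambda>t. indicator {0..T} t * y (l, t) $ k"])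
      show "integrable lborel (\<lambda>t. indicator {0..T} t * y (l, t) $ k)"
        by (rule set_integrable_nth[OF elim(2)])
      show "strip_ft T y (l, m) $ k = (LINT t|lborel. cis (t * m) * (indicator {0..T} t * y (l, t) $ k))" for m
        by (rule strip_ft_nth[OF elim(2)])
    qed (use elim that in auto)
    have i: "integrable lborel (\<lambda>m. cis (t * m) * cnj (strip_ft T y (l, m) $ k))" for t k
      using integrable_cis_mult[of "\<lambda>m. cnj (strip_ft T y (l, m) $ k)" t] elim(1) by (simp add: mult.commute integrable_cnj)
    have e: "cdot (g (l, m)) (strip_ft T y (l, m)) = (\<Sum>k\<in>UNIV. \<Sum>w\<in>W.
        (cis (fst w * l) * v w $ k) * (cis (snd w * m) * cnj (strip_ft T y (l, m) $ k)))" for m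
      unfolding cdot_def g by (simp add: sum_distrib_right sum_distrib_left cis_mult[symmetric] mult_ac)
    have "(LINT m|lborel. cdot (g (l, m)) (strip_ft T y (l, m))) = (\<Sum>k\<in>UNIV. \<Sum>w\<in>W.
        (cis (fst w * l) * v w $ k) * (LINT m|lborel. cis (snd w * m) * cnj (strip_ft T y (l, m) $ k)))"
      unfolding e using i by (simp add: Bochner_Integration.integral_sum Bochner_Integration.integrable_sum)
    also have "\<dots> = 0"
    proof (intro sum.neutral ballI)
      fix k w assume "w \<in> W"
      then have "snd w \<notin> {0..T}" using W(2) by (auto simp: strip_def)
      from z[OF this] show "(cis (fst w * l) * v w $ k) * (LINT m|lborel. cis (snd w * m) * cnj (strip_ft T y (l, m) $ k)) = 0"
        by simp
    qed
    finally show ?case .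
  qed
qed

text \<open>An approximation in \<open>L2 S\<close> says nothing about an individual slice. The
  slice integrals are therefore treated as one integrable function \<phi> of \<lambda>, whose norm
  in mean is bounded by the pairing of h - g with the transform of y and is thus arbitrarily
  small.\<close>

lemma L2K_perp_energy:
  assumes y: "y \<in> energy_space T S" and h: "h \<in> L2K T S"
  shows "AE l in lborel. (LINT m|lborel. cdot (h (l, m)) (strip_ft T y (l, m))) = 0"
proof -
  define Y where "Y = strip_ft T y"
  note hL = L2K_L2[OF h]
  have hY: "integrable lborel (\<lambda>z. cdot (h z) (Y z))" unfolding Y_def by (rule cdot_strip_ft_integrable[OF y hL])
  define \<phi> where "\<phi> = (\<lambda>l. LINT m|lborel. cdot (h (l, m)) (Y (l, m)))"
  have \<phi>: "integrable lborel \<phi>" unfolding \<phi>_def by (rule plane_fst(2)[OF hY])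
  note X = dual_L2[OF y]
  have "(LINT l|lborel. norm (\<phi> l)) \<le> 0 + \<epsilon>" if e: "\<epsilon> > 0" for \<epsilon>
  proof -
    define t where "t = (sqnorm S (dual T y) + 1) / \<epsilon>"
    have t: "t > 0" unfolding t_def using e sqnorm_nonneg[OF S, of "dual T y"] by simp
    obtain g where g: "g \<in> trig_span T" "sqnorm S (\<lambda>z. h z - g z) < \<epsilon> / t"
      using h t e unfolding L2K_iff[OF S] by (meson divide_pos_pos)
    note gL = trig_span_L2[OF S g(1)]
    define d where "d = (\<lambda>z. h z - g z)"
    have dL: "d \<in> L2 S" unfolding d_def by (rule L2_diff[OF S hL gL])
    have gY: "integrable lborel (\<lambda>z. cdot (g z) (Y z))" unfolding Y_def by (rule cdot_strip_ft_integrable[OF y gL])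
    have dY: "integrable lborel (\<lambda>z. cdot (d z) (Y z))" unfolding Y_def by (rule cdot_strip_ft_integrable[OF y dL])
    have ae: "AE l in lborel. norm (\<phi> l) \<le> (LINT m|lborel. norm (cdot (d (l, m)) (Y (l, m))))"
      using trig_perp_energy[OF y g(1)] plane_fst(1)[OF hY] plane_fst(1)[OF gY]
    proof eventually_elim
      case (elim l)
      have "\<phi> l = (LINT m|lborel. cdot (h (l, m)) (Y (l, m)) - cdot (g (l, m)) (Y (l, m)))"
        using elim by (simp add: \<phi>_def Y_def)
      also have "\<dots> = (LINT m|lborel. cdot (d (l, m)) (Y (l, m)))"
        by (simp add: d_def cdot_def sum_subtractf left_diff_distrib)
      finally show ?case by simp
    qed
    have "(LINT l|lborel. norm (\<phi> l)) \<le> (LINT l|lborel. LINT m|lborel. norm (cdot (d (l, m)) (Y (l, m))))"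
      using ae \<phi> plane_fst(2)[OF integrable_norm[OF dY]] by (intro integral_mono_AE) auto
    also have "\<dots> = (LINT z|lborel. norm (cdot (d z) (Y z)))" by (rule plane_fst(3)[OF integrable_norm[OF dY]])
    also have "\<dots> = (LINT z|lborel. norm (sesq (d z) (S z) (dual T y z)))"
    proof (rule integral_cong_AE)
      show "AE z in lborel. norm (cdot (d z) (Y z)) = norm (sesq (d z) (S z) (dual T y z))"
        using sesq_dual_AE[of T y] by eventually_elim (simp add: Y_def)
    qed (use L2_measurable[OF dL] energy_measurable[OF y] in \<open>auto simp: Y_def\<close>)
    also have "\<dots> \<le> (t * sqnorm S d + sqnorm S (dual T y) / t) / 2" by (rule integral_norm_sesq_young[OF S dL X t])
    also have "\<dots> \<le> (\<epsilon> + \<epsilon>) / 2"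
    proof -
      have "t * sqnorm S d \<le> \<epsilon>" using g(2) t by (simp add: field_simps d_def)
      moreover have "sqnorm S (dual T y) / t \<le> \<epsilon>"
        unfolding t_def using e sqnorm_nonneg[OF S, of "dual T y"] by (simp add: field_simps)
      ultimately show ?thesis by simp
    qed
    finally show ?thesis by simp
  qed
  from field_le_epsilon[OF this] have "(LINT l|lborel. norm (\<phi> l)) = 0"
    using Bochner_Integration.integral_nonneg[of lborel "\<lambda>l. norm (\<phi> l)"] by (intro antisym) auto
  then have "AE l in lborel. norm (\<phi> l) = 0"
    using integral_nonneg_eq_0_iff_AE[OF integrable_norm[OF \<phi>]] by simp
  then show ?thesis by (simp add: \<phi>_def Y_def)
qed

text \<open>As a function of \<lambda> the slice integral is integrable, and by assumption its
  transform vanishes at every s; inversion applied to the zero transform gives the claim. The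
  exceptional null set depends on t.\<close>

lemma fourier_coefficient_vanishes_AE:
  fixes f :: "real \<times> real \<Rightarrow> complex"
  assumes f: "integrable lborel f"
    and z: "\<And>s. (LINT z|lborel. cis (- (s * fst z + t * snd z)) * f z) = 0"
  shows "AE l in lborel. (LINT m|lborel. cis (- (t * m)) * f (l, m)) = 0"
proof -
  have ft: "integrable lborel (\<lambda>z. cis (- (s * fst z + t * snd z)) * f z)" for s
    by (rule Bochner_Integration.integrable_bound[OF f])
      (use borel_measurable_integrable[OF f] in \<open>auto simp: norm_mult\<close>)
  define \<psi> where "\<psi> = (\<lambda>l. LINT m|lborel. cis (- (t * m)) * f (l, m))"
  have \<psi>: "integrable lborel \<psi>" unfolding \<psi>_def using plane_fst(2)[OF ft[of 0]] by simp
  have "(LINT l|lborel. cis (- (s * l)) * \<psi> l) = 0" for s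
  proof -
    have "cis (- (s * l)) * \<psi> l = (LINT m|lborel. cis (- (s * l + t * m)) * f (l, m))" for l
    proof -
      have "cis (- (s * l + t * m)) * f (l, m) = cis (- (s * l)) * (cis (- (t * m)) * f (l, m))" for m
        by (simp add: cis_mult mult.assoc[symmetric])
      then show ?thesis unfolding \<psi>_def by (simp only: integral_mult_right_zero)
    qed
    then show ?thesis using plane_fst(3)[OF ft[of s]] z[of s] by simp
  qed
  from fourier_inversion[OF \<psi>, of "\<lambda>s. 0", unfolded this]
  show ?thesis by (simp add: \<psi>_def)
qed

text \<open>The converse direction: y is the inverse transform in \<mu> of the row vector x S,
  orthogonality places its support in [0,T], and inversion on almost every slice returns x
  S.\<close>

lemma energy_of_perp:
  assumes x: "x \<in> L2 S" and perp: "\<And>g. g \<in> trig_span T \<Longrightarrow> sp_inner S g x = 0"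
  obtains y where "y \<in> energy_space T S" "AE z in lborel. strip_ft T y z = x z v* S z"
proof -
  note [measurable] = L2_measurable[OF x]
  define \<phi> where "\<phi> = (\<lambda>z. x z v* S z)"
  have [measurable]: "\<phi> \<in> borel_measurable borel" unfolding \<phi>_def by measurable
  have aL: "(\<lambda>z. axis k 1) \<in> L2 S" for k
    by (rule L2_bounded[OF S, of _ "norm (axis k 1 :: complex ^ 'n)"]) auto
  have \<phi>i: "integrable lborel (\<lambda>z. \<phi> z $ k)" for k
    using L2_sesq_integrable[OF S x aL[of k]] by (simp add: sesq_axis \<phi>_def)
  define \<psi> where "\<psi> = (\<lambda>l t k. LINT m|lborel. cis (- (t * m)) * \<phi> (l, m) $ k)"
  define y where "y = (\<lambda>z. \<chi> k. complex_of_real (1 / (2 * pi)) * \<psi> (fst z) (snd z) k)"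
  have sect: "(\<lambda>p. \<phi> (fst (fst p), snd p)) \<in> borel_measurable ((borel :: (real \<times> real) measure) \<Otimes>\<^sub>M (borel :: real measure))"
    by (rule measurable_compose[where g=\<phi> and N=borel], intro borel_measurable_Pair) measurable
  have \<psi>m [measurable]: "(\<lambda>z. \<psi> (fst z) (snd z) k) \<in> borel_measurable borel" for k
    unfolding \<psi>_def using sect by (intro lborel.borel_measurable_lebesgue_integral) (simp add: split_beta')
  have ym [measurable]: "y \<in> borel_measurable borel"
    unfolding y_def by (intro measurable_vecI) simp
  have vanish: "AE l in lborel. \<psi> l t k = 0" if t: "t \<notin> {0..T}" for t k
    unfolding \<psi>_def
  proof (rule fourier_coefficient_vanishes_AE[OF \<phi>i])
    fix s
    have "(s, t) \<notin> strip T" using t by (auto simp: strip_def)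
    from perp[OF trig_span_single[OF this, of "axis k 1"]]
    have "(LINT z|lborel. sesq (cis (s * fst z + t * snd z) *s axis k 1) (S z) (x z)) = 0"
      by (simp add: sp_inner_def)
    also have "(LINT z|lborel. sesq (cis (s * fst z + t * snd z) *s axis k 1) (S z) (x z)) =
        (LINT z|lborel. cnj (cis (- (s * fst z + t * snd z)) * \<phi> z $ k))"
    proof (rule integral_cong_AE)
      show "AE z in lborel. sesq (cis (s * fst z + t * snd z) *s axis k 1) (S z) (x z) =
          cnj (cis (- (s * fst z + t * snd z)) * \<phi> z $ k)"
        using spectral_densityD(3)[OF S]
      proof eventually_elim
        case (elim z)
        show ?case
          using sesq_hermitian_cnj[OF psdD(1)[OF elim], of "axis k 1" "x z"]
          by (simp add: sesq_linear sesq_axis \<phi>_def cis_cnj add.commute)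
      qed
    qed measurable
    also have "\<dots> = cnj (LINT z|lborel. cis (- (s * fst z + t * snd z)) * \<phi> z $ k)"
      by (rule Bochner_Integration.integral_cnj)
    finally show "(LINT z|lborel. cis (- (s * fst z + t * snd z)) * \<phi> z $ k) = 0" by simp
  qed
  \<comment> \<open>The null set of \<lambda> varies with the uncountably many t. Fubini's theorem
    for null sets exchanges the quantifiers, at the price of an exceptional null set of t on each
    slice.\<close>
  have "AE l in lborel. AE t in lborel. t \<notin> {0..T} \<longrightarrow> \<psi> l t k = 0" for k
  proof -
    let ?P = "\<lambda>z. snd z \<notin> {0..T} \<longrightarrow> \<psi> (fst z) (snd z) k = 0"
    have P: "{z. ?P z} \<in> sets borel" by measurable
    have "AE l in lborel. ?P (l, t)" for t
      using vanish[of t k] by (cases "t \<in> {0..T}") auto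
    then have "AE t in lborel. AE l in lborel. ?P (l, t)" by (rule always_eventually[OF allI])
    from plane_AE_swap[of ?P, OF P this] show ?thesis by simp
  qed
  then have "AE l in lborel. \<forall>k. AE t in lborel. t \<notin> {0..T} \<longrightarrow> \<psi> l t k = 0"
    by (intro AE_all_finite)
  moreover have "AE l in lborel. \<forall>k. integrable lborel (\<lambda>m. \<phi> (l, m) $ k)"
    using plane_fst(1)[OF \<phi>i] by (intro AE_all_finite)
  ultimately have main: "AE l in lborel. set_integrable lborel {0..T} (\<lambda>t. y (l, t)) \<and>
      (AE m in lborel. strip_ft T y (l, m) = \<phi> (l, m))"
  proof eventually_elim
    case (elim l)
    have \<psi>l [measurable]: "(\<lambda>t. \<psi> l t k) \<in> borel_measurable borel" for k
      using measurable_plane_section[OF \<psi>m[of k], of l] by simp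
    have "norm (\<psi> l t k) \<le> (LINT m|lborel. norm (\<phi> (l, m) $ k))" for t k
      unfolding \<psi>_def by (rule order_trans[OF integral_norm_bound]) (simp add: norm_mult)
    then have b: "norm (indicator {0..T} t * \<psi> l t k) \<le> norm (indicator {0..T} t * (LINT m|lborel. norm (\<phi> (l, m) $ k)))" for t k
      using abs_ge_self order_trans by (fastforce simp: indicator_def)
    \<comment> \<open>A bounded function on a bounded interval. Together with the vanishing outside
      [0,T] this makes the slice of \<psi> integrable, which a transform of an integrable function
      need not be.\<close>
    have bd: "integrable lborel (\<lambda>t. indicator {0..T} t * \<psi> l t k)" for k
    proof (rule Bochner_Integration.integrable_bound)
      show "integrable lborel (\<lambda>t. indicator {0..T} t * (LINT m|lborel. norm (\<phi> (l, m) $ k)))"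
        by (intro integrable_mult_left integrable_real_indicator) (auto simp: emeasure_lborel_Icc_eq)
      show "(\<lambda>t. indicator {0..T} t * \<psi> l t k) \<in> borel_measurable lborel" by measurable
    qed (use b in auto)
    have y_ind: "indicator {0..T} t * y (l, t) $ k = complex_of_real (1 / (2 * pi)) * (indicator {0..T} t * \<psi> l t k)" for t k
      by (simp add: y_def)
    have si: "set_integrable lborel {0..T} (\<lambda>t. y (l, t))"
      unfolding set_integrable_def integrable_nth
      using bd by (simp add: vsc of_real_indicator y_ind)
    moreover have "AE m in lborel. \<forall>k. strip_ft T y (l, m) $ k = \<phi> (l, m) $ k"
    proof (rule AE_all_finite)
      fix k
      have ae: "AE t in lborel. indicator {0..T} t * \<psi> l t k = \<psi> l t k"
        using elim(1)[rule_format, of k] by eventually_elim (auto simp: indicator_def)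
      have \<psi>i: "integrable lborel (\<lambda>t. \<psi> l t k)"
        using bd[of k] integrable_cong_AE[OF _ _ ae] by simp
      have "AE m in lborel. \<phi> (l, m) $ k = complex_of_real (1 / (2 * pi)) * (LINT t|lborel. cis (t * m) * \<psi> l t k)"
        using elim(2) by (intro fourier_inversion \<psi>i) (auto simp: \<psi>_def)
      then show "AE m in lborel. strip_ft T y (l, m) $ k = \<phi> (l, m) $ k"
      proof eventually_elim
        case (elim m)
        have "(LINT t|lborel. cis (t * m) * \<psi> l t k) = (LINT t|lborel. cis (t * m) * (indicator {0..T} t * \<psi> l t k))"
          by (rule integral_cong_AE) (use ae in \<open>auto\<close>)
        then have "\<phi> (l, m) $ k = (LINT t|lborel. complex_of_real (1 / (2 * pi)) * (cis (t * m) * (indicator {0..T} t * \<psi> l t k)))"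
          unfolding elim by (simp only: integral_mult_right_zero)
        also have "\<dots> = (LINT t|lborel. cis (t * m) * (indicator {0..T} t * y (l, t) $ k))"
          by (simp add: y_ind mult_ac)
        finally show ?case unfolding strip_ft_nth[OF si] ..
      qed
    qed
    ultimately show ?case by (simp add: vec_eq_iff)
  qed
  have sb: "set_borel_measurable lborel (strip T) y" unfolding set_borel_measurable_def by measurable
  note [measurable] = strip_ft_measurable[OF sb]
  have eq: "AE z in lborel. strip_ft T y z = \<phi> z"
  proof (rule plane_AE_I)
    show "{z. strip_ft T y z = \<phi> z} \<in> sets borel" by measurable
    show "AE l in lborel. AE m in lborel. strip_ft T y (l, m) = \<phi> (l, m)"
      using main by eventually_elim simp
  qed
  have "(\<integral>\<^sup>+z. ennreal (qf (matrix_inv (S z)) (strip_ft T y z)) \<partial>lborel) = (\<integral>\<^sup>+z. ennreal (qf (S z) (x z)) \<partial>lborel)"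
  proof (rule nn_integral_cong_AE)
    show "AE z in lborel. ennreal (qf (matrix_inv (S z)) (strip_ft T y z)) = ennreal (qf (S z) (x z))"
      using eq spectral_densityD(3)[OF S] inv
      by eventually_elim (simp add: sesq_matrix_inv \<phi>_def vec_inv_cancel)
  qed
  then have "y \<in> energy_space T S"
    using sb main x by (auto simp: energy_space_def L2_def)
  then show ?thesis using that eq unfolding \<phi>_def by blast
qed

end

section \<open>The optimal spectral characteristic\<close>

lemma L2_mono:
  assumes S: "spectral_density S" and F: "spectral_density F" and K: "K \<ge> 0"
    and le: "AE z in lborel. \<forall>x. qf (F z) x \<le> K * qf (S z) x" and h: "h \<in> L2 S"
  shows "h \<in> L2 F" "sqnorm F h \<le> K * sqnorm S h"
proof -
  note [measurable] = spectral_densityD(2)[OF F] L2_measurable[OF h]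
  have i: "integrable lborel (\<lambda>z. K * qf (S z) (h z))" using h by (simp add: L2_iff[OF S])
  have fi: "integrable lborel (\<lambda>z. qf (F z) (h z))"
  proof (rule Bochner_Integration.integrable_bound[OF i])
    show "AE z in lborel. norm (qf (F z) (h z)) \<le> norm (K * qf (S z) (h z))"
      using le qf_nonneg_AE[OF F, of h] by eventually_elim (simp, metis abs_of_nonneg abs_ge_self order_trans)
  qed measurable
  show "h \<in> L2 F" using fi L2_measurable[OF h] by (simp add: L2_iff[OF F])
  have "sqnorm F h \<le> (LINT z|lborel. K * qf (S z) (h z))"
    unfolding sqnorm_def using fi i le by (intro integral_mono_AE) (auto elim: eventually_mono)
  then show "sqnorm F h \<le> K * sqnorm S h" by (simp add: sqnorm_def)
qed

text \<open>Domination of the forms carries the approximating exponential sums along. It moves the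
  optimal characteristic of a mixture into the spaces of both constituents, each of which is
  dominated by a multiple of the mixture.\<close>

lemma L2K_mono:
  assumes S: "spectral_density S" and F: "spectral_density F" and K: "K \<ge> 0"
    and le: "AE z in lborel. \<forall>x. qf (F z) x \<le> K * qf (S z) x" and h: "h \<in> L2K T S"
  shows "h \<in> L2K T F"
  unfolding L2K_iff[OF F]
proof (intro conjI allI impI)
  show "h \<in> L2 F" by (rule L2_mono(1)[OF S F K le L2K_L2[OF h]])
  fix \<epsilon> :: real assume e: "\<epsilon> > 0"
  then have "\<epsilon> / (K + 1) > 0" using K by simp
  then obtain g where g: "g \<in> trig_span T" "sqnorm S (\<lambda>z. h z - g z) < \<epsilon> / (K + 1)"
    using h unfolding L2K_iff[OF S] by blast
  have "sqnorm F (\<lambda>z. h z - g z) \<le> K * sqnorm S (\<lambda>z. h z - g z)"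
    by (rule L2_mono(2)[OF S F K le L2_diff[OF S L2K_L2[OF h] trig_span_L2[OF S g(1)]]])
  also have "\<dots> \<le> (K + 1) * sqnorm S (\<lambda>z. h z - g z)" using sqnorm_nonneg[OF S] by (intro mult_right_mono) auto
  also have "\<dots> < \<epsilon>" using g(2) K by (simp add: field_simps)
  finally show "\<exists>g\<in>trig_span T. sqnorm F (\<lambda>z. h z - g z) < \<epsilon>" using g(1) by blast
qed

lemma sqnorm_eq_0_AE:
  assumes S: "spectral_density S" and inv: "AE z in lborel. invertible (S z)" and h: "h \<in> L2 S" and z: "sqnorm S h = 0"
  shows "AE z in lborel. h z = 0"
proof -
  have "AE z in lborel. qf (S z) (h z) = 0"
    using z integral_nonneg_eq_0_iff_AE[OF _ qf_nonneg_AE[OF S, of h]] h by (simp add: sqnorm_def L2_iff[OF S])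
  then show ?thesis using inv spectral_densityD(3)[OF S]
    by eventually_elim (simp add: qf_eq_0_iff)
qed

lemma sqnorm_cong_AE:
  assumes S: "spectral_density S" and g: "g \<in> borel_measurable borel" and h: "h \<in> borel_measurable borel"
    and eq: "AE z in lborel. g z = h z"
  shows "sqnorm S g = sqnorm S h"
proof -
  note [measurable] = spectral_densityD(2)[OF S] g h
  show ?thesis unfolding sqnorm_def by (rule integral_cong_AE) (use eq in \<open>auto elim: eventually_mono\<close>)
qed

section \<open>The error as a distance to the unrestricted estimate\<close>

locale interpolation =
  fixes T :: real and a :: "'n::finite vfield" and F G :: "'n density"
  assumes a: "set_integrable lborel (strip T) a"
    and F: "spectral_density F" and G: "spectral_density G"
    and FG_inv: "AE z in lborel. invertible (F z + G z)"
begin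

sublocale spectral_sum "\<lambda>z. F z + G z"
  by unfold_locales (use spectral_density_add[OF F G] FG_inv in auto)

abbreviation "SS \<equiv> \<lambda>z. F z + G z"
abbreviation "A \<equiv> AK T a"

lemma [measurable]: "F \<in> borel_measurable borel" "G \<in> borel_measurable borel" "A \<in> borel_measurable borel"
  using spectral_densityD(2)[OF F] spectral_densityD(2)[OF G] AK_measurable[OF a] by auto

text \<open>The noncausal Wiener filter: it minimizes the error density at each frequency, without
  the restriction to exponentials outside the strip.\<close>

definition wiener :: "'n vfield" where
  "wiener z = A z v* F z v* matrix_inv (SS z)"

text \<open>The error density that remains for \<open>wiener\<close>. Its matrix is the one of the
  operator Q, so its integral supplies the second summand of the objective.\<close>

definition wiener_error :: "real \<times> real \<Rightarrow> complex" where
  "wiener_error z = sesq (A z) (F z ** matrix_inv (SS z) ** G z) (A z)"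

lemma wiener_measurable [measurable]: "wiener \<in> borel_measurable borel"
  unfolding wiener_def by measurable

lemma A_L2: "spectral_density M \<Longrightarrow> A \<in> L2 M"
  using AK_bounded[OF a] AK_measurable[OF a] L2_bounded by blast

lemma qf_F_le: "AE z in lborel. \<forall>x. qf (F z) x \<le> 1 * qf (SS z) x"
  using spectral_densityD(3)[OF G] by eventually_elim (simp add: sesq_linear psdD(2))

lemma wiener_AE: "AE z in lborel. wiener z v* SS z = A z v* F z"
  using FG_inv by eventually_elim (simp add: wiener_def vec_inv_cancel)

lemma sesq_wiener_AE: "AE z in lborel. \<forall>x. sesq (wiener z) (SS z) x = sesq (A z) (F z) x"
  using wiener_AE by eventually_elim (simp add: sesq_eq_cdot)

text \<open>An absorption argument: pointwise, the form of S at w = \<open>wiener\<close> is the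
  real part of the F-form at (A, w), hence at most half of the F-form at A plus half of the F-form
  at w. The latter is at most half of the left-hand side and is absorbed.\<close>

lemma wiener_L2: "wiener \<in> L2 SS"
proof -
  have i: "integrable lborel (\<lambda>z. qf (F z) (A z))" using A_L2[OF F] by (simp add: L2_iff[OF F])
  have "integrable lborel (\<lambda>z. qf (SS z) (wiener z))"
  proof (rule Bochner_Integration.integrable_bound[OF i])
    show "AE z in lborel. norm (qf (SS z) (wiener z)) \<le> norm (qf (F z) (A z))"
      using sesq_wiener_AE qf_F_le spectral_densityD(3)[OF F] spectral_densityD(3)[OF S]
    proof eventually_elim
      case (elim z)
      have "qf (SS z) (wiener z) = Re (sesq (A z) (F z) (wiener z))" using elim(1) by simp
      also have "\<dots> \<le> (1 * qf (F z) (A z) + qf (F z) (wiener z) / 1) / 2"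
        by (rule order_trans[OF complex_Re_le_cmod psd_young[OF elim(3)]]) simp
      also have "\<dots> \<le> (qf (F z) (A z) + qf (SS z) (wiener z)) / 2" using elim(2) by simp
      finally show ?case using psdD(2)[OF elim(4), of "wiener z"] by simp
    qed
  qed measurable
  then show ?thesis by (simp add: L2_iff[OF S])
qed

lemma wiener_L2_F: "wiener \<in> L2 F"
  using L2_mono(1)[OF S F _ qf_F_le wiener_L2] by simp

lemma wiener_error_AE: "AE z in lborel. wiener_error z = sesq (A z) (F z) (A z) - sesq (wiener z) (F z) (A z)"
  using sesq_wiener_AE
proof eventually_elim
  case (elim z)
  have "wiener_error z = sesq (wiener z) (G z) (A z)"
    unfolding wiener_error_def wiener_def sesq_eq_cdot by (simp add: vector_matrix_mul_assoc)
  also have "\<dots> = sesq (wiener z) (SS z) (A z) - sesq (wiener z) (F z) (A z)" by (simp add: sesq_linear)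
  finally show ?case using elim by simp
qed

lemma wiener_error_integrable: "integrable lborel wiener_error"
proof -
  have i: "integrable lborel (\<lambda>z. sesq (A z) (F z) (A z) - sesq (wiener z) (F z) (A z))"
    by (intro Bochner_Integration.integrable_diff L2_sesq_integrable F wiener_L2_F A_L2[OF F])
  have "wiener_error \<in> borel_measurable lborel" unfolding wiener_error_def by measurable
  then show ?thesis using integrable_cong_AE[OF _ _ wiener_error_AE] i by auto
qed

lemma error_density_AE:
  "AE z in lborel. \<forall>h. qf (F z) (A z - h) + qf (G z) h = Re (wiener_error z) + qf (SS z) (wiener z - h)"
  using wiener_error_AE sesq_wiener_AE spectral_densityD(3)[OF F] spectral_densityD(3)[OF S]
proof eventually_elim
  case (elim z)
  show ?case
  proof
    fix h
    have "Re (sesq (wiener z) (F z) (A z)) = Re (sesq (A z) (F z) (wiener z))"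
      using sesq_hermitian_cnj[OF psdD(1)[OF elim(3)], of "wiener z" "A z"] by simp
    then have "Re (wiener_error z) = qf (F z) (A z) - qf (SS z) (wiener z)" using elim(1,2) by simp
    moreover have "Re (sesq (wiener z) (SS z) h) = Re (sesq (A z) (F z) h)" using elim(2) by simp
    moreover have "qf (SS z) h = qf (F z) h + qf (G z) h" by (simp add: sesq_linear)
    ultimately show "qf (F z) (A z - h) + qf (G z) h = Re (wiener_error z) + qf (SS z) (wiener z - h)"
      unfolding qf_diff[OF psdD(1)[OF elim(3)]] qf_diff[OF psdD(1)[OF elim(4)]] by simp
  qed
qed

text \<open>In the completed square take h = \<open>wiener\<close>: the distance term disappears and
  the other side is a sum of two nonnegative forms.\<close>

lemma wiener_error_nonneg_AE: "AE z in lborel. 0 \<le> Re (wiener_error z)"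
  using error_density_AE spectral_densityD(3)[OF F] spectral_densityD(3)[OF G]
proof eventually_elim
  case (elim z)
  have "0 \<le> qf (F z) (A z - wiener z) + qf (G z) (wiener z)" using elim by (intro add_nonneg_nonneg psdD(2))
  then show ?case using elim(1) by (simp add: sesq_linear(9))
qed

definition wiener_mse :: real where
  "wiener_mse = (LINT z|lborel. Re (wiener_error z))"

lemma wiener_mse_nonneg: "0 \<le> wiener_mse"
  unfolding wiener_mse_def by (rule integral_nonneg_AE[OF wiener_error_nonneg_AE])

lemma mse_eq:
  assumes h: "h \<in> L2 SS"
  shows "mse T a h F G = ennreal (1 / (4 * pi\<^sup>2) * (wiener_mse + sqnorm SS (\<lambda>z. wiener z - h z)))"
proof -
  have d: "(\<lambda>z. wiener z - h z) \<in> L2 SS" by (rule L2_diff[OF S wiener_L2 h])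
  have i: "integrable lborel (\<lambda>z. Re (wiener_error z) + qf (SS z) (wiener z - h z))"
    using d wiener_error_integrable by (simp add: L2_iff[OF S])
  have "(\<integral>\<^sup>+z. ennreal (qf (F z) (A z - h z) + qf (G z) (h z)) \<partial>lborel)
    = (\<integral>\<^sup>+z. ennreal (Re (wiener_error z) + qf (SS z) (wiener z - h z)) \<partial>lborel)"
    by (rule nn_integral_cong_AE) (use error_density_AE in eventually_elim, simp)
  also have "\<dots> = ennreal (LINT z|lborel. Re (wiener_error z) + qf (SS z) (wiener z - h z))"
    by (rule nn_integral_eq_integral[OF i]) (use wiener_error_nonneg_AE qf_nonneg_AE[OF S, of "\<lambda>z. wiener z - h z"] in eventually_elim, simp)
  also have "(LINT z|lborel. Re (wiener_error z) + qf (SS z) (wiener z - h z)) = wiener_mse + sqnorm SS (\<lambda>z. wiener z - h z)"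
    unfolding wiener_mse_def sqnorm_def using wiener_error_integrable d by (simp add: L2_iff[OF S])
  finally show ?thesis unfolding mse_def using wiener_mse_nonneg sqnorm_nonneg[OF S] by (subst ennreal_mult) auto
qed

text \<open>The Pythagorean identity is kept along with orthogonality because it measures the excess
  error of a competitor by its distance to the optimum.\<close>

lemma projection_exists:
  obtains h where "h \<in> L2K T SS"
    "\<And>k. k \<in> L2K T SS \<Longrightarrow> sp_inner SS k (\<lambda>z. wiener z - h z) = 0"
    "\<And>k. k \<in> L2K T SS \<Longrightarrow> sqnorm SS (\<lambda>z. wiener z - k z) = sqnorm SS (\<lambda>z. wiener z - h z) + sqnorm SS (\<lambda>z. h z - k z)"
proof -
  obtain h where h: "h \<in> L2K T SS" and o: "\<And>g. g \<in> trig_span T \<Longrightarrow> sp_inner SS g (\<lambda>z. wiener z - h z) = 0"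
    using L2K_projection[OF S FG_inv wiener_L2] by blast
  define x where "x = (\<lambda>z. wiener z - h z)"
  have x: "x \<in> L2 SS" unfolding x_def by (rule L2_diff[OF S wiener_L2 L2K_L2[OF h]])
  have oK: "sp_inner SS k x = 0" if "k \<in> L2K T SS" for k
    by (rule L2K_orthogonalI[OF S x _ that]) (use o in \<open>simp add: x_def\<close>)
  have "sqnorm SS (\<lambda>z. wiener z - k z) = sqnorm SS x + sqnorm SS (\<lambda>z. h z - k z)" if k: "k \<in> L2K T SS" for k
  proof -
    have d: "(\<lambda>z. h z - k z) \<in> L2 SS" by (rule L2_diff[OF S L2K_L2[OF h] L2K_L2[OF k]])
    have "sp_inner SS (\<lambda>z. h z - k z) x = 0"
      using sp_inner_linear(2)[OF S L2K_L2[OF h] L2K_L2[OF k] x] oK[OF h] oK[OF k] by simp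
    then have "sp_inner SS x (\<lambda>z. h z - k z) = 0" using sp_inner_cnj[OF S d x] by simp
    moreover have "sqnorm SS (\<lambda>z. wiener z - k z) = sqnorm SS (\<lambda>z. x z + (h z - k z))" by (simp add: x_def)
    ultimately show ?thesis using sqnorm_add[OF S x d] by simp
  qed
  then show ?thesis using that h oK unfolding x_def by blast
qed

section \<open>The operator equation as an orthogonality relation\<close>

lemma B_pair_AE:
  assumes c: "c \<in> energy_space T SS" and y: "y \<in> energy_space T SS"
  shows "AE l in lborel. B_pair T F G c y l =
    complex_of_real (1 / (2 * pi)) * (LINT m|lborel. cdot (dual T c (l, m)) (strip_ft T y (l, m)))"
proof -
  note [measurable] = energy_measurable[OF c] energy_measurable[OF y]
  have "AE z in lborel. sesq (strip_ft T c z) (matrix_inv (SS z)) (strip_ft T y z) = cdot (dual T c z) (strip_ft T y z)"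
    using qf_dual_AE[of T c y] sesq_dual_AE[of T y] by eventually_elim simp
  from plane_AE[OF this] show ?thesis
  proof eventually_elim
    case (elim l)
    show ?case unfolding B_pair_def T_pair_def
      by (intro arg_cong2[where f=times] refl integral_cong_AE elim) measurable
  qed
qed

lemma R_pair_eq:
  "R_pair T F G (partial_ft a) y l =
    complex_of_real (1 / (2 * pi)) * (LINT m|lborel. cdot (wiener (l, m)) (strip_ft T y (l, m)))"
  unfolding R_pair_def T_pair_def strip_ft_partial_ft[OF a]
  by (simp add: sesq_eq_cdot wiener_def vector_matrix_mul_assoc)

lemma Q_pair_eq:
  "Q_pair T F G (partial_ft a) (partial_ft a) l = complex_of_real (1 / (2 * pi)) * (LINT m|lborel. wiener_error (l, m))"
  unfolding Q_pair_def T_pair_def strip_ft_partial_ft[OF a] by (simp add: wiener_error_def)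

lemma sp_inner_dual:
  assumes h: "h \<in> L2 SS" and y: "y \<in> energy_space T SS"
  shows "sp_inner SS h (dual T y) = (LINT l|lborel. LINT m|lborel. cdot (h (l, m)) (strip_ft T y (l, m)))"
proof -
  note [measurable] = energy_measurable[OF y] L2_measurable[OF h]
  have "sp_inner SS h (dual T y) = (LINT z|lborel. cdot (h z) (strip_ft T y z))"
    unfolding sp_inner_def by (rule integral_cong_AE) (use sesq_dual_AE[of T y] in \<open>auto elim: eventually_mono\<close>)
  then show ?thesis using plane_fst(3)[OF cdot_strip_ft_integrable[OF y h]] by simp
qed

text \<open>Integrating the operator equation over \<lambda>: it says that \<open>wiener\<close>
  minus the dual of c is orthogonal to the dual of every function of finite energy.\<close>

lemma BinvRa_sp_inner:
  assumes c: "BinvRa T a F G c" and y: "y \<in> energy_space T SS"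
  shows "sp_inner SS (dual T c) (dual T y) = sp_inner SS wiener (dual T y)"
proof -
  have ce: "c \<in> energy_space T SS" using c by (simp add: BinvRa_def)
  note [measurable] = energy_measurable[OF y] energy_measurable[OF ce]
  have "AE l in lborel. B_pair T F G c y l = R_pair T F G (partial_ft a) y l"
    using c y by (simp add: BinvRa_def)
  then have ae: "AE l in lborel. (LINT m|lborel. cdot (dual T c (l, m)) (strip_ft T y (l, m))) =
      (LINT m|lborel. cdot (wiener (l, m)) (strip_ft T y (l, m)))"
    using B_pair_AE[OF ce y] by eventually_elim (simp add: R_pair_eq)
  show ?thesis unfolding sp_inner_dual[OF dual_L2[OF ce] y] sp_inner_dual[OF wiener_L2 y]
    using plane_fst(2)[OF cdot_strip_ft_integrable[OF y dual_L2[OF ce]]]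
      plane_fst(2)[OF cdot_strip_ft_integrable[OF y wiener_L2]]
    by (intro integral_cong_AE ae) auto
qed

text \<open>The difference of two solutions is itself the difference of two duals, so it may be
  tested against itself and has norm zero.\<close>

lemma BinvRa_unique:
  assumes c: "BinvRa T a F G c" and c': "BinvRa T a F G c'"
  shows "AE z in lborel. dual T c z = dual T c' z"
proof -
  have ce: "c \<in> energy_space T SS" and ce': "c' \<in> energy_space T SS" using c c' by (auto simp: BinvRa_def)
  note L = dual_L2[OF ce] and L' = dual_L2[OF ce']
  have d: "(\<lambda>z. dual T c z - dual T c' z) \<in> L2 SS" by (rule L2_diff[OF S L L'])
  have "sp_inner SS (\<lambda>z. dual T c z - dual T c' z) (\<lambda>z. dual T c z - dual T c' z) = 0"
    using BinvRa_sp_inner[OF c ce] BinvRa_sp_inner[OF c' ce] BinvRa_sp_inner[OF c ce'] BinvRa_sp_inner[OF c' ce']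
    by (simp add: sp_inner_linear(2)[OF S L L' d] sp_inner_linear(4)[OF S L L' L] sp_inner_linear(4)[OF S L L' L'])
  then have "sqnorm SS (\<lambda>z. dual T c z - dual T c' z) = 0" using sqnorm_eq_sp_inner[OF S d] by simp
  from sqnorm_eq_0_AE[OF S FG_inv d this] show ?thesis by eventually_elim simp
qed

lemma optimal_exists:
  obtains h c where "optimal_char T a F G h" "BinvRa T a F G c" "AE z in lborel. h z = wiener z - dual T c z"
    "\<And>k. k \<in> L2K T SS \<Longrightarrow> sqnorm SS (\<lambda>z. wiener z - k z) = sqnorm SS (\<lambda>z. wiener z - h z) + sqnorm SS (\<lambda>z. h z - k z)"
proof -
  obtain h where h: "h \<in> L2K T SS"
    and perp: "\<And>k. k \<in> L2K T SS \<Longrightarrow> sp_inner SS k (\<lambda>z. wiener z - h z) = 0"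
    and pyth: "\<And>k. k \<in> L2K T SS \<Longrightarrow> sqnorm SS (\<lambda>z. wiener z - k z) = sqnorm SS (\<lambda>z. wiener z - h z) + sqnorm SS (\<lambda>z. h z - k z)"
    using projection_exists by blast
  have opt: "optimal_char T a F G h"
    unfolding optimal_char_def
  proof (intro conjI ballI h)
    fix k assume k: "k \<in> L2K T SS"
    show "mse T a h F G \<le> mse T a k F G"
      unfolding mse_eq[OF L2K_L2[OF h]] mse_eq[OF L2K_L2[OF k]] pyth[OF k]
      using sqnorm_nonneg[OF S] by (intro ennreal_leI mult_left_mono) auto
  qed
  have x: "(\<lambda>z. wiener z - h z) \<in> L2 SS" by (rule L2_diff[OF S wiener_L2 L2K_L2[OF h]])
  obtain c where c: "c \<in> energy_space T SS" "AE z in lborel. strip_ft T c z = (wiener z - h z) v* SS z"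
    using energy_of_perp[OF x perp[OF trig_span_L2K[OF S]]] by blast
  note [measurable] = energy_measurable[OF c(1)] L2_measurable[OF L2K_L2[OF h]]
  have dual: "AE z in lborel. dual T c z = wiener z - h z"
    using c(2) FG_inv by eventually_elim (simp add: dual_def vec_inv_cancel)
  have "BinvRa T a F G c"
    unfolding BinvRa_def
  proof (intro conjI ballI c(1))
    fix y assume y: "y \<in> energy_space T SS"
    note [measurable] = energy_measurable[OF y]
    \<comment> \<open>The dual of c is the residual \<open>wiener\<close> minus h. On almost every
      slice the part of h pairs to zero with the transform of y, which leaves the pairing of
      \<open>wiener\<close>, that is, the right-hand side.\<close>
    show "AE l in lborel. B_pair T F G c y l = R_pair T F G (partial_ft a) y l"
      using B_pair_AE[OF c(1) y] L2K_perp_energy[OF y h] plane_AE[OF dual]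
        plane_fst(1)[OF cdot_strip_ft_integrable[OF y wiener_L2]]
        plane_fst(1)[OF cdot_strip_ft_integrable[OF y L2K_L2[OF h]]]
    proof eventually_elim
      case (elim l)
      have "(LINT m|lborel. cdot (dual T c (l, m)) (strip_ft T y (l, m))) =
          (LINT m|lborel. cdot (wiener (l, m)) (strip_ft T y (l, m)) - cdot (h (l, m)) (strip_ft T y (l, m)))"
      proof (rule integral_cong_AE)
        show "AE m in lborel. cdot (dual T c (l, m)) (strip_ft T y (l, m)) =
            cdot (wiener (l, m)) (strip_ft T y (l, m)) - cdot (h (l, m)) (strip_ft T y (l, m))"
          using elim(3) by eventually_elim (simp add: cdot_def sum_subtractf left_diff_distrib)
      qed measurable
      also have "\<dots> = (LINT m|lborel. cdot (wiener (l, m)) (strip_ft T y (l, m)))"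
        using elim by simp
      finally show ?case using elim(1) by (simp add: R_pair_eq)
    qed
  qed
  moreover have "AE z in lborel. h z = wiener z - dual T c z" using dual by eventually_elim simp
  ultimately show ?thesis using that opt pyth by blast
qed

text \<open>The constructed optimum and solution of the operator equation are compared with
  arbitrary h and c; both comparisons reduce to null sets because a zero norm forces equality almost
  everywhere for an invertible density. Testing the equation with y = c identifies the squared norm
  of the dual of c with the R-term of the objective.\<close>

lemma optimal_characterization:
  assumes h: "optimal_char T a F G h" and c: "BinvRa T a F G c"
  shows "AE z in lborel. h z = wiener z - dual T c z"
    and "mse T a h F G = ennreal (objective T a F G c / (2 * pi))"
    and "k \<in> L2K T SS \<Longrightarrow> mse T a k F G = ennreal (objective T a F G c / (2 * pi) + 1 / (4 * pi\<^sup>2) * sqnorm SS (\<lambda>z. h z - k z))"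
    and "0 \<le> objective T a F G c"
proof -
  obtain h1 c1 where h1: "optimal_char T a F G h1" and c1: "BinvRa T a F G c1"
    and e1: "AE z in lborel. h1 z = wiener z - dual T c1 z"
    and pyth: "\<And>k. k \<in> L2K T SS \<Longrightarrow> sqnorm SS (\<lambda>z. wiener z - k z) = sqnorm SS (\<lambda>z. wiener z - h1 z) + sqnorm SS (\<lambda>z. h1 z - k z)"
    using optimal_exists by blast
  have hK: "h \<in> L2K T SS" and h1K: "h1 \<in> L2K T SS" using h h1 by (auto simp: optimal_char_def)
  note hL = L2K_L2[OF hK] and h1L = L2K_L2[OF h1K]
  have ce: "c \<in> energy_space T SS" using c by (simp add: BinvRa_def)
  note [measurable] = energy_measurable[OF ce] L2_measurable[OF hL] L2_measurable[OF h1L]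
  have "mse T a h F G \<le> mse T a h1 F G" using h h1K by (simp add: optimal_char_def)
  then have "sqnorm SS (\<lambda>z. wiener z - h z) \<le> sqnorm SS (\<lambda>z. wiener z - h1 z)"
    unfolding mse_eq[OF hL] mse_eq[OF h1L] using wiener_mse_nonneg sqnorm_nonneg[OF S]
    by (subst (asm) ennreal_le_iff) (auto simp: mult_le_cancel_left field_simps)
  \<comment> \<open>h is no farther from \<open>wiener\<close> than h1 is, while the Pythagorean
    identity makes it farther by the squared distance of h and h1.\<close>
  then have "sqnorm SS (\<lambda>z. h1 z - h z) = 0" using pyth[OF hK] sqnorm_nonneg[OF S, of "\<lambda>z. h1 z - h z"] by simp
  from sqnorm_eq_0_AE[OF S FG_inv L2_diff[OF S h1L hL] this]
  have hh1: "AE z in lborel. h z = h1 z" by eventually_elim simp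
  show form: "AE z in lborel. h z = wiener z - dual T c z"
    using hh1 e1 BinvRa_unique[OF c c1] by eventually_elim simp
  have n: "sqnorm SS (\<lambda>z. wiener z - h1 z) = sqnorm SS (dual T c)"
    by (rule sqnorm_cong_AE[OF S]) (use form hh1 in \<open>auto elim: eventually_elim2\<close>)
  have nk: "sqnorm SS (\<lambda>z. h1 z - k z) = sqnorm SS (\<lambda>z. h z - k z)" if "k \<in> L2K T SS" for k
    by (rule sqnorm_cong_AE[OF S]) (use hh1 L2_measurable[OF L2K_L2[OF that]] in \<open>auto elim: eventually_mono\<close>)
  have "sqnorm SS (dual T c) = Re (sp_inner SS wiener (dual T c))"
    using sqnorm_eq_sp_inner[OF S dual_L2[OF ce]] BinvRa_sp_inner[OF c ce] by simp
  also have "\<dots> = (LINT l|lborel. Re (LINT m|lborel. cdot (wiener (l, m)) (strip_ft T c (l, m))))"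
    unfolding sp_inner_dual[OF wiener_L2 ce]
    by (rule integral_Re[OF plane_fst(2)[OF cdot_strip_ft_integrable[OF ce wiener_L2]], symmetric])
  finally have n2: "sqnorm SS (dual T c) = \<dots>" .
  have kq: "wiener_mse = (LINT l|lborel. Re (LINT m|lborel. wiener_error (l, m)))"
  proof -
    have "wiener_mse = Re (LINT z|lborel. wiener_error z)" unfolding wiener_mse_def by (rule integral_Re[OF wiener_error_integrable])
    also have "\<dots> = Re (LINT l|lborel. LINT m|lborel. wiener_error (l, m))" by (simp only: plane_fst(3)[OF wiener_error_integrable])
    also have "\<dots> = (LINT l|lborel. Re (LINT m|lborel. wiener_error (l, m)))"
      by (rule integral_Re[OF plane_fst(2)[OF wiener_error_integrable], symmetric])
    finally show ?thesis .
  qed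
  have "objective T a F G c = (LINT l|lborel. 1 / (2 * pi) *
      (Re (LINT m|lborel. cdot (wiener (l, m)) (strip_ft T c (l, m))) + Re (LINT m|lborel. wiener_error (l, m))))"
    unfolding objective_def R_pair_eq Q_pair_eq by (simp add: field_simps)
  also have "\<dots> = 1 / (2 * pi) * (sqnorm SS (dual T c) + wiener_mse)"
    unfolding n2 kq integral_mult_right_zero
    by (subst Bochner_Integration.integral_add)
      (use plane_fst(2)[OF cdot_strip_ft_integrable[OF ce wiener_L2]] plane_fst(2)[OF wiener_error_integrable] in auto)
  finally have obj: "objective T a F G c = 1 / (2 * pi) * (sqnorm SS (dual T c) + wiener_mse)" .
  \<comment> \<open>Each pairing carries the factor 1/(2 pi), the error carries its square; one
    factor 1/(2 pi) therefore remains.\<close>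
  have obj': "1 / (4 * pi\<^sup>2) * (wiener_mse + sqnorm SS (dual T c)) = objective T a F G c / (2 * pi)"
    unfolding obj by (simp add: field_simps power2_eq_square)
  show k: "mse T a k F G = ennreal (objective T a F G c / (2 * pi) + 1 / (4 * pi\<^sup>2) * sqnorm SS (\<lambda>z. h z - k z))"
    if "k \<in> L2K T SS" for k
    unfolding mse_eq[OF L2K_L2[OF that]] pyth[OF that] n nk[OF that] obj'[symmetric]
    by (rule arg_cong[where f=ennreal]) (simp add: algebra_simps)
  have "sqnorm SS (\<lambda>z. h z - h z) = 0" by (simp add: sqnorm_def sesq_linear)
  then show "mse T a h F G = ennreal (objective T a F G c / (2 * pi))" using k[OF hK] by simp
  show "0 \<le> objective T a F G c" unfolding obj using sqnorm_nonneg[OF S, of "dual T c"] wiener_mse_nonneg by simp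
qed

end

section \<open>Least favorable densities and minimax robustness\<close>

lemma invertible_if_posdef:
  fixes M :: "complex ^ 'n ^ 'n::finite"
  assumes pos: "\<And>x. x \<noteq> 0 \<Longrightarrow> 0 < qf M x"
  shows "invertible M"
proof -
  \<comment> \<open>The form acts on row vectors, so positivity excludes a left kernel; the
    transpose turns this into the library's criterion for an injective matrix.\<close>
  have "x = 0" if "transpose M *v x = 0" for x
  proof (rule ccontr)
    assume "x \<noteq> 0"
    from pos[OF this] show False using that by (simp add: sesq_eq_cdot cdot_def)
  qed
  then have "\<exists>B. B ** transpose M = mat 1" by (simp add: matrix_left_invertible_ker)
  then have "\<exists>B. M ** B = mat 1" using left_invertible_transpose[of "transpose M"] by (metis transpose_transpose right_invertible_transpose)
  then show ?thesis by (metis invertible_right_inverse)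
qed

definition mixture :: "real \<Rightarrow> 'n::finite density \<Rightarrow> 'n density \<Rightarrow> 'n density" where
  "mixture \<epsilon> F F' = (\<lambda>z. (1 - \<epsilon>) *\<^sub>R F z + \<epsilon> *\<^sub>R F' z)"

lemma qf_mixture: "qf (mixture \<epsilon> F F' z) x = (1 - \<epsilon>) * qf (F z) x + \<epsilon> * qf (F' z) x"
  by (simp only: mixture_def sesq_linear(7) sesq_linear(11)) simp

lemma spectral_density_mixture:
  assumes "spectral_density F" "spectral_density F'" "0 < \<epsilon>" "\<epsilon> < 1"
  shows "spectral_density (mixture \<epsilon> F F')"
  unfolding mixture_def using assms by (intro spectral_density_add spectral_density_scaleR) auto

text \<open>For fixed h the error density is affine in the pair. The identity is stated in the
  extended reals for any measurable h, so an infinite error at either pair is permitted.\<close>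

lemma mse_mixture:
  assumes a: "set_integrable lborel (strip T) a" and h [measurable]: "h \<in> borel_measurable borel"
    and sd: "spectral_density F" "spectral_density F'" "spectral_density G" "spectral_density G'"
    and e: "0 < \<epsilon>" "\<epsilon> < 1"
  shows "mse T a h (mixture \<epsilon> F F') (mixture \<epsilon> G G') = ennreal (1 - \<epsilon>) * mse T a h F G + ennreal \<epsilon> * mse T a h F' G'"
proof -
  note [measurable] = sd[THEN spectral_densityD(2)] AK_measurable[OF a]
  define E where "E F G z = qf (F z) (AK T a z - h z) + qf (G z) (h z)" for F G z
  have [measurable]: "E F G \<in> borel_measurable borel" "E F' G' \<in> borel_measurable borel"
    unfolding E_def by measurable
  have nn: "AE z in lborel. 0 \<le> E F G z" "AE z in lborel. 0 \<le> E F' G' z"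
    using qf_nonneg_AE[OF sd(1), of "\<lambda>z. AK T a z - h z"] qf_nonneg_AE[OF sd(3), of h]
      qf_nonneg_AE[OF sd(2), of "\<lambda>z. AK T a z - h z"] qf_nonneg_AE[OF sd(4), of h]
    unfolding E_def by (eventually_elim, simp)+
  have "(\<integral>\<^sup>+z. ennreal (E (mixture \<epsilon> F F') (mixture \<epsilon> G G') z) \<partial>lborel) =
      (\<integral>\<^sup>+z. ennreal (1 - \<epsilon>) * ennreal (E F G z) + ennreal \<epsilon> * ennreal (E F' G' z) \<partial>lborel)"
  proof (rule nn_integral_cong_AE)
    show "AE z in lborel. ennreal (E (mixture \<epsilon> F F') (mixture \<epsilon> G G') z) =
        ennreal (1 - \<epsilon>) * ennreal (E F G z) + ennreal \<epsilon> * ennreal (E F' G' z)"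
      using nn
    proof eventually_elim
      case (elim z)
      have "E (mixture \<epsilon> F F') (mixture \<epsilon> G G') z = (1 - \<epsilon>) * E F G z + \<epsilon> * E F' G' z"
        unfolding E_def qf_mixture by (simp add: algebra_simps)
      then show ?case using elim e by (simp add: ennreal_mult)
    qed
  qed
  also have "\<dots> = ennreal (1 - \<epsilon>) * (\<integral>\<^sup>+z. ennreal (E F G z) \<partial>lborel) + ennreal \<epsilon> * (\<integral>\<^sup>+z. ennreal (E F' G' z) \<partial>lborel)"
    by (subst nn_integral_add) (auto simp: nn_integral_cmult)
  finally show ?thesis unfolding mse_def E_def by (simp add: distrib_left mult_ac)
qed

text \<open>Lower semicontinuity of the error under convergence almost everywhere. No norm attached
  to the pair enters, which allows a sequence that converges on account of another pair.\<close>

lemma mse_Fatou: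
  assumes a: "set_integrable lborel (strip T) a" and h: "\<And>n. h n \<in> borel_measurable borel"
    and F: "spectral_density F" and G: "spectral_density G"
    and lim: "AE z in lborel. (\<lambda>n. h n z) \<longlonglongrightarrow> f z"
    and M: "\<And>n. mse T a (h n) F G \<le> M"
  shows "mse T a f F G \<le> M"
proof -
  note [measurable] = h spectral_densityD(2)[OF F] spectral_densityD(2)[OF G] AK_measurable[OF a]
  define E where "E k z = qf (F z) (AK T a z - k z) + qf (G z) (k z)" for k z
  define c where "c = ennreal (1 / (4 * pi\<^sup>2))"
  have m: "mse T a k F G = c * (\<integral>\<^sup>+z. ennreal (E k z) \<partial>lborel)" for k
    by (simp add: mse_def E_def c_def)
  have c: "c \<noteq> 0" "c \<noteq> \<infinity>" by (auto simp: c_def)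
  have Em [measurable]: "E (h n) \<in> borel_measurable borel" for n unfolding E_def by measurable
  have "AE z in lborel. liminf (\<lambda>n. ennreal (E (h n) z)) = ennreal (E f z)"
    using lim
  proof eventually_elim
    case (elim z)
    have "(\<lambda>n. E (h n) z) \<longlonglongrightarrow> E f z"
      unfolding E_def sesq_def by (intro tendsto_intros tendsto_vec_nth elim)
    then show ?case by (intro lim_imp_Liminf) (auto intro: tendsto_ennrealI)
  qed
  then have "c * (\<integral>\<^sup>+z. ennreal (E f z) \<partial>lborel) = (\<integral>\<^sup>+z. liminf (\<lambda>n. ennreal (E (h n) z)) \<partial>lborel) * c"
    by (subst mult.commute, intro arg_cong2[where f=times] refl nn_integral_cong_AE) auto
  also have "\<dots> \<le> liminf (\<lambda>n. \<integral>\<^sup>+z. ennreal (E (h n) z) \<partial>lborel) * c"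
    by (intro mult_right_mono nn_integral_liminf) auto
  also have "\<dots> \<le> (M / c) * c"
  proof (rule mult_right_mono)
    have "(\<integral>\<^sup>+z. ennreal (E (h n) z) \<partial>lborel) \<le> M / c" for n
      using M[of n] c unfolding m
      using divide_right_mono_ennreal[of "c * (\<integral>\<^sup>+z. ennreal (E (h n) z) \<partial>lborel)" M c]
      by (simp add: ennreal_mult_divide_eq mult.commute[of c])
    then show "liminf (\<lambda>n. \<integral>\<^sup>+z. ennreal (E (h n) z) \<partial>lborel) \<le> M / c"
      by (intro Liminf_le always_eventually allI) simp_all
  qed simp
  also have "M / c * c = M * c / c" by (metis ennreal_times_divide mult.commute)
  also have "\<dots> = M" using c by (intro mult_divide_eq_ennreal) auto
  finally show ?thesis unfolding m .
qed

section \<open>The saddle point for a convex class\<close>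

locale convex_problem =
  fixes D :: "('n::finite density \<times> 'n density) set" and T :: real and a :: "'n vfield"
    and F0 G0 :: "'n density" and c0 :: "'n vfield"
  assumes a: "set_integrable lborel (strip T) a"
    and sd: "\<And>F G. (F, G) \<in> D \<Longrightarrow> spectral_density F \<and> spectral_density G"
    and conv: "\<And>F G F' G' \<epsilon>. (F, G) \<in> D \<Longrightarrow> (F', G') \<in> D \<Longrightarrow> 0 < \<epsilon> \<Longrightarrow> \<epsilon> < 1 \<Longrightarrow>
      (mixture \<epsilon> F F', mixture \<epsilon> G G') \<in> D"
    and inv0: "AE z in lborel. invertible (F0 z + G0 z)"
    and problem: "solves_problem D T a F0 G0 c0"
begin

lemma D0: "(F0, G0) \<in> D" and c0: "BinvRa T a F0 G0 c0"
  using problem by (auto simp: solves_problem_def)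

sublocale base: interpolation T a F0 G0
  by unfold_locales (use a sd[OF D0] inv0 in auto)

definition M0 :: real where
  "M0 = objective T a F0 G0 c0 / (2 * pi)"

lemma M0_nonneg: "0 \<le> M0"
  using base.optimal_exists base.optimal_characterization(4)[OF _ c0] unfolding M0_def by (metis divide_nonneg_pos pi_gt_zero zero_less_mult_iff zero_less_numeral)

text \<open>The witness is the optimal characteristic of the mixture with weight \<epsilon> on
  (F,G). Its error there is the objective divided by 2 pi, hence at most \<open>M0\<close>, and by
  affinity it splits into the errors at the two constituents.\<close>

lemma mixture_optimal:
  assumes D: "(F, G) \<in> D" and e: "0 < \<epsilon>" "\<epsilon> < 1"
  obtains h where "h \<in> L2K T (\<lambda>z. F0 z + G0 z)" "h \<in> L2K T (\<lambda>z. F z + G z)"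
    "ennreal (1 - \<epsilon>) * mse T a h F0 G0 + ennreal \<epsilon> * mse T a h F G \<le> ennreal M0"
proof -
  let ?F = "mixture \<epsilon> F0 F" and ?G = "mixture \<epsilon> G0 G"
  have D': "(?F, ?G) \<in> D" by (rule conv[OF D0 D e])
  have s0: "spectral_density F0" "spectral_density G0" and s: "spectral_density F" "spectral_density G"
    and s': "spectral_density ?F" "spectral_density ?G"
    using sd[OF D0] sd[OF D] sd[OF D'] by auto
  have q: "qf (?F z + ?G z) x = (1 - \<epsilon>) * qf (F0 z + G0 z) x + \<epsilon> * qf (F z + G z) x" for z x
    by (simp add: sesq_linear(7) qf_mixture algebra_simps)
  note psd0 = spectral_densityD(3)[OF spectral_density_add[OF s0]]
    and psd1 = spectral_densityD(3)[OF spectral_density_add[OF s]]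
  have inv: "AE z in lborel. invertible (?F z + ?G z)"
    using psd0 psd1 inv0
  proof eventually_elim
    case (elim z)
    show ?case
    proof (rule invertible_if_posdef)
      fix x :: "complex ^ 'n" assume "x \<noteq> 0"
      then have "0 < qf (F0 z + G0 z) x"
        using qf_eq_0_iff[OF elim(1,3), of x] psdD(2)[OF elim(1), of x] by simp
      then show "0 < qf (?F z + ?G z) x"
        unfolding q using e psdD(2)[OF elim(2), of x] by (intro add_pos_nonneg mult_pos_pos mult_nonneg_nonneg) auto
    qed
  qed
  interpret mix: interpolation T a ?F ?G
    by unfold_locales (use a s' inv in auto)
  obtain h c where h: "optimal_char T a ?F ?G h" and c: "BinvRa T a ?F ?G c"
    using mix.optimal_exists by blast
  have hK: "h \<in> L2K T (\<lambda>z. ?F z + ?G z)" using h by (simp add: optimal_char_def)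
  \<comment> \<open>The maximum property applies because the mixture belongs to D and its sum is
    invertible, being at least a positive multiple of the definite F0 + G0.\<close>
  have "objective T a ?F ?G c \<le> objective T a F0 G0 c0"
    using problem D' inv c unfolding solves_problem_def by blast
  then have "objective T a ?F ?G c / (2 * pi) \<le> M0"
    unfolding M0_def by (intro divide_right_mono) auto
  then have "mse T a h ?F ?G \<le> ennreal M0"
    using mix.optimal_characterization(2)[OF h c] by (simp add: ennreal_leI)
  then have le: "ennreal (1 - \<epsilon>) * mse T a h F0 G0 + ennreal \<epsilon> * mse T a h F G \<le> ennreal M0"
    using mse_mixture[OF a L2_measurable[OF L2K_L2[OF hK]] s0(1) s(1) s0(2) s(2) e] by simp
  \<comment> \<open>Discards the nonnegative contribution of the other constituent; the factors
    \<open>1 / (1 - \<epsilon>)\<close> and \<open>1 / \<epsilon>\<close> of the two dominations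
    result from it.\<close>
  have dom: "y \<le> 1 / t * (r * x + t * y)" if "0 < t" "0 \<le> r" "0 \<le> x" for r t x y :: real
    using that by (simp add: field_simps)
  have le0: "AE z in lborel. \<forall>x. qf (F0 z + G0 z) x \<le> 1 / (1 - \<epsilon>) * qf (?F z + ?G z) x"
    using psd1
  proof eventually_elim
    case (elim z)
    show ?case
    proof
      fix x
      show "qf (F0 z + G0 z) x \<le> 1 / (1 - \<epsilon>) * qf (?F z + ?G z) x"
        unfolding q add.commute[of "(1 - \<epsilon>) * _"] by (rule dom) (use e psdD(2)[OF elim] in auto)
    qed
  qed
  have 0: "h \<in> L2K T (\<lambda>z. F0 z + G0 z)"
    by (rule L2K_mono[OF mix.S base.S _ le0 hK]) (use e in auto)
  have le1: "AE z in lborel. \<forall>x. qf (F z + G z) x \<le> 1 / \<epsilon> * qf (?F z + ?G z) x"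
    using psd0
  proof eventually_elim
    case (elim z)
    show ?case
    proof
      fix x
      show "qf (F z + G z) x \<le> 1 / \<epsilon> * qf (?F z + ?G z) x"
        unfolding q by (rule dom) (use e psdD(2)[OF elim] in auto)
    qed
  qed
  have 1: "h \<in> L2K T (\<lambda>z. F z + G z)"
    by (rule L2K_mono[OF mix.S spectral_density_add[OF s] _ le1 hK]) (use e in auto)
  show ?thesis using that 0 1 le by blast
qed

text \<open>If a weighted mean is at most \<open>M0\<close> and one term is at least
  \<open>M0\<close>, the other is at most \<open>M0\<close>. In the extended reals the cancellation
  is legitimate because the term removed is finite.\<close>

lemma mse_le_of_mixture:
  assumes le: "ennreal (1 - \<epsilon>) * m0 + ennreal \<epsilon> * m \<le> ennreal M0" and m0: "ennreal M0 \<le> m0" and e: "0 < \<epsilon>" "\<epsilon> < 1"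
  shows "m \<le> ennreal M0"
proof -
  have "ennreal (1 - \<epsilon>) * ennreal M0 + ennreal \<epsilon> * m \<le> ennreal M0"
    using le m0 by (meson add_right_mono mult_left_mono order_trans zero_le)
  moreover have "ennreal M0 = ennreal (1 - \<epsilon>) * ennreal M0 + ennreal \<epsilon> * ennreal M0"
  proof -
    have "ennreal M0 = ennreal ((1 - \<epsilon>) * M0 + \<epsilon> * M0)" by (simp add: algebra_simps)
    also have "\<dots> = ennreal ((1 - \<epsilon>) * M0) + ennreal (\<epsilon> * M0)"
      using e M0_nonneg by (intro ennreal_plus) auto
    finally show ?thesis using e M0_nonneg by (simp add: ennreal_mult)
  qed
  ultimately have "ennreal (1 - \<epsilon>) * ennreal M0 + ennreal \<epsilon> * m \<le> ennreal (1 - \<epsilon>) * ennreal M0 + ennreal \<epsilon> * ennreal M0"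
    by simp
  then have "ennreal \<epsilon> * m \<le> ennreal \<epsilon> * ennreal M0"
    by (simp add: ennreal_add_left_cancel_le ennreal_mult_eq_top_iff)
  then show ?thesis using e by (simp add: ennreal_mult_le_mult_iff)
qed

text \<open>A single mixture suffices, here with weight 1/2. Its characteristic competes at (F0,G0),
  where it cannot beat \<open>M0\<close>, so its error at (F,G) is at most \<open>M0\<close>; it
  also competes at (F,G), where the optimum is no worse. This covers pairs with a singular
  sum.\<close>

lemma least_favorable: "least_favorable D T a F0 G0"
  unfolding least_favorable_def
proof (intro conjI D0)
  obtain h0 where h0: "optimal_char T a F0 G0 h0" using base.optimal_exists by blast
  have m0: "mse T a h0 F0 G0 = ennreal M0"
    unfolding M0_def by (rule base.optimal_characterization(2)[OF h0 c0])
  have "mse T a h F G \<le> mse T a h0 F0 G0" if D: "(F, G) \<in> D" and h: "optimal_char T a F G h" for F G h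
  proof -
    obtain k where k: "k \<in> L2K T (\<lambda>z. F0 z + G0 z)" "k \<in> L2K T (\<lambda>z. F z + G z)"
      "ennreal (1 - 1/2) * mse T a k F0 G0 + ennreal (1/2) * mse T a k F G \<le> ennreal M0"
      by (rule mixture_optimal[OF D, of "1/2"]) auto
    have "mse T a h F G \<le> mse T a k F G" using h k(2) by (simp add: optimal_char_def)
    also have "\<dots> \<le> ennreal M0"
    proof (rule mse_le_of_mixture[OF k(3)])
      show "ennreal M0 \<le> mse T a k F0 G0" using h0 k(1) m0 by (simp add: optimal_char_def)
    qed auto
    finally show ?thesis using m0 by simp
  qed
  then show "\<exists>h0. optimal_char T a F0 G0 h0 \<and> (\<forall>(F, G)\<in>D. \<forall>h. optimal_char T a F G h \<longrightarrow> mse T a h F G \<le> mse T a h0 F0 G0)"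
    using h0 by blast
qed

text \<open>\<open>h0\<close> is known to lie in the space of F0 + G0 only, so its error at (F,G) is
  reached as a limit: the characteristics of mixtures with vanishing weight have error at most
  \<open>M0\<close> at (F,G) and converge to \<open>h0\<close> almost everywhere.\<close>

lemma saddle_point:
  assumes h0: "optimal_char T a F0 G0 h0" and D: "(F, G) \<in> D"
  shows "mse T a h0 F G \<le> ennreal M0"
proof -
  \<comment> \<open>The ratio 1/8 is the one that \<open>L2_geometric_AE_bound\<close> requires. The
    factor 1/2 keeps \<open>1 - e n\<close> at least 1/2 and cancels the resulting 2 in the estimate
    of \<open>N n\<close>.\<close>
  define e :: "nat \<Rightarrow> real" where "e n = (1/2) * (1/8) ^ n" for n
  have e: "0 < e n" "e n \<le> 1/2" "e n < 1" for n
    using power_le_one[of "1/8::real" n] unfolding e_def by auto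
  have "\<exists>h. h \<in> L2K T (\<lambda>z. F0 z + G0 z) \<and>
      ennreal (1 - e n) * mse T a h F0 G0 + ennreal (e n) * mse T a h F G \<le> ennreal M0" for n
    using mixture_optimal[OF D e(1) e(3)] by metis
  then obtain h where hK: "\<And>n. h n \<in> L2K T (\<lambda>z. F0 z + G0 z)"
    and le: "\<And>n. ennreal (1 - e n) * mse T a (h n) F0 G0 + ennreal (e n) * mse T a (h n) F G \<le> ennreal M0"
    by metis
  define N where "N n = sqnorm (\<lambda>z. F0 z + G0 z) (\<lambda>z. h0 z - h n z)" for n
  define \<kappa> where "\<kappa> = 1 / (4 * pi\<^sup>2)"
  have \<kappa>: "\<kappa> > 0" by (simp add: \<kappa>_def)
  have N0: "0 \<le> N n" for n unfolding N_def by (rule sqnorm_nonneg[OF base.S])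
  have m0: "mse T a (h n) F0 G0 = ennreal (M0 + \<kappa> * N n)" for n
    using base.optimal_characterization(3)[OF h0 c0 hK[of n]] by (simp add: M0_def \<kappa>_def N_def)
  have m: "mse T a (h n) F G \<le> ennreal M0" for n
  proof (rule mse_le_of_mixture[OF le[of n]])
    show "ennreal M0 \<le> mse T a (h n) F0 G0"
      unfolding m0 using \<kappa> N0[of n] by (intro ennreal_leI) simp
  qed (use e in auto)
  \<comment> \<open>The error at (F,G) is dropped from the mixture inequality; what remains bounds
    the excess error of \<open>h n\<close> at (F0,G0), and this excess is \<kappa> times the squared
    distance.\<close>
  have N: "N n \<le> (M0 / \<kappa>) * (1/8) ^ n" for n
  proof -
    have "ennreal (1 - e n) * ennreal (M0 + \<kappa> * N n) \<le> ennreal M0"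
      by (rule order_trans[OF _ le[of n]]) (simp add: m0)
    then have "ennreal ((1 - e n) * (M0 + \<kappa> * N n)) \<le> ennreal M0"
      using e(3)[of n] N0[of n] M0_nonneg \<kappa> ennreal_mult[of "1 - e n" "M0 + \<kappa> * N n"] by simp
    then have "(1 - e n) * (M0 + \<kappa> * N n) \<le> M0" using M0_nonneg by simp
    then have "(1 - e n) * (\<kappa> * N n) \<le> e n * M0" by (simp add: algebra_simps)
    moreover have "(1/2) * (\<kappa> * N n) \<le> (1 - e n) * (\<kappa> * N n)"
      using e(2)[of n] \<kappa> N0[of n] by (intro mult_right_mono) auto
    ultimately have "\<kappa> * N n \<le> 2 * e n * M0" by simp
    then show ?thesis using \<kappa> by (simp add: e_def field_simps)
  qed
  have h0K: "h0 \<in> L2K T (\<lambda>z. F0 z + G0 z)" using h0 by (simp add: optimal_char_def)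
  have "AE z in lborel. \<exists>C. \<forall>n. norm (h0 z - h n z) \<le> C * (1/2) ^ n"
    using N unfolding N_def
    by (intro L2_geometric_AE_bound[OF base.S inv0] L2_diff[OF base.S] L2K_L2[OF h0K] L2K_L2[OF hK])
  then have lim: "AE z in lborel. (\<lambda>n. h n z) \<longlonglongrightarrow> h0 z"
  proof eventually_elim
    case (elim z)
    then obtain C where C: "\<And>n. norm (h0 z - h n z) \<le> C * (1/2) ^ n" by blast
    have "(\<lambda>n. C * (1/2) ^ n) \<longlonglongrightarrow> 0" by (intro tendsto_mult_right_zero LIMSEQ_power_zero) simp
    then have "(\<lambda>n. h0 z - h n z) \<longlonglongrightarrow> 0"
      by (rule Lim_null_comparison[rotated]) (use C in auto)
    from tendsto_diff[OF tendsto_const[of "h0 z"] this] show ?case by simp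
  qed
  have "spectral_density F" "spectral_density G" using sd[OF D] by auto
  from mse_Fatou[OF a L2_measurable[OF L2K_L2[OF hK]] this lim m] show ?thesis .
qed

text \<open>The usual passage from a saddle point: the worst case of \<open>h0\<close> is its error
  at (F0,G0), there it beats every h in \<open>H_class\<close>, and the error of h at (F0,G0) is at
  most its own worst case.\<close>

lemma minimax_robust:
  assumes h0: "optimal_char T a F0 G0 h0" and H: "h0 \<in> H_class D T"
  shows "minimax_robust D T a h0"
  unfolding minimax_robust_def
proof (intro conjI H ballI)
  have m0: "mse T a h0 F0 G0 = ennreal M0"
    unfolding M0_def by (rule base.optimal_characterization(2)[OF h0 c0])
  have max: "mse T a h0 F G \<le> mse T a h0 F0 G0" if "(F, G) \<in> D" for F G
    unfolding m0 by (rule saddle_point[OF h0 that])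
  then show "\<exists>(F1, G1)\<in>D. \<forall>(F, G)\<in>D. mse T a h0 F G \<le> mse T a h0 F1 G1"
    using D0 by blast
  fix h assume h: "h \<in> H_class D T"
  have "(SUP (F, G)\<in>D. mse T a h0 F G) \<le> mse T a h0 F0 G0"
    using max by (intro SUP_least) auto
  also have "\<dots> \<le> mse T a h F0 G0"
    using h0 h D0 by (auto simp: optimal_char_def H_class_def)
  also have "\<dots> \<le> (SUP (F, G)\<in>D. mse T a h F G)"
    using SUP_upper[OF D0, of "\<lambda>(F, G). mse T a h F G"] by simp
  finally show "(SUP (F, G)\<in>D. mse T a h0 F G) \<le> (SUP (F, G)\<in>D. mse T a h F G)" .
qed

end

section \<open>Convexity of the admissible classes\<close>

lemma mean_mu_mixture:
  fixes \<phi> :: "complex ^ 'n ^ 'n::finite \<Rightarrow> 'b::{banach, second_countable_topology}"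
  assumes \<phi>: "bounded_linear \<phi>" and F: "spectral_density F" and F': "spectral_density F'"
    and p: "AE l in lborel. mean_mu (\<lambda>z. \<phi> (F z)) l = p l"
    and p': "AE l in lborel. mean_mu (\<lambda>z. \<phi> (F' z)) l = p l"
  shows "AE l in lborel. mean_mu (\<lambda>z. \<phi> (mixture \<epsilon> F F' z)) l = p l"
  using p p' plane_fst(1)[OF integrable_bounded_linear[OF \<phi> spectral_densityD(1)[OF F]]]
    plane_fst(1)[OF integrable_bounded_linear[OF \<phi> spectral_densityD(1)[OF F']]]
proof eventually_elim
  case (elim l)
  interpret \<phi>: bounded_linear \<phi> by fact
  have "mean_mu (\<lambda>z. \<phi> (mixture \<epsilon> F F' z)) l =
      (1 - \<epsilon>) *\<^sub>R mean_mu (\<lambda>z. \<phi> (F z)) l + \<epsilon> *\<^sub>R mean_mu (\<lambda>z. \<phi> (F' z)) l"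
    using elim(3,4) unfolding mean_mu_def mixture_def
    by (simp add: \<phi>.add \<phi>.scaleR scaleR_add_right mult.commute)
  then show ?case using elim(1,2) by (simp add: scaleR_add_left[symmetric])
qed

lemma convex_square:
  fixes x y :: real
  assumes "0 \<le> \<epsilon>" "\<epsilon> \<le> 1"
  shows "((1 - \<epsilon>) * x + \<epsilon> * y)\<^sup>2 \<le> (1 - \<epsilon>) * x\<^sup>2 + \<epsilon> * y\<^sup>2"
proof -
  have "(1 - \<epsilon>) * x\<^sup>2 + \<epsilon> * y\<^sup>2 - ((1 - \<epsilon>) * x + \<epsilon> * y)\<^sup>2 = \<epsilon> * (1 - \<epsilon>) * (x - y)\<^sup>2"
    by (simp add: power2_eq_square algebra_simps)
  also have "\<dots> \<ge> 0" using assms by simp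
  finally show ?thesis by simp
qed

text \<open>The centre \<open>G1\<close> is split with the same weights as the mixture, so convexity
  of the norm and of the square applies pointwise. The bound also provides integrability of the
  mixed deviation, which \<open>dev_le\<close> demands separately.\<close>

lemma dev_le_mixture:
  fixes \<phi> :: "complex ^ 'n ^ 'n::finite \<Rightarrow> 'b::{real_normed_vector, second_countable_topology}"
  assumes \<phi>: "bounded_linear \<phi>" and sd: "spectral_density G" "spectral_density G'" "spectral_density G1"
    and e: "0 < \<epsilon>" "\<epsilon> < 1"
    and d: "dev_le (\<lambda>z. norm (\<phi> (G z - G1 z))) d" and d': "dev_le (\<lambda>z. norm (\<phi> (G' z - G1 z))) d"
  shows "dev_le (\<lambda>z. norm (\<phi> (mixture \<epsilon> G G' z - G1 z))) d"
proof -
  interpret \<phi>: bounded_linear \<phi> by fact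
  note [measurable] = sd[THEN spectral_densityD(2)]
  have [measurable]: "\<phi> \<in> borel_measurable borel"
    by (intro borel_measurable_continuous_onI linear_continuous_on \<phi>)
  have pt: "(norm (\<phi> (mixture \<epsilon> G G' z - G1 z)))\<^sup>2 \<le>
      (1 - \<epsilon>) * (norm (\<phi> (G z - G1 z)))\<^sup>2 + \<epsilon> * (norm (\<phi> (G' z - G1 z)))\<^sup>2" for z
  proof -
    have "mixture \<epsilon> G G' z - G1 z = (1 - \<epsilon>) *\<^sub>R (G z - G1 z) + \<epsilon> *\<^sub>R (G' z - G1 z)"
      unfolding mixture_def by (simp add: algebra_simps)
    then have "norm (\<phi> (mixture \<epsilon> G G' z - G1 z)) \<le> (1 - \<epsilon>) * norm (\<phi> (G z - G1 z)) + \<epsilon> * norm (\<phi> (G' z - G1 z))"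
      using e norm_triangle_ineq[of "(1 - \<epsilon>) *\<^sub>R \<phi> (G z - G1 z)" "\<epsilon> *\<^sub>R \<phi> (G' z - G1 z)"]
      by (simp add: \<phi>.add \<phi>.scaleR)
    then have le: "(norm (\<phi> (mixture \<epsilon> G G' z - G1 z)))\<^sup>2 \<le> ((1 - \<epsilon>) * norm (\<phi> (G z - G1 z)) + \<epsilon> * norm (\<phi> (G' z - G1 z)))\<^sup>2"
      by (intro power_mono) auto
    show ?thesis by (rule order_trans[OF le convex_square]) (use e in auto)
  qed
  have m [measurable]: "(\<lambda>z. norm (\<phi> (mixture \<epsilon> G G' z - G1 z))) \<in> borel_measurable borel"
    unfolding mixture_def by measurable
  show ?thesis
    using d d' unfolding dev_le_def
  proof eventually_elim
    case (elim l)
    let ?f = "\<lambda>m. (1 - \<epsilon>) * (norm (\<phi> (G (l, m) - G1 (l, m))))\<^sup>2 + \<epsilon> * (norm (\<phi> (G' (l, m) - G1 (l, m))))\<^sup>2"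
    have i: "integrable lborel ?f" using elim by simp
    have mi: "integrable lborel (\<lambda>m. (norm (\<phi> (mixture \<epsilon> G G' (l, m) - G1 (l, m))))\<^sup>2)"
    proof (rule Bochner_Integration.integrable_bound[OF i])
      show "(\<lambda>m. (norm (\<phi> (mixture \<epsilon> G G' (l, m) - G1 (l, m))))\<^sup>2) \<in> borel_measurable lborel"
        using measurable_plane_section[OF m, of l] by simp
      show "AE m in lborel. norm ((norm (\<phi> (mixture \<epsilon> G G' (l, m) - G1 (l, m))))\<^sup>2) \<le> norm (?f m)"
        using pt by (intro AE_I2) (auto intro: order_trans[OF _ abs_ge_self])
    qed
    have "mean_mu (\<lambda>z. (norm (\<phi> (mixture \<epsilon> G G' z - G1 z)))\<^sup>2) l \<le> (1 / (2 * pi)) * (LINT m|lborel. ?f m)"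
      unfolding mean_mu_def using mi i pt by (auto intro!: mult_left_mono integral_mono divide_right_mono)
    also have "\<dots> = (1 - \<epsilon>) * mean_mu (\<lambda>z. (norm (\<phi> (G z - G1 z)))\<^sup>2) l + \<epsilon> * mean_mu (\<lambda>z. (norm (\<phi> (G' z - G1 z)))\<^sup>2) l"
    proof -
      have "(LINT m|lborel. ?f m) = (1 - \<epsilon>) * (LINT m|lborel. (norm (\<phi> (G (l, m) - G1 (l, m))))\<^sup>2)
          + \<epsilon> * (LINT m|lborel. (norm (\<phi> (G' (l, m) - G1 (l, m))))\<^sup>2)"
        using elim by simp
      then show ?thesis by (simp only: mean_mu_def real_scaleR_def distrib_left mult.left_commute)
    qed
    also have "\<dots> \<le> (1 - \<epsilon>) * d l + \<epsilon> * d l" using elim e by (intro add_mono mult_left_mono) auto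
    also have "\<dots> = d l" by (simp add: algebra_simps)
    finally show ?case using mi by simp
  qed
qed

text \<open>The linear maps by which the classes constrain a density: the trace for j = 1, entries
  and real parts of diagonal entries for j = 2, the product with a fixed matrix for j = 3, and
  single entries for the deviations of j = 4.\<close>

lemma bounded_linear_functionals:
  "bounded_linear (tr :: complex ^ 'n ^ 'n::finite \<Rightarrow> real)"
  "bounded_linear (\<lambda>M :: complex ^ 'n ^ 'n. M $ i $ j)"
  "bounded_linear (\<lambda>M :: complex ^ 'n ^ 'n. Re (M $ i $ j))"
  "bounded_linear (mat_ip B)"
  by (intro linear_conv_bounded_linear[THEN iffD1] linearI;
      simp add: tr_def trace_def mat_ip_def sum.distrib sum_distrib_left algebra_simps)+

lemma convex_between:
  fixes v u x y :: real
  assumes "v \<le> x" "x \<le> u" "v \<le> y" "y \<le> u" "0 < \<epsilon>" "\<epsilon> < 1"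
  shows "v \<le> (1 - \<epsilon>) * x + \<epsilon> * y" "(1 - \<epsilon>) * x + \<epsilon> * y \<le> u"
proof -
  have "(1 - \<epsilon>) * v \<le> (1 - \<epsilon>) * x" "\<epsilon> * v \<le> \<epsilon> * y" "(1 - \<epsilon>) * x \<le> (1 - \<epsilon>) * u" "\<epsilon> * y \<le> \<epsilon> * u"
    using assms by (auto intro: mult_left_mono)
  then show "v \<le> (1 - \<epsilon>) * x + \<epsilon> * y" "(1 - \<epsilon>) * x + \<epsilon> * y \<le> u"
    unfolding left_diff_distrib mult_1 by linarith+
qed

lemma between_mixture:
  fixes \<phi> :: "complex ^ 'n ^ 'n::finite \<Rightarrow> real"
  assumes \<phi>: "bounded_linear \<phi>" and e: "0 < \<epsilon>" "\<epsilon> < 1"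
    and F: "AE z in lborel. v z \<le> \<phi> (F z) \<and> \<phi> (F z) \<le> u z"
    and F': "AE z in lborel. v z \<le> \<phi> (F' z) \<and> \<phi> (F' z) \<le> u z"
  shows "AE z in lborel. v z \<le> \<phi> (mixture \<epsilon> F F' z) \<and> \<phi> (mixture \<epsilon> F F' z) \<le> u z"
  using F F'
proof eventually_elim
  case (elim z)
  interpret \<phi>: bounded_linear \<phi> by fact
  show ?case using convex_between[of "v z" "\<phi> (F z)" "u z" "\<phi> (F' z)" \<epsilon>] elim e
    by (simp add: mixture_def \<phi>.add \<phi>.scaleR)
qed

lemma DVU1_convex:
  assumes e: "0 < \<epsilon>" "\<epsilon> < 1" and "F \<in> DVU1 V U p" "F' \<in> DVU1 V U p"
  shows "mixture \<epsilon> F F' \<in> DVU1 V U p"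
  unfolding DVU1_def
proof (intro CollectI conjI)
  show "spectral_density (mixture \<epsilon> F F')"
    by (rule spectral_density_mixture[OF _ _ e]) (use assms in \<open>simp_all add: DVU1_def\<close>)
  show "AE z in lborel. tr (V z) \<le> tr (mixture \<epsilon> F F' z) \<and> tr (mixture \<epsilon> F F' z) \<le> tr (U z)"
    by (rule between_mixture[OF bounded_linear_functionals(1) e]) (use assms in \<open>simp_all add: DVU1_def\<close>)
  show "AE l in lborel. mean_mu (\<lambda>z. tr (mixture \<epsilon> F F' z)) l = p l"
    by (rule mean_mu_mixture[OF bounded_linear_functionals(1)]) (use assms in \<open>simp_all add: DVU1_def\<close>)
qed

lemma DVU2_convex:
  assumes e: "0 < \<epsilon>" "\<epsilon> < 1" and "F \<in> DVU2 V U p" "F' \<in> DVU2 V U p"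
  shows "mixture \<epsilon> F F' \<in> DVU2 V U p"
  unfolding DVU2_def
proof (intro CollectI conjI allI)
  show "spectral_density (mixture \<epsilon> F F')"
    by (rule spectral_density_mixture[OF _ _ e]) (use assms in \<open>simp_all add: DVU2_def\<close>)
  fix k
  show "AE z in lborel. Re (V z $ k $ k) \<le> Re (mixture \<epsilon> F F' z $ k $ k) \<and> Re (mixture \<epsilon> F F' z $ k $ k) \<le> Re (U z $ k $ k)"
    by (rule between_mixture[OF bounded_linear_functionals(3) e]) (use assms in \<open>simp_all add: DVU2_def\<close>)
  show "AE l in lborel. mean_mu (\<lambda>z. Re (mixture \<epsilon> F F' z $ k $ k)) l = p k l"
    by (rule mean_mu_mixture[OF bounded_linear_functionals(3)]) (use assms in \<open>simp_all add: DVU2_def\<close>)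
qed

lemma DVU3_convex:
  assumes e: "0 < \<epsilon>" "\<epsilon> < 1" and "F \<in> DVU3 B V U p" "F' \<in> DVU3 B V U p"
  shows "mixture \<epsilon> F F' \<in> DVU3 B V U p"
  unfolding DVU3_def
proof (intro CollectI conjI)
  show "spectral_density (mixture \<epsilon> F F')"
    by (rule spectral_density_mixture[OF _ _ e]) (use assms in \<open>simp_all add: DVU3_def\<close>)
  show "AE z in lborel. mat_ip B (V z) \<le> mat_ip B (mixture \<epsilon> F F' z) \<and> mat_ip B (mixture \<epsilon> F F' z) \<le> mat_ip B (U z)"
    by (rule between_mixture[OF bounded_linear_functionals(4) e]) (use assms in \<open>simp_all add: DVU3_def\<close>)
  show "AE l in lborel. mean_mu (\<lambda>z. mat_ip B (mixture \<epsilon> F F' z)) l = p l"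
    by (rule mean_mu_mixture[OF bounded_linear_functionals(4)]) (use assms in \<open>simp_all add: DVU3_def\<close>)
qed

text \<open>Here the bounds are inequalities of Hermitian matrices. The differences to V and U mix
  with the same weights, and nonnegative combinations of nonnegative definite matrices are
  nonnegative definite.\<close>

lemma DVU4_convex:
  assumes e: "0 < \<epsilon>" "\<epsilon> < 1" and F: "F \<in> DVU4 V U P" and F': "F' \<in> DVU4 V U P"
  shows "mixture \<epsilon> F F' \<in> DVU4 V U P"
proof -
  have "AE z in lborel. herm_le (V z) (F z) \<and> herm_le (F z) (U z)"
    "AE z in lborel. herm_le (V z) (F' z) \<and> herm_le (F' z) (U z)"
    using F F' by (auto simp: DVU4_def)
  then have "AE z in lborel. herm_le (V z) (mixture \<epsilon> F F' z) \<and> herm_le (mixture \<epsilon> F F' z) (U z)"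
  proof eventually_elim
    case (elim z)
    have "mixture \<epsilon> F F' z - V z = (1 - \<epsilon>) *\<^sub>R (F z - V z) + \<epsilon> *\<^sub>R (F' z - V z)"
      "U z - mixture \<epsilon> F F' z = (1 - \<epsilon>) *\<^sub>R (U z - F z) + \<epsilon> *\<^sub>R (U z - F' z)"
      unfolding mixture_def by (simp_all add: algebra_simps)
    then show ?case using elim e unfolding herm_le_def by (simp add: psd_add psd_scaleR)
  qed
  moreover have "AE l in lborel. mean_mu (\<lambda>z. mixture \<epsilon> F F' z) l = P l"
    by (rule mean_mu_mixture[OF bounded_linear_ident]) (use F F' in \<open>simp_all add: DVU4_def\<close>)
  moreover have "spectral_density (mixture \<epsilon> F F')"
    by (rule spectral_density_mixture[OF _ _ e]) (use F F' in \<open>simp_all add: DVU4_def\<close>)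
  ultimately show ?thesis unfolding DVU4_def by simp
qed

lemma D2d1_convex:
  assumes e: "0 < \<epsilon>" "\<epsilon> < 1" and G1: "spectral_density G1" and G: "G \<in> D2d1 G1 d" "G' \<in> D2d1 G1 d"
  shows "mixture \<epsilon> G G' \<in> D2d1 G1 d"
  using dev_le_mixture[OF bounded_linear_functionals(1) _ _ G1 e, of G G' d] G e
  unfolding D2d1_def by (auto intro!: spectral_density_mixture)

lemma D2d2_convex:
  assumes e: "0 < \<epsilon>" "\<epsilon> < 1" and G1: "spectral_density G1" and G: "G \<in> D2d2 G1 d" "G' \<in> D2d2 G1 d"
  shows "mixture \<epsilon> G G' \<in> D2d2 G1 d"
  using dev_le_mixture[OF bounded_linear_functionals(2) _ _ G1 e, of G G'] G e
  unfolding D2d2_def by (auto intro!: spectral_density_mixture)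

lemma D2d3_convex:
  assumes e: "0 < \<epsilon>" "\<epsilon> < 1" and G1: "spectral_density G1" and G: "G \<in> D2d3 B G1 d" "G' \<in> D2d3 B G1 d"
  shows "mixture \<epsilon> G G' \<in> D2d3 B G1 d"
  using dev_le_mixture[OF bounded_linear_functionals(4) _ _ G1 e, of G G' B d] G e
  unfolding D2d3_def by (auto intro!: spectral_density_mixture)

lemma D2d4_convex:
  assumes e: "0 < \<epsilon>" "\<epsilon> < 1" and G1: "spectral_density G1" and G: "G \<in> D2d4 G1 d" "G' \<in> D2d4 G1 d"
  shows "mixture \<epsilon> G G' \<in> D2d4 G1 d"
  using dev_le_mixture[OF bounded_linear_functionals(2) _ _ G1 e, of G G'] G e
  unfolding D2d4_def by (auto intro!: spectral_density_mixture)

theorem theorem1: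
  fixes T :: real and a :: "'n::finite vfield"
    and V U G1 F0 G0 :: "'n density"
    and B1 B2 :: "complex ^ 'n ^ 'n"
    and p \<delta> :: "real \<Rightarrow> real" and pk \<delta>k :: "'n \<Rightarrow> real \<Rightarrow> real"
    and P :: "real \<Rightarrow> complex ^ 'n ^ 'n" and \<delta>ij :: "'n \<Rightarrow> 'n \<Rightarrow> real \<Rightarrow> real"
    and D :: "('n density \<times> 'n density) set"
    and c0 :: "'n vfield"
  assumes T: "0 < T"
    and a: "set_integrable lborel (strip T) a"
    and VUG1: "spectral_density V" "spectral_density U" "spectral_density G1"
    and B12: "hermitian B1" "hermitian B2"
    and F0G0: "(F0, G0) \<in> D"
    and minimal: "minimality T F0 G0"
    and c0: "BinvRa T a F0 G0 c0"
    and relations: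
      "D = DVU1 V U p \<times> D2d1 G1 \<delta> \<and> relations1 T a V U G1 \<delta> F0 G0 c0 \<or>
       D = DVU2 V U pk \<times> D2d2 G1 \<delta>k \<and> relations2 T a V U G1 \<delta>k F0 G0 c0 \<or>
       D = DVU3 B1 V U p \<times> D2d3 B2 G1 \<delta> \<and> relations3 B1 B2 T a V U G1 \<delta> F0 G0 c0 \<or>
       D = DVU4 V U P \<times> D2d4 G1 \<delta>ij \<and> relations4 T a V U G1 \<delta>ij F0 G0 c0"
    and problem: "solves_problem D T a F0 G0 c0"
  shows "least_favorable D T a F0 G0 \<and>
    (\<forall>h0. optimal_char T a F0 G0 h0 \<and> h0 \<in> H_class D T \<longrightarrow>
      minimax_robust D T a h0 \<and>
      (AE z in lborel. h0 z =
        AK T a z v* (F0 z ** matrix_inv (F0 z + G0 z))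
        - strip_ft T c0 z v* matrix_inv (F0 z + G0 z)))"
proof -
  have sd: "spectral_density F \<and> spectral_density G" if "(F, G) \<in> D" for F G
    using that relations
    by (auto simp: DVU1_def DVU2_def DVU3_def DVU4_def D2d1_def D2d2_def D2d3_def D2d4_def)
  have conv: "(mixture \<epsilon> F F', mixture \<epsilon> G G') \<in> D"
    if "(F, G) \<in> D" "(F', G') \<in> D" "0 < \<epsilon>" "\<epsilon> < 1" for F G F' G' \<epsilon>
    using that relations VUG1(3)
    by (elim disjE)
      (auto intro: DVU1_convex DVU2_convex DVU3_convex DVU4_convex D2d1_convex D2d2_convex D2d3_convex D2d4_convex)
  \<comment> \<open>Minimality provides the invertibility of F0 + G0 almost everywhere, on which the
    pointwise bounds and the uniqueness of the optimum rest.\<close>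
  interpret convex_problem D T a F0 G0 c0
    using minimal a sd conv problem by unfold_locales (auto simp: minimality_def)
  have "AE z in lborel. h0 z = AK T a z v* (F0 z ** matrix_inv (F0 z + G0 z))
      - strip_ft T c0 z v* matrix_inv (F0 z + G0 z)" if "optimal_char T a F0 G0 h0" for h0
    using base.optimal_characterization(1)[OF that c0]
    by (simp add: base.wiener_def base.dual_def vector_matrix_mul_assoc)
  then show ?thesis using least_favorable minimax_robust by blast
qed

end
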